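(* Let $\varepsilon>0$, $\eta\in\mathbb R$, $\Omega=[0,\ell_x]\times[0,\ell_y]\times[0,\ell_z]$, and let $u:\Omega\times[0,\infty)\to\mathbb R$ be an exact solution of the Swift–Hohenberg equation $$\frac{\partial u}{\partial t}=-\left(u^3+(1-\eta)u+\varepsilon\Delta^2u+2\Delta u\right)$$ with boundary conditions $\nabla u\cdot\boldsymbol n=0$ and $\nabla(\Delta u)\cdot\boldsymbol n=0$ on $\partial\Omega$ ($\boldsymbol n$ the outward unit normal) and initial condition $u_0$. Suppose $u\in C^6$. Let $(U^{(n)})_{n\ge0}\subset L_{\mathrm d}^2$ be the solution of the scheme $$\frac{U^{(n+1)}-U^{(n)}}{\Delta t}=\begin{cases}-\left[(U^{(n)})^3+\left\{(1-\eta)U^{(n+1)}+\varepsilon\Delta_{\mathrm d}^2U^{(n+1)}\right\}+2\Delta_{\mathrm d}U^{(n)}\right]&(\eta<1),\\-\left[(U^{(n)})^3+\varepsilon\Delta_{\mathrm d}^2U^{(n+1)}-\left\{(\eta-1)U^{(n)}-2\Delta_{\mathrm d}U^{(n)}\right\}\right]&(\eta\ge1),\end{cases}$$ with the discrete Neumann boundary conditions, and assume $U_{i,j,k}^{(0)}=u_0(i\Delta x,j\Delta y,k\Delta z)$ for all grid indices $(i,j,k)$. For any $\zeta>\frac1\varepsilon+\eta-1$ let $$C_{\varepsilon,\eta,\zeta}=\frac{\varepsilon+1-\eta+\zeta-\sqrt{(\varepsilon-1+\eta-\zeta)^2+4}}{6},$$ $$M=\max\left\{\sqrt{\max\{0,\zeta\}},\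 \sqrt{\frac{C^2}{C_{\varepsilon,\eta,\zeta}}\left(H(U^{(0)})+\frac{\zeta^2}{4}\ell_x\ell_y\ell_z\right)}\right\},$$ $$M'=\max\left\{M,\ \sqrt{\frac{C'^2}{C_{\varepsilon,\eta,\zeta}}\left(H_{\mathrm{true}}(u_0)+\frac{\zeta^2}{4}|\Omega|\right)}\right\}.$$ Assume that $\hat L:=3M'^2-|1-\eta|\ne0$. Then, if either $\hat L<0$, or $\hat L>0$ and $\Delta t<\frac{2}{\hat L}$, and if moreover $\Delta t$ satisfies the condition "$3M^2\le|1-\eta|$, or $3M^2>|1-\eta|$ and $\Delta t\le\frac{2}{3M^2-|1-\eta|}$", the numerical solution converges to the exact solution with rate $O(\Delta t+(\Delta x)^2+(\Delta y)^2+(\Delta z)^2)$ in the discrete $L^2$ norm. That is, for each fixed $T>0$ and $n\Delta t=T$, the error $e^{(n)}_{i,j,k}=U^{(n)}_{i,j,k}-u(i\Delta x,j\Delta y,k\Delta z,n\Delta t)$ satisfies $$\|e^{(n)}\|_{L_{\mathrm d}^2}=O\left(\Delta t+(\Delta x)^2+(\Delta y)^2+(\Delta z)^2\right)$$ as $\Delta t,\Delta x,\Delta y,\Delta z\to0$ within discretizations for which $\hat L\ne0$, either $\hat L<0$ or ($\hat L>0$ and $\Delta t<\frac{2}{\hat L}$), and either $3M^2\le|1-\eta|$ or ($3M^2>|1-\eta|$ and $\Delta t\le\frac{2}{3M^2-|1-\eta|}$).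
   Context: Lengths $\ell_x,\ell_y,\ell_z>0$ are fixed; for positive integers $N_x,N_y,N_z$ the mesh sizes are $\Delta x=\ell_x/N_x$, $\Delta y=\ell_y/N_y$, $\Delta z=\ell_z/N_z$; $\Delta t>0$ is the time step; $|\Omega|=\ell_x\ell_y\ell_z$. $L_{\mathrm d}^2$ is the real vector space of arrays $U=(U_{i,j,k})$ with $0\le i\le N_x$, $0\le j\le N_y$, $0\le k\le N_z$. Write $\sum''_{i=0}^{N}a_i=\frac{a_0}{2}+a_1+\dots+a_{N-1}+\frac{a_N}{2}$ and $\sum''_{i,j,k}=\sum''_{i=0}^{N_x}\sum''_{j=0}^{N_y}\sum''_{k=0}^{N_z}$. Norms: $\|U\|_{L_{\mathrm d}^2}=\left(\sum''_{i,j,k}U_{i,j,k}^2\Delta x\Delta y\Delta z\right)^{1/2}$ and $\|U\|_{L_{\mathrm d}^\infty}=\max_{i,j,k}|U_{i,j,k}|$ over the grid. "$u\in C^6$" means $u$ is $C^6$ on $\Omega\times[0,\infty)$. Difference operators: $\delta_i^+f_{i,j,k}=\frac{f_{i+1,j,k}-f_{i,j,k}}{\Delta x}$, $\delta_i^-f_{i,j,k}=\frac{f_{i,j,k}-f_{i-1,j,k}}{\Delta x}$, $\delta_i^{\langle1\rangle}f_{i,j,k}=\frac{f_{i+1,j,k}-f_{i-1,j,k}}{2\Delta x}$, and analogously in $j$ (with $\Delta y$) and $k$ (with $\Delta z$). $\nabla_{\mathrm d}^{\pm}=(\delta_i^{\pm},\delta_j^{\pm},\delta_k^{\pm})$, $\Delta_{\mathrm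 d}=\nabla_{\mathrm d}^+\cdot\nabla_{\mathrm d}^-=\delta_i^+\delta_i^-+\delta_j^+\delta_j^-+\delta_k^+\delta_k^-$, $\Delta_{\mathrm d}^2=\Delta_{\mathrm d}\Delta_{\mathrm d}$. Seminorm: $\|\mathrm DU\|_{L_{\mathrm d}^2}=\left(\sum''_{i,j,k}\frac{|\nabla_{\mathrm d}^+U_{i,j,k}|^2+|\nabla_{\mathrm d}^-U_{i,j,k}|^2}{2}\Delta x\Delta y\Delta z\right)^{1/2}$. The cube $U^3$ is entrywise. Discrete Neumann boundary conditions: $\delta_i^{\langle1\rangle}U_{i,j,k}=\delta_i^{\langle1\rangle}\Delta_{\mathrm d}U_{i,j,k}=0$ at $i=0,N_x$; $\delta_j^{\langle1\rangle}U_{i,j,k}=\delta_j^{\langle1\rangle}\Delta_{\mathrm d}U_{i,j,k}=0$ at $j=0,N_y$; $\delta_k^{\langle1\rangle}U_{i,j,k}=\delta_k^{\langle1\rangle}\Delta_{\mathrm d}U_{i,j,k}=0$ at $k=0,N_z$. These determine the values of $U$ at exterior (ghost) indices: they amount to even reflection in each index, $U_{-p,j,k}=U_{p,j,k}$, $U_{N_x+p,j,k}=U_{N_x-p,j,k}$ for $p=1,2$, and similarly in $j,k$. Elements of $L_{\mathrm d}^2$ are extended in this way whenever difference operators are applied. Energies: $$H(U)=\sum''_{i,j,k}\left(\frac14U_{i,j,k}^4+\frac{1-\eta}{2}U_{i,j,k}^2-\frac{|\nabla_{\mathrm d}^+U_{i,j,k}|^2+|\nabla_{\mathrm d}^-U_{i,j,k}|^2}{2}+\frac\varepsilon2(\Delta_{\mathrm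 d}U_{i,j,k})^2\right)\Delta x\Delta y\Delta z,$$ $$H_{\mathrm{true}}(v)=\int_\Omega\left(\frac14v^4+\frac{1-\eta}{2}v^2+\frac\varepsilon2(\Delta v)^2-|\nabla v|^2\right)d\boldsymbol x.$$ $C>0$ is a discrete Sobolev constant (independent of the mesh): $\|U\|_{L_{\mathrm d}^\infty}\le C\sqrt{\|U\|_{L_{\mathrm d}^2}^2+\|\mathrm DU\|_{L_{\mathrm d}^2}^2+\|\Delta_{\mathrm d}U\|_{L_{\mathrm d}^2}^2}$ for all grid functions satisfying the discrete Neumann boundary conditions; such a constant exists and is fixed. $C'>0$ is a Sobolev constant of $\Omega$: $\max_\Omega|v|\le C'\left(\int_\Omega(v^2+|\nabla v|^2+(\Delta v)^2)\,d\boldsymbol x\right)^{1/2}$ for all sufficiently smooth $v$ on $\Omega$ with $\nabla v\cdot\boldsymbol n=0$ and $\nabla(\Delta v)\cdot\boldsymbol n=0$ on $\partial\Omega$; with it the exact solution satisfies $\max_\Omega|u(\cdot,t)|\le\sqrt{\frac{C'^2}{C_{\varepsilon,\eta,\zeta}}\left(H_{\mathrm{true}}(u_0)+\frac{\zeta^2}{4}|\Omega|\right)}$ for all $t\ge0$. *)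

theory Defs
  imports "HOL-Analysis.Analysis"
begin

section \<open>The continuous problem\<close>

type_synonym point = "real \<times> real \<times> real"

text \<open>
  Derivatives are taken within the (closed) domain, so they are one-sided at boundary points.
  All domains used below are convex with nonempty interior, so these derivatives are unique.
\<close>

primrec Ck_on :: "nat \<Rightarrow> ('a::euclidean_space \<Rightarrow> real) \<Rightarrow> 'a set \<Rightarrow> bool" where
  "Ck_on 0 f S \<longleftrightarrow> continuous_on S f"
| "Ck_on (Suc k) f S \<longleftrightarrow> f differentiable_on S \<and>
     (\<forall>v. Ck_on k (\<lambda>x. frechet_derivative f (at x within S) v) S)"

fun Omega :: "point \<Rightarrow> point set" where
  "Omega (lx, ly, lz) = {0..lx} \<times> {0..ly} \<times> {0..lz}"

fun vol :: "point \<Rightarrow> real" where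
  "vol (lx, ly, lz) = lx * ly * lz"

definition partial :: "point set \<Rightarrow> point \<Rightarrow> (point \<Rightarrow> real) \<Rightarrow> point \<Rightarrow> real" where
  "partial S b v x = frechet_derivative v (at x within S) b"

definition grad :: "point set \<Rightarrow> (point \<Rightarrow> real) \<Rightarrow> point \<Rightarrow> point" where
  "grad S v x = (partial S (1, 0, 0) v x, partial S (0, 1, 0) v x, partial S (0, 0, 1) v x)"

definition lap :: "point set \<Rightarrow> (point \<Rightarrow> real) \<Rightarrow> point \<Rightarrow> real" where
  "lap S v x = partial S (1, 0, 0) (partial S (1, 0, 0) v) x
     + partial S (0, 1, 0) (partial S (0, 1, 0) v) x
     + partial S (0, 0, 1) (partial S (0, 0, 1) v) x"

text \<open>
  Outward unit normals of the faces of the box through a boundary point: on edges and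
  corners, the normal of each adjacent face is included.
\<close>

fun outward_normals :: "point \<Rightarrow> point \<Rightarrow> point set" where
  "outward_normals (lx, ly, lz) (x, y, z) =
     {n. x = 0 \<and> n = (-1, 0, 0) \<or> x = lx \<and> n = (1, 0, 0)
       \<or> y = 0 \<and> n = (0, -1, 0) \<or> y = ly \<and> n = (0, 1, 0)
       \<or> z = 0 \<and> n = (0, 0, -1) \<or> z = lz \<and> n = (0, 0, 1)}"

definition neumann :: "point \<Rightarrow> (point \<Rightarrow> real) \<Rightarrow> bool" where
  "neumann l v \<longleftrightarrow> (\<forall>x\<in>Omega l. \<forall>n\<in>outward_normals l x. inner (grad (Omega l) v x) n = 0)"

text \<open>At time \<open>0\<close> the time derivative is one-sided.\<close>

definition SH_exact_solution ::
  "real \<Rightarrow> real \<Rightarrow> point \<Rightarrow> (point \<Rightarrow> real) \<Rightarrow> (point \<Rightarrow> real \<Rightarrow> real) \<Rightarrow> bool" where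
  "SH_exact_solution \<epsilon> \<eta> l u0 u \<longleftrightarrow>
     (\<forall>x\<in>Omega l. \<forall>t\<ge>0.
        ((\<lambda>s. u x s) has_real_derivative
           - ((u x t)^3 + (1 - \<eta>) * u x t
              + \<epsilon> * lap (Omega l) (lap (Omega l) (\<lambda>y. u y t)) x
              + 2 * lap (Omega l) (\<lambda>y. u y t) x))
          (at t within {0..})) \<and>
     (\<forall>t\<ge>0. neumann l (\<lambda>y. u y t) \<and> neumann l (lap (Omega l) (\<lambda>y. u y t))) \<and>
     (\<forall>x\<in>Omega l. u x 0 = u0 x)"

definition H_true :: "real \<Rightarrow> real \<Rightarrow> point \<Rightarrow> (point \<Rightarrow> real) \<Rightarrow> real" where
  "H_true \<epsilon> \<eta> l v = integral (Omega l)
     (\<lambda>x. 1/4 * (v x)^4 + (1 - \<eta>)/2 * (v x)^2 + \<epsilon>/2 * (lap (Omega l) v x)^2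
          - (norm (grad (Omega l) v x))^2)"

definition sobolev_const :: "point \<Rightarrow> real \<Rightarrow> bool" where
  "sobolev_const l C' \<longleftrightarrow> C' > 0 \<and>
     (\<forall>v. Ck_on 6 v (Omega l) \<and> neumann l v \<and> neumann l (lap (Omega l) v) \<longrightarrow>
        (\<forall>x\<in>Omega l. \<bar>v x\<bar> \<le> C' * sqrt (integral (Omega l)
           (\<lambda>y. (v y)^2 + (norm (grad (Omega l) v y))^2 + (lap (Omega l) v y)^2))))"


section \<open>Grid functions\<close>

text \<open>
  An element of the discrete space is represented by a function on the whole integer lattice of
  which only the values at grid indices matter: every operation below either reads only
  grid values or first applies \<open>neumann_ext\<close>, which overwrites all other values.
\<close>

type_synonym gridfun = "int \<Rightarrow> int \<Rightarrow> int \<Rightarrow> real"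

fun mesh :: "point \<Rightarrow> nat \<times> nat \<times> nat \<Rightarrow> point" where
  "mesh (lx, ly, lz) (Nx, Ny, Nz) = (lx / real Nx, ly / real Ny, lz / real Nz)"

fun grid :: "nat \<times> nat \<times> nat \<Rightarrow> (int \<times> int \<times> int) set" where
  "grid (Nx, Ny, Nz) = {0..int Nx} \<times> {0..int Ny} \<times> {0..int Nz}"

fun node :: "point \<Rightarrow> int \<Rightarrow> int \<Rightarrow> int \<Rightarrow> point" where
  "node (dx, dy, dz) i j k = (real_of_int i * dx, real_of_int j * dy, real_of_int k * dz)"

definition fwd :: "real \<Rightarrow> (int \<Rightarrow> real) \<Rightarrow> int \<Rightarrow> real" where
  "fwd d f i = (f (i + 1) - f i) / d"

definition bwd :: "real \<Rightarrow> (int \<Rightarrow> real) \<Rightarrow> int \<Rightarrow> real" where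
  "bwd d f i = (f i - f (i - 1)) / d"

definition ctr :: "real \<Rightarrow> (int \<Rightarrow> real) \<Rightarrow> int \<Rightarrow> real" where
  "ctr d f i = (f (i + 1) - f (i - 1)) / (2 * d)"

fun grad_plus :: "point \<Rightarrow> gridfun \<Rightarrow> int \<Rightarrow> int \<Rightarrow> int \<Rightarrow> point" where
  "grad_plus (dx, dy, dz) U i j k =
     (fwd dx (\<lambda>i. U i j k) i, fwd dy (\<lambda>j. U i j k) j, fwd dz (\<lambda>k. U i j k) k)"

fun grad_minus :: "point \<Rightarrow> gridfun \<Rightarrow> int \<Rightarrow> int \<Rightarrow> int \<Rightarrow> point" where
  "grad_minus (dx, dy, dz) U i j k =
     (bwd dx (\<lambda>i. U i j k) i, bwd dy (\<lambda>j. U i j k) j, bwd dz (\<lambda>k. U i j k) k)"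

fun lap_d :: "point \<Rightarrow> gridfun \<Rightarrow> gridfun" where
  "lap_d (dx, dy, dz) U i j k =
     fwd dx (bwd dx (\<lambda>i. U i j k)) i + fwd dy (bwd dy (\<lambda>j. U i j k)) j
     + fwd dz (bwd dz (\<lambda>k. U i j k)) k"

text \<open>
  Even reflection at \<open>0\<close> and at \<open>N\<close>; the resulting extension is \<open>2N\<close>-periodic, which also covers
  \<open>N = 1\<close>, where ghost indices such as \<open>-2\<close> need more than one reflection.
\<close>

definition fold_index :: "nat \<Rightarrow> int \<Rightarrow> int" where
  "fold_index N i = (let m = i mod (2 * int N) in if m \<le> int N then m else 2 * int N - m)"

fun neumann_ext :: "nat \<times> nat \<times> nat \<Rightarrow> gridfun \<Rightarrow> gridfun" where
  "neumann_ext (Nx, Ny, Nz) U i j k = U (fold_index Nx i) (fold_index Ny j) (fold_index Nz k)"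

fun discrete_neumann :: "point \<Rightarrow> nat \<times> nat \<times> nat \<Rightarrow> gridfun \<Rightarrow> bool" where
  "discrete_neumann (dx, dy, dz) (Nx, Ny, Nz) F \<longleftrightarrow>
     (\<forall>G\<in>{F, lap_d (dx, dy, dz) F}.
       (\<forall>i\<in>{0, int Nx}. \<forall>j k. ctr dx (\<lambda>i. G i j k) i = 0) \<and>
       (\<forall>j\<in>{0, int Ny}. \<forall>i k. ctr dy (\<lambda>j. G i j k) j = 0) \<and>
       (\<forall>k\<in>{0, int Nz}. \<forall>i j. ctr dz (\<lambda>k. G i j k) k = 0))"

text \<open>
  The two lemmas below justify encoding the discrete Neumann conditions by \<open>neumann_ext\<close>: the
  extension satisfies them, and they determine all ghost values that the second power of the
  discrete Laplacian reads at grid points.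
\<close>

lemma fold_index_minus: "N > 0 \<Longrightarrow> fold_index N (- i) = fold_index N i"
  by (auto simp: fold_index_def Let_def zmod_zminus1_eq_if)

lemma fold_index_reflect: "N > 0 \<Longrightarrow> fold_index N (int N + i) = fold_index N (int N - i)"
proof -
  assume N: "N > 0"
  have "(int N + i) mod (2 * int N) = (2 * int N - (int N - i)) mod (2 * int N)"
    by simp
  also have "\<dots> = (- (int N - i)) mod (2 * int N)"
    by (metis add_uminus_conv_diff mod_add_self1)
  finally have "fold_index N (int N + i) = fold_index N (- (int N - i))"
    unfolding fold_index_def by simp
  then show ?thesis
    using fold_index_minus[OF N, of "int N - i"] by simp
qed

lemma fold_index_id: "0 \<le> i \<Longrightarrow> i \<le> int N \<Longrightarrow> N > 0 \<Longrightarrow> fold_index N i = i"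
  by (auto simp: fold_index_def Let_def)

lemma neumann_ext_bc:
  assumes "Nx > 0" "Ny > 0" "Nz > 0"
  shows "discrete_neumann (dx, dy, dz) (Nx, Ny, Nz) (neumann_ext (Nx, Ny, Nz) U)"
proof -
  have *: "fold_index N (-1) = fold_index N 1" "fold_index N (-2) = fold_index N 2"
    "fold_index N (int N + 1) = fold_index N (int N - 1)"
    "fold_index N (int N + 2) = fold_index N (int N - 2)" if "N > 0" for N
    using that fold_index_minus[of N 1] fold_index_minus[of N 2]
      fold_index_reflect[of N 1] fold_index_reflect[of N 2] by auto
  show ?thesis
    using *[OF assms(1)] *[OF assms(2)] *[OF assms(3)]
    by (simp add: ctr_def fwd_def bwd_def algebra_simps flip: diff_divide_distrib add_divide_distrib)
qed

lemma neumann_ext_unique: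
  assumes bc: "discrete_neumann (dx, dy, dz) (Nx, Ny, Nz) F"
    and N: "Nx > 0" "Ny > 0" "Nz > 0" and d: "dx > 0" "dy > 0" "dz > 0"
    and ijk: "i \<in> {-2..int Nx + 2}" "j \<in> {-2..int Ny + 2}" "k \<in> {-2..int Nz + 2}"
  shows "F i j k = neumann_ext (Nx, Ny, Nz) F i j k"
proof -
  have one_dim: "f i = f (fold_index N i)"
    if asm: "N > 0" "i \<in> {-2..int N + 2}" "f (-1) = f 1" "f (-2) = f 2"
      "f (int N + 1) = f (int N - 1)" "f (int N + 2) = f (int N - 2)"
    for f :: "int \<Rightarrow> real" and N i
  proof -
    consider "i \<in> {0..int N}" | "i = -1" | "i = -2" | "i = int N + 1" | "i = int N + 2"
      using asm(2) by fastforce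
    then show ?thesis
    proof cases
      case 1 then show ?thesis using asm(1) by (simp add: fold_index_id)
    next
      case 2 then show ?thesis
        using asm fold_index_minus[of N 1] by (simp add: fold_index_id)
    next
      case 3
      show ?thesis
      proof (cases "N = 1")
        case True
        then show ?thesis using 3 asm by (simp add: fold_index_def)
      next
        case False
        then show ?thesis using 3 asm fold_index_minus[of N 2] by (simp add: fold_index_id)
      qed
    next
      case 4 then show ?thesis
        using asm fold_index_reflect[of N 1] by (simp add: fold_index_id)
    next
      case 5
      show ?thesis
      proof (cases "N = 1")
        case True
        then show ?thesis using 5 asm by (simp add: fold_index_def)
      next
        case False
        then show ?thesis using 5 asm fold_index_reflect[of N 2] by (simp add: fold_index_id)
      qed
    qed
  qed
  have x1: "F (-1) j k = F 1 j k" "F (int Nx + 1) j k = F (int Nx - 1) j k" for j k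
    using bc d by (auto simp: ctr_def)
  have y1: "F i (-1) k = F i 1 k" "F i (int Ny + 1) k = F i (int Ny - 1) k" for i k
    using bc d by (auto simp: ctr_def)
  have z1: "F i j (-1) = F i j 1" "F i j (int Nz + 1) = F i j (int Nz - 1)" for i j
    using bc d by (auto simp: ctr_def)
  let ?L = "lap_d (dx, dy, dz) F"
  have Lx: "?L 1 j k = ?L (-1) j k" "?L (int Nx + 1) j k = ?L (int Nx - 1) j k" for j k
    using bc d by (auto simp: ctr_def simp del: lap_d.simps)
  have Ly: "?L i 1 k = ?L i (-1) k" "?L i (int Ny + 1) k = ?L i (int Ny - 1) k" for i k
    using bc d by (auto simp: ctr_def simp del: lap_d.simps)
  have Lz: "?L i j 1 = ?L i j (-1)" "?L i j (int Nz + 1) = ?L i j (int Nz - 1)" for i j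
    using bc d by (auto simp: ctr_def simp del: lap_d.simps)
  have comm: "1 + int N = int N + 1" "2 + int N = int N + 2" for N by simp_all
  have x2: "F (-2) j k = F 2 j k" "F (int Nx + 2) j k = F (int Nx - 2) j k" for j k
    using Lx[of j k] d by (simp_all add: x1 comm fwd_def bwd_def flip: diff_divide_distrib add_divide_distrib)
  have y2: "F i (-2) k = F i 2 k" "F i (int Ny + 2) k = F i (int Ny - 2) k" for i k
    using Ly[of i k] d by (simp_all add: y1 comm fwd_def bwd_def flip: diff_divide_distrib add_divide_distrib)
  have z2: "F i j (-2) = F i j 2" "F i j (int Nz + 2) = F i j (int Nz - 2)" for i j
    using Lz[of i j] d by (simp_all add: z1 comm fwd_def bwd_def flip: diff_divide_distrib add_divide_distrib)
  have "F i j k = F (fold_index Nx i) j k"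
    using one_dim[of Nx i "\<lambda>i. F i j k"] N ijk x1 x2 by simp
  also have "\<dots> = F (fold_index Nx i) (fold_index Ny j) k"
    using one_dim[of Ny j "\<lambda>j. F (fold_index Nx i) j k"] N ijk y1 y2 by simp
  also have "\<dots> = F (fold_index Nx i) (fold_index Ny j) (fold_index Nz k)"
    using one_dim[of Nz k "\<lambda>k. F (fold_index Nx i) (fold_index Ny j) k"] N ijk z1 z2 by simp
  finally show ?thesis by simp
qed


section \<open>Discrete norms and energy\<close>

definition tsum :: "nat \<Rightarrow> (int \<Rightarrow> real) \<Rightarrow> real" where
  "tsum N a = a 0 / 2 + (\<Sum>i\<in>{1..int N - 1}. a i) + a (int N) / 2"

fun tsum3 :: "nat \<times> nat \<times> nat \<Rightarrow> gridfun \<Rightarrow> real" where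
  "tsum3 (Nx, Ny, Nz) F = tsum Nx (\<lambda>i. tsum Ny (\<lambda>j. tsum Nz (\<lambda>k. F i j k)))"

definition L2_norm_d :: "point \<Rightarrow> nat \<times> nat \<times> nat \<Rightarrow> gridfun \<Rightarrow> real" where
  "L2_norm_d l N U = sqrt (tsum3 N (\<lambda>i j k. (U i j k)^2 * vol (mesh l N)))"

definition Linf_norm_d :: "nat \<times> nat \<times> nat \<Rightarrow> gridfun \<Rightarrow> real" where
  "Linf_norm_d N U = Max ((\<lambda>(i, j, k). \<bar>U i j k\<bar>) ` grid N)"

definition grad_sq_d :: "point \<Rightarrow> nat \<times> nat \<times> nat \<Rightarrow> gridfun \<Rightarrow> gridfun" where
  "grad_sq_d l N U i j k =
     ((norm (grad_plus (mesh l N) (neumann_ext N U) i j k))^2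
      + (norm (grad_minus (mesh l N) (neumann_ext N U) i j k))^2) / 2"

definition D_seminorm_d :: "point \<Rightarrow> nat \<times> nat \<times> nat \<Rightarrow> gridfun \<Rightarrow> real" where
  "D_seminorm_d l N U = sqrt (tsum3 N (\<lambda>i j k. grad_sq_d l N U i j k * vol (mesh l N)))"

definition H_d :: "real \<Rightarrow> real \<Rightarrow> point \<Rightarrow> nat \<times> nat \<times> nat \<Rightarrow> gridfun \<Rightarrow> real" where
  "H_d \<epsilon> \<eta> l N U = tsum3 N (\<lambda>i j k.
     (1/4 * (U i j k)^4 + (1 - \<eta>)/2 * (U i j k)^2 - grad_sq_d l N U i j k
      + \<epsilon>/2 * (lap_d (mesh l N) (neumann_ext N U) i j k)^2) * vol (mesh l N))"

definition discrete_sobolev_const :: "point \<Rightarrow> real \<Rightarrow> bool" where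
  "discrete_sobolev_const l C \<longleftrightarrow> C > 0 \<and>
     (\<forall>Nx > 0. \<forall>Ny > 0. \<forall>Nz > 0. \<forall>U. let N = (Nx, Ny, Nz) in
        Linf_norm_d N U \<le> C * sqrt ((L2_norm_d l N U)^2 + (D_seminorm_d l N U)^2
          + (L2_norm_d l N (lap_d (mesh l N) (neumann_ext N U)))^2))"


section \<open>The scheme and the constants\<close>

definition SH_scheme ::
  "real \<Rightarrow> real \<Rightarrow> point \<Rightarrow> nat \<times> nat \<times> nat \<Rightarrow> real \<Rightarrow> (nat \<Rightarrow> gridfun) \<Rightarrow> bool" where
  "SH_scheme \<epsilon> \<eta> l N dt U \<longleftrightarrow>
     (\<forall>n. \<forall>(i, j, k)\<in>grid N.
        let V = U n; W = U (n + 1);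
            LV = lap_d (mesh l N) (neumann_ext N V);
            LLW = lap_d (mesh l N) (lap_d (mesh l N) (neumann_ext N W))
        in (W i j k - V i j k) / dt =
          (if \<eta> < 1
           then - ((V i j k)^3 + ((1 - \<eta>) * W i j k + \<epsilon> * LLW i j k) + 2 * LV i j k)
           else - ((V i j k)^3 + \<epsilon> * LLW i j k - ((\<eta> - 1) * V i j k - 2 * LV i j k))))"

definition C_const :: "real \<Rightarrow> real \<Rightarrow> real \<Rightarrow> real" where
  "C_const \<epsilon> \<eta> \<zeta> = (\<epsilon> + 1 - \<eta> + \<zeta> - sqrt ((\<epsilon> - 1 + \<eta> - \<zeta>)^2 + 4)) / 6"

definition M_const ::
  "real \<Rightarrow> real \<Rightarrow> real \<Rightarrow> real \<Rightarrow> point \<Rightarrow> nat \<times> nat \<times> nat \<Rightarrow> gridfun \<Rightarrow> real" where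
  "M_const C \<epsilon> \<eta> \<zeta> l N U0 =
     max (sqrt (max 0 \<zeta>)) (sqrt (C^2 / C_const \<epsilon> \<eta> \<zeta> * (H_d \<epsilon> \<eta> l N U0 + \<zeta>^2 / 4 * vol l)))"

definition M'_const ::
  "real \<Rightarrow> real \<Rightarrow> real \<Rightarrow> real \<Rightarrow> real \<Rightarrow> point \<Rightarrow> nat \<times> nat \<times> nat \<Rightarrow> gridfun
   \<Rightarrow> (point \<Rightarrow> real) \<Rightarrow> real" where
  "M'_const C C' \<epsilon> \<eta> \<zeta> l N U0 u0 =
     max (M_const C \<epsilon> \<eta> \<zeta> l N U0)
         (sqrt (C'^2 / C_const \<epsilon> \<eta> \<zeta> * (H_true \<epsilon> \<eta> l u0 + \<zeta>^2 / 4 * vol l)))"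

end

theory Submission
  imports Defs
begin

text \<open>
  Boundedness of the numerical solution: replace \<open>x^4 / 4\<close> beyond \<open>M\<close> by a parabola of the same
  value, slope and curvature. The modified energy decreases along the scheme under the step-size
  condition, and the discrete Sobolev inequality turns an energy bound into \<open>\<bar>U n i j k\<bar> \<le> M\<close>, where
  the modification is invisible. Since \<open>u0\<close> is smooth, \<open>M\<close> is bounded independently of the mesh.

  Consistency: differentiating the equation in the normal direction shows that the first, third and fifth
  normal derivatives of \<open>u\<close> vanish on the faces, so the even reflection of \<open>u\<close> has six
  derivatives in each variable and Taylor expansion is second-order accurate up to the boundary.

  Convergence: testing the error equation with the new error, the implicit bilaplacian absorbs the
  explicit Laplacian, and the discrete Gronwall inequality concludes.
\<close>

section \<open>Trapezoidal sums and even grid functions\<close>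

text \<open>The nonlinearity is explicit, so an energy estimate with the plain quartic would need a
  bound on the very iterate it is meant to bound; this circularity is the reason for changing the
  potential. For consistency, the Neumann conditions speak of normal derivatives of order one and
  three only, whereas composing two second differences calls for six derivatives of the reflected
  function: the Taylor error of the inner difference must itself be differentiated twice, since
  dividing its mere size by the square of the outer step would destroy the order. The condition of
  order five therefore has to be won from the equation. Derivatives are taken within the closed
  cylinder, one-sided on its boundary, so the symmetry of mixed derivatives has to be proved there
  as well. The final constants depend on suprema of derivatives over \<open>[0, T]\<close> and on a
  bound for \<open>M\<close>, all fixed before the mesh. The smallness threshold keeps two ghost
  layers within a single reflection and the factor in front of the new error at least one
  half.\<close>

definition tsum_weight :: "nat \<Rightarrow> int \<Rightarrow> real" where
  "tsum_weight N i = (if i = 0 \<or> i = int N then 1/2 else 1)"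

lemma tsum_weight_pos: "tsum_weight N i > 0"
  by (simp add: tsum_weight_def)

lemma tsum_eq_weighted:
  assumes "N > 0"
  shows "tsum N a = (\<Sum>i\<in>{0..int N}. tsum_weight N i * a i)"
proof -
  have *: "{0..int N} = insert 0 (insert (int N) {1..int N - 1})" using assms by auto
  have "(\<Sum>i\<in>{1..int N - 1}. tsum_weight N i * a i) = (\<Sum>i\<in>{1..int N - 1}. a i)"
    by (rule sum.cong) (auto simp: tsum_weight_def)
  then show ?thesis
    unfolding * using assms by (simp add: tsum_def tsum_weight_def)
qed

lemma tsum_add: "tsum N (\<lambda>i. a i + b i) = tsum N a + tsum N b"
  by (simp add: tsum_def sum.distrib add_divide_distrib)

lemma tsum_cmult: "tsum N (\<lambda>i. c * a i) = c * tsum N a"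
  by (simp add: tsum_def sum_distrib_left algebra_simps)

lemma tsum_cong:
  assumes "N > 0" "\<And>i. 0 \<le> i \<Longrightarrow> i \<le> int N \<Longrightarrow> a i = b i"
  shows "tsum N a = tsum N b"
  using assms by (simp add: tsum_eq_weighted)

lemma tsum_mono:
  assumes "N > 0" "\<And>i. 0 \<le> i \<Longrightarrow> i \<le> int N \<Longrightarrow> a i \<le> b i"
  shows "tsum N a \<le> tsum N b"
  unfolding tsum_eq_weighted[OF assms(1)]
  by (rule sum_mono) (use assms(2) tsum_weight_pos less_imp_le in \<open>auto intro!: mult_left_mono\<close>)

lemma tsum_const:
  assumes "N > 0"
  shows "tsum N (\<lambda>i. c) = real N * c"
  using assms by (simp add: tsum_def of_nat_diff algebra_simps)

lemma tsum_swap: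
  assumes "N > 0" "M > 0"
  shows "tsum N (\<lambda>i. tsum M (\<lambda>j. f i j)) = tsum M (\<lambda>j. tsum N (\<lambda>i. f i j))"
proof -
  have "tsum N (\<lambda>i. tsum M (\<lambda>j. f i j))
      = (\<Sum>i\<in>{0..int N}. \<Sum>j\<in>{0..int M}. tsum_weight N i * (tsum_weight M j * f i j))"
    using assms by (simp add: tsum_eq_weighted sum_distrib_left)
  also have "\<dots> = (\<Sum>j\<in>{0..int M}. \<Sum>i\<in>{0..int N}. tsum_weight M j * (tsum_weight N i * f i j))"
    by (subst sum.swap) (simp add: mult.left_commute)
  also have "\<dots> = tsum M (\<lambda>j. tsum N (\<lambda>i. f i j))"
    using assms by (simp add: tsum_eq_weighted sum_distrib_left)
  finally show ?thesis .
qed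

text \<open>Read \<open>q i\<close> as a flux at the midpoint \<open>i + 1/2\<close>. Because the
  end terms carry weight one half, each end contributes the mean of its two neighbouring fluxes,
  which vanishes for a flux that is odd about that end.\<close>

lemma tsum_telescope:
  assumes "N > 0"
  shows "tsum N (\<lambda>i. q i - q (i - 1)) = (q (int N) + q (int N - 1) - q 0 - q (- 1)) / 2"
proof -
  have "(\<Sum>i\<in>{1..int m}. q i - q (i - 1)) = q (int m) - q 0" for m
  proof (induction m)
    case (Suc m)
    have "{1..int (Suc m)} = insert (int (Suc m)) {1..int m}" by auto
    then show ?case using Suc by simp
  qed simp
  from this[of "N - 1"] have "(\<Sum>i\<in>{1..int N - 1}. q i - q (i - 1)) = q (int N - 1) - q 0"
    using assms by (simp add: of_nat_diff)
  then show ?thesis by (simp add: tsum_def field_simps)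
qed

text \<open>The two reflections compose to a shift by \<open>2 * N\<close>, whence the periodicity
  in the name.\<close>

definition even_periodic :: "nat \<Rightarrow> (int \<Rightarrow> real) \<Rightarrow> bool" where
  "even_periodic N f \<longleftrightarrow> (\<forall>i. f (- i) = f i \<and> f (int N + i) = f (int N - i))"

lemma even_periodic_fold_index: "N > 0 \<Longrightarrow> even_periodic N (\<lambda>i. f (fold_index N i))"
  by (simp add: even_periodic_def fold_index_minus fold_index_reflect)

lemma second_difference: "fwd d (bwd d f) i = (f (i + 1) - 2 * f i + f (i - 1)) / d^2"
  by (simp add: fwd_def bwd_def power2_eq_square diff_divide_distrib add_divide_distrib)

lemma even_periodic_second_difference:
  assumes "even_periodic N f"
  shows "even_periodic N (fwd d (bwd d f))"
proof -
  have s: "f (- i) = f i" "f (int N + i) = f (int N - i)" for i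
    using assms by (auto simp: even_periodic_def)
  have "f (- i + 1) = f (i - 1)" "f (- i - 1) = f (i + 1)" for i
    using s(1)[of "i - 1"] s(1)[of "i + 1"] by simp_all
  moreover have "f (int N + i + 1) = f (int N - i - 1)" "f (int N + i - 1) = f (int N - i + 1)" for i
    using s(2)[of "i + 1"] s(2)[of "i - 1"] by (simp_all add: algebra_simps)
  ultimately show ?thesis
    using s by (simp add: even_periodic_def second_difference)
qed

text \<open>No boundary term survives: the discrete flux is odd about both ends when
  \<open>f\<close> and \<open>g\<close> are even there. Averaging forward and backward differences
  is what matches the half weights at the ends.\<close>

lemma summation_by_parts:
  assumes N: "N > 0" and f: "even_periodic N f" and g: "even_periodic N g"
  shows "tsum N (\<lambda>i. fwd d (bwd d f) i * g i)
    = - tsum N (\<lambda>i. (fwd d f i * fwd d g i + bwd d f i * bwd d g i) / 2)"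
proof -
  \<comment> \<open>The flux through the edge from \<open>i\<close> to \<open>i + 1\<close>:
    difference of \<open>f\<close> times mean of \<open>g\<close>, with the \<open>1 / d\<close> of
    the outer difference included.\<close>
  define q where "q i = (f (i + 1) - f i) * (g (i + 1) + g i) / (2 * d^2)" for i
  have sy: "f (- 1) = f 1" "g (- 1) = g 1" "f (1 + int N) = f (int N - 1)" "g (1 + int N) = g (int N - 1)"
    using f g by (auto simp: even_periodic_def add.commute)
  have "q (- 1) = - q 0" "q (int N) = - q (int N - 1)"
    by (simp_all add: q_def sy minus_divide_left algebra_simps)
  then have z: "tsum N (\<lambda>i. q i - q (i - 1)) = 0"
    by (simp add: tsum_telescope[OF N])
  have "fwd d (bwd d f) i * g i + (fwd d f i * fwd d g i + bwd d f i * bwd d g i) / 2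
      = q i - q (i - 1)" for i
  proof (cases "d = 0")
    \<comment> \<open>Division by zero yields zero, so every term vanishes.\<close>
    case True then show ?thesis by (simp add: fwd_def bwd_def q_def)
  next
    case False
    then show ?thesis
      by (simp add: second_difference fwd_def bwd_def q_def field_simps power2_eq_square)
  qed
  with z have "tsum N (\<lambda>i. fwd d (bwd d f) i * g i
      + (fwd d f i * fwd d g i + bwd d f i * bwd d g i) / 2) = 0"
    by simp
  then show ?thesis by (simp add: tsum_add)
qed

section \<open>Green's formula for the discrete Laplacian on a box\<close>

locale box_grid =
  fixes lx ly lz :: real and Nx Ny Nz :: nat
  assumes lx: "lx > 0" and ly: "ly > 0" and lz: "lz > 0"
    and Nx: "Nx > 0" and Ny: "Ny > 0" and Nz: "Nz > 0"
begin

abbreviation dx :: real where "dx \<equiv> lx / real Nx"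
abbreviation dy :: real where "dy \<equiv> ly / real Ny"
abbreviation dz :: real where "dz \<equiv> lz / real Nz"
abbreviation l :: point where "l \<equiv> (lx, ly, lz)"
abbreviation N :: "nat \<times> nat \<times> nat" where "N \<equiv> (Nx, Ny, Nz)"
abbreviation Lap :: "gridfun \<Rightarrow> gridfun" where "Lap \<equiv> lap_d (dx, dy, dz)"
abbreviation ext :: "gridfun \<Rightarrow> gridfun" where "ext \<equiv> neumann_ext (Nx, Ny, Nz)"
abbreviation gsum :: "gridfun \<Rightarrow> real" where "gsum \<equiv> tsum3 (Nx, Ny, Nz)"

lemma gsum_add: "gsum (\<lambda>i j k. F i j k + G i j k) = gsum F + gsum G"
  by (simp add: tsum_add)

lemma gsum_cmult: "gsum (\<lambda>i j k. c * F i j k) = c * gsum F"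
  by (simp add: tsum_cmult)

lemma gsum_diff: "gsum (\<lambda>i j k. F i j k - G i j k) = gsum F - gsum G"
  using gsum_add[of F "\<lambda>i j k. (-1) * G i j k"] gsum_cmult[of "-1" G] by simp

lemma gsum_const: "gsum (\<lambda>i j k. c) = real Nx * real Ny * real Nz * c"
  using Nx Ny Nz by (simp add: tsum_const)

lemma gsum_cong:
  assumes "\<And>i j k. (i, j, k) \<in> grid N \<Longrightarrow> F i j k = G i j k"
  shows "gsum F = gsum G"
  using assms Nx Ny Nz by (auto intro!: tsum_cong)

lemma gsum_mono:
  assumes "\<And>i j k. (i, j, k) \<in> grid N \<Longrightarrow> F i j k \<le> G i j k"
  shows "gsum F \<le> gsum G"
  using assms Nx Ny Nz by (auto intro!: tsum_mono)

lemma gsum_nonneg: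
  assumes "\<And>i j k. (i, j, k) \<in> grid N \<Longrightarrow> 0 \<le> F i j k"
  shows "0 \<le> gsum F"
  using gsum_mono[of "\<lambda>i j k. 0" F] assms gsum_const[of 0] by simp

text \<open>Stated as invariance of the whole lattice function rather than as being of the form
  \<open>ext U\<close>, since invariance passes directly to differences and to
  \<open>Lap\<close>.\<close>

definition reflected :: "gridfun \<Rightarrow> bool" where
  "reflected F \<longleftrightarrow> (\<forall>j k. even_periodic Nx (\<lambda>i. F i j k))
     \<and> (\<forall>i k. even_periodic Ny (\<lambda>j. F i j k)) \<and> (\<forall>i j. even_periodic Nz (\<lambda>k. F i j k))"

lemma reflected_ext: "reflected (ext U)"
  using Nx Ny Nz
    even_periodic_fold_index[of Nx "\<lambda>i. U i (fold_index Ny j) (fold_index Nz k)" for j k]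
    even_periodic_fold_index[of Ny "\<lambda>j. U (fold_index Nx i) j (fold_index Nz k)" for i k]
    even_periodic_fold_index[of Nz "\<lambda>k. U (fold_index Nx i) (fold_index Ny j) k" for i j]
  by (simp add: reflected_def)

lemma ext_grid: "(i, j, k) \<in> grid N \<Longrightarrow> ext U i j k = U i j k"
  using Nx Ny Nz by (simp add: fold_index_id)

lemma reflected_diff: "reflected F \<Longrightarrow> reflected G \<Longrightarrow> reflected (\<lambda>i j k. F i j k - G i j k)"
  by (simp add: reflected_def even_periodic_def)

text \<open>A second difference of an even function is even in its own direction and inherits
  evenness in the others pointwise. This permits Green's formula for \<open>Lap (Lap F)\<close>; it
  is the Neumann condition on the Laplacian.\<close>

lemma reflected_Lap:
  assumes "reflected F"
  shows "reflected (Lap F)"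
proof -
  have add: "even_periodic n f \<Longrightarrow> even_periodic n g \<Longrightarrow> even_periodic n (\<lambda>i. f i + g i)" for n f g
    by (simp add: even_periodic_def)
  have x: "even_periodic Nx (\<lambda>i. F i j k)" for j k using assms by (simp add: reflected_def)
  have y: "even_periodic Ny (\<lambda>j. F i j k)" for i k using assms by (simp add: reflected_def)
  have z: "even_periodic Nz (\<lambda>k. F i j k)" for i j using assms by (simp add: reflected_def)
  have xx: "even_periodic Nx (\<lambda>i. fwd dx (bwd dx (\<lambda>i. F i j k)) i)" for j k
    by (rule even_periodic_second_difference[OF x])
  have yy: "even_periodic Ny (\<lambda>j. fwd dy (bwd dy (\<lambda>j. F i j k)) j)" for i k
    by (rule even_periodic_second_difference[OF y])
  have zz: "even_periodic Nz (\<lambda>k. fwd dz (bwd dz (\<lambda>k. F i j k)) k)" for i j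
    by (rule even_periodic_second_difference[OF z])
  have xy: "even_periodic Nx (\<lambda>i. fwd dy (bwd dy (\<lambda>j. F i j k)) j)"
    "even_periodic Nx (\<lambda>i. fwd dz (bwd dz (\<lambda>k. F i j k)) k)" for j k
    using x by (auto simp: even_periodic_def second_difference)
  have yx: "even_periodic Ny (\<lambda>j. fwd dx (bwd dx (\<lambda>i. F i j k)) i)"
    "even_periodic Ny (\<lambda>j. fwd dz (bwd dz (\<lambda>k. F i j k)) k)" for i k
    using y by (auto simp: even_periodic_def second_difference)
  have zx: "even_periodic Nz (\<lambda>k. fwd dx (bwd dx (\<lambda>i. F i j k)) i)"
    "even_periodic Nz (\<lambda>k. fwd dy (bwd dy (\<lambda>j. F i j k)) j)" for i j
    using z by (auto simp: even_periodic_def second_difference)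
  show ?thesis
    unfolding reflected_def lap_d.simps
    by (intro conjI allI add xx yy zz xy yx zx)
qed

text \<open>The symmetric bilinear form belonging to \<open>grad_sq_d\<close>. Green's formula is
  needed off the diagonal, to make \<open>Lap\<close> self-adjoint.\<close>

definition grad_prod :: "gridfun \<Rightarrow> gridfun \<Rightarrow> gridfun" where
  "grad_prod F G i j k =
     (inner (grad_plus (dx, dy, dz) F i j k) (grad_plus (dx, dy, dz) G i j k)
      + inner (grad_minus (dx, dy, dz) F i j k) (grad_minus (dx, dy, dz) G i j k)) / 2"

lemma grad_prod_self_nonneg: "0 \<le> grad_prod F F i j k"
  by (simp add: grad_prod_def)

lemma grad_prod_commute: "grad_prod F G i j k = grad_prod G F i j k"
  by (simp add: grad_prod_def inner_commute)

text \<open>For each direction the corresponding sum is moved innermost, where summation by parts in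
  one variable applies.\<close>

lemma sum_Lap_mult:
  assumes "reflected F" "reflected G"
  shows "gsum (\<lambda>i j k. Lap F i j k * G i j k) = - gsum (grad_prod F G)"
proof -
  have ep: "even_periodic Nx (\<lambda>i. F i j k)" "even_periodic Nx (\<lambda>i. G i j k)"
     "even_periodic Ny (\<lambda>j. F i j k)" "even_periodic Ny (\<lambda>j. G i j k)"
     "even_periodic Nz (\<lambda>k. F i j k)" "even_periodic Nz (\<lambda>k. G i j k)" for i j k
    using assms by (auto simp: reflected_def)
  let ?X = "\<lambda>i j k. fwd dx (bwd dx (\<lambda>i. F i j k)) i * G i j k"
  let ?Y = "\<lambda>i j k. fwd dy (bwd dy (\<lambda>j. F i j k)) j * G i j k"
  let ?Z = "\<lambda>i j k. fwd dz (bwd dz (\<lambda>k. F i j k)) k * G i j k"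
  let ?X' = "\<lambda>i j k. (fwd dx (\<lambda>i. F i j k) i * fwd dx (\<lambda>i. G i j k) i
      + bwd dx (\<lambda>i. F i j k) i * bwd dx (\<lambda>i. G i j k) i) / 2"
  let ?Y' = "\<lambda>i j k. (fwd dy (\<lambda>j. F i j k) j * fwd dy (\<lambda>j. G i j k) j
      + bwd dy (\<lambda>j. F i j k) j * bwd dy (\<lambda>j. G i j k) j) / 2"
  let ?Z' = "\<lambda>i j k. (fwd dz (\<lambda>k. F i j k) k * fwd dz (\<lambda>k. G i j k) k
      + bwd dz (\<lambda>k. F i j k) k * bwd dz (\<lambda>k. G i j k) k) / 2"
  have neg: "tsum n (\<lambda>i. - a i) = - tsum n a" for n a
    using tsum_cmult[of n "-1" a] by simp
  have Z: "gsum ?Z = - gsum ?Z'"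
    by (simp add: summation_by_parts[OF Nz ep(5,6)] neg)
  have "gsum ?Y = tsum Nx (\<lambda>i. tsum Nz (\<lambda>k. tsum Ny (\<lambda>j. ?Y i j k)))"
    by (simp add: tsum_swap[OF Ny Nz])
  also have "\<dots> = - tsum Nx (\<lambda>i. tsum Nz (\<lambda>k. tsum Ny (\<lambda>j. ?Y' i j k)))"
    by (simp add: summation_by_parts[OF Ny ep(3,4)] neg)
  also have "\<dots> = - gsum ?Y'"
    by (simp add: tsum_swap[OF Ny Nz])
  finally have Y: "gsum ?Y = - gsum ?Y'" .
  have "gsum ?X = tsum Ny (\<lambda>j. tsum Nz (\<lambda>k. tsum Nx (\<lambda>i. ?X i j k)))"
    by (simp add: tsum_swap[OF Nx Ny] tsum_swap[OF Nx Nz])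
  also have "\<dots> = - tsum Ny (\<lambda>j. tsum Nz (\<lambda>k. tsum Nx (\<lambda>i. ?X' i j k)))"
    by (simp add: summation_by_parts[OF Nx ep(1,2)] neg)
  also have "\<dots> = - gsum ?X'"
    by (simp add: tsum_swap[OF Nx Ny] tsum_swap[OF Nx Nz])
  finally have X: "gsum ?X = - gsum ?X'" .
  have "gsum (\<lambda>i j k. Lap F i j k * G i j k) = gsum (\<lambda>i j k. (?X i j k + ?Y i j k) + ?Z i j k)"
    by (rule gsum_cong) (simp add: algebra_simps)
  also have "\<dots> = gsum ?X + gsum ?Y + gsum ?Z"
    by (simp only: gsum_add)
  also have "\<dots> = - (gsum ?X' + gsum ?Y' + gsum ?Z')" by (simp only: X Y Z)
  also have "gsum ?X' + gsum ?Y' + gsum ?Z' = gsum (\<lambda>i j k. (?X' i j k + ?Y' i j k) + ?Z' i j k)"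
    by (simp only: gsum_add)
  also have "\<dots> = gsum (grad_prod F G)"
    by (rule gsum_cong) (simp add: grad_prod_def field_simps)
  finally show ?thesis .
qed

lemma sum_Lap_selfadjoint:
  assumes "reflected F" "reflected G"
  shows "gsum (\<lambda>i j k. Lap F i j k * G i j k) = gsum (\<lambda>i j k. F i j k * Lap G i j k)"
  using sum_Lap_mult[OF assms] sum_Lap_mult[OF assms(2,1)]
  by (simp add: grad_prod_commute[of F G, abs_def] mult.commute[of "G _ _ _"] mult.commute[of "F _ _ _"]
    del: tsum3.simps lap_d.simps)

lemma Lap_diff: "Lap (\<lambda>i j k. F i j k - G i j k) i j k = Lap F i j k - Lap G i j k"
  by (simp add: second_difference diff_divide_distrib add_divide_distrib algebra_simps)

end

section \<open>Energy decay and the error recursion\<close>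

declare lap_d.simps [simp del] tsum3.simps [simp del] neumann_ext.simps [simp del]

text \<open>
  The quartic potential continued outside \<open>[-M, M]\<close> by its second-order Taylor polynomial, so that its
  second derivative never exceeds \<open>3 * M^2\<close>. The energy with this potential decays without an
  a priori bound on the next iterate, and \<open>\<zeta> \<le> M^2\<close> keeps it coercive.
\<close>

definition trunc_quartic :: "real \<Rightarrow> real \<Rightarrow> real" where
  "trunc_quartic M x = (if \<bar>x\<bar> \<le> M then x^4 / 4
     else M^4 / 4 + M^3 * (\<bar>x\<bar> - M) + 3/2 * M^2 * (\<bar>x\<bar> - M)^2)"

text \<open>Taylor's inequality for a function with second derivative at most
  \<open>3 * M^2\<close>. Only the old value \<open>v\<close> is confined to \<open>[-M, M]\<close>;
  the new value \<open>w\<close> is arbitrary, which breaks the circle between energy decay and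
  boundedness.\<close>

lemma trunc_quartic_upper:
  assumes v: "\<bar>v\<bar> \<le> M"
  shows "trunc_quartic M w \<le> trunc_quartic M v + v^3 * (w - v) + 3/2 * M^2 * (w - v)^2"
proof -
  have inner: "w^4 / 4 \<le> v^4 / 4 + v^3 * (w - v) + 3/2 * M^2 * (w - v)^2"
    if "\<bar>v\<bar> \<le> M" "\<bar>w\<bar> \<le> M" for v w
  proof -
    have "v^2 \<le> M^2" "w^2 \<le> M^2" using that abs_le_square_iff[of _ M] by auto
    moreover have "2 * v * w \<le> v^2 + w^2" using sum_squares_bound[of v w] by simp
    ultimately have "3 * v^2 + 2 * v * w + w^2 \<le> 6 * M^2" by linarith
    then have "(3 * v^2 + 2 * v * w + w^2) * (w - v)^2 \<le> 6 * M^2 * (w - v)^2"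
      by (rule mult_right_mono) simp
    \<comment> \<open>The Taylor remainder of the fourth power in closed form.\<close>
    moreover have "w^4 = v^4 + 4 * v^3 * (w - v) + (3 * v^2 + 2 * v * w + w^2) * (w - v)^2"
      by algebra
    ultimately show ?thesis by linarith
  qed
  \<comment> \<open>With \<open>w = M + q\<close> both sides are quadratic in \<open>q\<close> with
    the same leading coefficient. The constant terms compare by \<open>inner\<close> at
    \<open>w = M\<close>, the linear ones by comparing slopes at \<open>M\<close>.\<close>
  have outer: "M^4 / 4 + M^3 * q + 3/2 * M^2 * q^2
      \<le> v^4 / 4 + v^3 * (M + q - v) + 3/2 * M^2 * (M + q - v)^2"
    if v: "\<bar>v\<bar> \<le> M" and q: "q \<ge> 0" for v q
  proof -
    have M: "M \<ge> 0" using v by linarith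
    have v2: "v^2 \<le> M^2" using v abs_le_square_iff[of v M] by auto
    have "v * M \<le> M * M" using v M by (intro mult_right_mono) auto
    then have "M^2 + M * v + v^2 \<le> 3 * M^2" using v2 by (simp add: power2_eq_square mult.commute)
    then have "(M^2 + M * v + v^2) * (M - v) \<le> 3 * M^2 * (M - v)"
      using v by (intro mult_right_mono) auto
    moreover have "M^3 - v^3 = (M^2 + M * v + v^2) * (M - v)" by algebra
    ultimately have "M^3 \<le> v^3 + 3 * M^2 * (M - v)" by linarith
    then have "M^3 * q \<le> (v^3 + 3 * M^2 * (M - v)) * q" using q by (rule mult_right_mono)
    moreover have "M^4 / 4 \<le> v^4 / 4 + v^3 * (M - v) + 3/2 * M^2 * (M - v)^2"
      using inner[of v M] v M by simp
    moreover have "v^3 * (M + q - v) + 3/2 * M^2 * (M + q - v)^2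
      = v^3 * (M - v) + 3/2 * M^2 * (M - v)^2 + (v^3 + 3 * M^2 * (M - v)) * q + 3/2 * M^2 * q^2"
      by algebra
    ultimately show ?thesis by linarith
  qed
  consider "\<bar>w\<bar> \<le> M" | "w > M" | "w < - M" by linarith
  then show ?thesis
  proof cases
    case 1
    then show ?thesis using inner[of v w] v by (simp add: trunc_quartic_def)
  next
    case 2
    then show ?thesis using outer[of v "w - M"] v by (simp add: trunc_quartic_def)
  next
    \<comment> \<open>The truncated potential is even, so this is the previous case for
      \<open>- v\<close> and \<open>- w\<close>.\<close>
    case 3
    have "(- v - w)^2 = (w + v)^2" for v by algebra
    with 3 show ?thesis
      using outer[of "- v" "- w - M"] v
      by (simp add: trunc_quartic_def algebra_simps power2_commute[of v w])
  qed
qed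

text \<open>Completing a square shows that the quartic dominates the parabola. The points of contact
  \<open>x^2 = \<zeta>\<close>, if any, lie in \<open>[-M, M]\<close> because
  \<open>\<zeta> \<le> M^2\<close>, so truncation keeps the inequality. It trades the quartic for
  additional quadratic coercivity.\<close>

lemma trunc_quartic_lower:
  assumes M: "M \<ge> 0" "\<zeta> \<le> M^2"
  shows "\<zeta> / 2 * x^2 - \<zeta>^2 / 4 \<le> trunc_quartic M x"
proof (cases "\<bar>x\<bar> \<le> M")
  case True
  have "0 \<le> (x^2 - \<zeta>)^2" by simp
  also have "(x^2 - \<zeta>)^2 = x^4 - 2 * \<zeta> * x^2 + \<zeta>^2" by algebra
  finally show ?thesis using True by (simp add: trunc_quartic_def)
next
  case False
  define q where "q = \<bar>x\<bar> - M"
  have q: "q \<ge> 0" using False by (simp add: q_def)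
  have x2: "x^2 = (M + q)^2" by (simp add: q_def)
  \<comment> \<open>The difference of the two sides in powers of \<open>q\<close>;
    \<open>\<zeta> \<le> M^2\<close> makes every coefficient nonnegative.\<close>
  have "0 \<le> (M^2 - \<zeta>)^2 / 4 + q * M * (M^2 - \<zeta>) + q^2 / 2 * (2 * M^2 + (M^2 - \<zeta>))"
    using q M by (intro add_nonneg_nonneg mult_nonneg_nonneg) auto
  also have "\<dots> = M^4 / 4 + M^3 * q + 3/2 * M^2 * q^2 - \<zeta> / 2 * (M + q)^2 + \<zeta>^2 / 4"
    by (simp add: field_simps power2_eq_square power3_eq_cube power4_eq_xxxx)
  finally show ?thesis using False by (simp add: trunc_quartic_def x2 q_def[symmetric])
qed

text \<open>Three times \<open>C_const\<close> is the smaller eigenvalue of the matrix with diagonal entries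
  \<open>\<epsilon>\<close>, \<open>1 - \<eta> + \<zeta>\<close> and off-diagonal entries \<open>1\<close>.\<close>

lemma C_const_coercive:
  assumes eps: "\<epsilon> > 0" and zeta: "\<zeta> > 1 / \<epsilon> + \<eta> - 1"
  defines "c \<equiv> C_const \<epsilon> \<eta> \<zeta>"
  shows "c > 0"
    and "0 \<le> (1 - \<eta> + \<zeta> - 2 * c) * s^2 + (\<epsilon> - 2 * c) * r^2 + 2 * (1 + c) * (s * r)"
proof -
  define a where "a = \<epsilon>"
  define b where "b = 1 - \<eta> + \<zeta>"
  define R where "R = sqrt ((a - b)^2 + 4)"
  have c: "c = (a + b - R) / 6"
    by (simp add: c_def C_const_def R_def a_def b_def algebra_simps)
  have R2: "R^2 = (a - b)^2 + 4" by (simp add: R_def)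
  have b: "b > 1 / a" using zeta by (simp add: a_def b_def)
  then have b0: "b > 0" using eps by (smt (verit) a_def divide_pos_pos)
  have ab: "a * b > 1" using b eps by (simp add: a_def field_simps)
  have "R < sqrt ((a + b)^2)"
    unfolding R_def by (rule real_sqrt_less_mono) (use ab in \<open>simp add: power2_eq_square algebra_simps\<close>)
  then have Rab: "R < a + b" using eps b0 by (simp add: a_def)
  then show c0: "c > 0" by (simp add: c)
  have "R \<ge> sqrt (2^2)" unfolding R_def by (rule real_sqrt_le_mono) simp
  then have R: "R \<ge> 2" by simp
  have "sqrt ((a - b)^2) < R" unfolding R_def by (rule real_sqrt_less_mono) simp
  then have Rd: "\<bar>a - b\<bar> < R" by simp
  define P where "P = b - 2 * c"
  define Q where "Q = a - 2 * c"
  have "a - b < R" using Rd by simp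
  then have P: "P > 0" using c0 c unfolding P_def by (simp add: field_simps)
  \<comment> \<open>Determinant of the form in the second claim. Inserting
    \<open>a + b = 6 * c + R\<close> and \<open>R^2 = (a - b)^2 + 4\<close> reduces it to
    \<open>c * (R - 2)\<close>, which is nonnegative since \<open>c > 0\<close> and
    \<open>R \<ge> 2\<close>.\<close>
  have "P * Q - (1 + c)^2 = c * (R - 2) + ((a - b)^2 + 4 - R^2) * (-1/4)"
  proof -
    have ae: "a = 6 * c + R - b" using c by simp
    show ?thesis unfolding P_def Q_def ae by (simp add: field_simps power2_eq_square)
  qed
  then have PQ: "P * Q - (1 + c)^2 \<ge> 0" using R R2 c0 by simp
  have "P * (P * s^2 + Q * r^2 + 2 * (1 + c) * (s * r))
      = (P * s + (1 + c) * r)^2 + (P * Q - (1 + c)^2) * r^2"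
    by algebra
  also have "\<dots> \<ge> 0" using PQ by simp
  finally have "0 \<le> P * s^2 + Q * r^2 + 2 * (1 + c) * (s * r)" using P by (simp add: zero_le_mult_iff)
  then show "0 \<le> (1 - \<eta> + \<zeta> - 2 * c) * s^2 + (\<epsilon> - 2 * c) * r^2 + 2 * (1 + c) * (s * r)"
    by (simp add: P_def Q_def a_def b_def)
qed

text \<open>Dividing by \<open>1 - h * A\<close>, which is at least one half, at most doubles the
  source term. As \<open>E 0 = 0\<close>, only the \<open>n\<close> source terms contribute, each
  amplified by at most \<open>(1 + h * D)^n\<close>.\<close>

lemma discrete_gronwall:
  fixes E :: "nat \<Rightarrow> real"
  assumes E0: "E 0 = 0" and nonneg: "\<And>n. E n \<ge> 0"
    and A: "A \<ge> 0" and B: "B \<ge> 0" and R: "R \<ge> 0" and h: "h > 0" "h * A \<le> 1/2"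
    and step: "\<And>m. m < n \<Longrightarrow> (1 - h * A) * E (Suc m) \<le> (1 + h * B) * E m + h * R"
  shows "E n \<le> 2 * (real n * h) * R * exp (2 * (A + B) * (real n * h))"
proof -
  \<comment> \<open>The factor two pays for the division: with \<open>h * A \<le> 1/2\<close> it
    gives \<open>1 + h * B \<le> (1 - h * A) * (1 + h * D)\<close>.\<close>
  define D where "D = 2 * (A + B)"
  have D: "D \<ge> 0" using A B by (simp add: D_def)
  have st: "E (Suc m) \<le> (1 + h * D) * E m + 2 * h * R" if "m < n" for m
  proof -
    have "h * A * (h * D) \<le> 1/2 * (h * D)" using h D by (intro mult_right_mono) auto
    then have "1 + h * B \<le> (1 - h * A) * (1 + h * D)" by (simp add: D_def algebra_simps)
    then have "(1 + h * B) * E m \<le> (1 - h * A) * (1 + h * D) * E m"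
      using nonneg by (rule mult_right_mono)
    moreover have "h * R \<le> (1 - h * A) * (2 * h * R)"
    proof -
      have "1 / 2 * (2 * h * R) \<le> (1 - h * A) * (2 * h * R)"
        using h R by (intro mult_right_mono) auto
      then show ?thesis by simp
    qed
    ultimately have "(1 - h * A) * E (Suc m) \<le> (1 - h * A) * ((1 + h * D) * E m + 2 * h * R)"
      using step[OF that] by (simp add: algebra_simps)
    then show ?thesis using h by (simp add: mult_le_cancel_left)
  qed
  have "m \<le> n \<Longrightarrow> E m \<le> real m * (2 * h * R) * (1 + h * D)^m" for m
  proof (induction m)
    case 0 then show ?case using E0 by simp
  next
    case (Suc m)
    have g: "1 + h * D \<ge> 1" using h D by simp
    have hR: "0 \<le> h * R" using h R by simp
    have "E (Suc m) \<le> (1 + h * D) * E m + 2 * h * R" using st Suc.prems by simp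
    also have "\<dots> \<le> (1 + h * D) * (real m * (2 * h * R) * (1 + h * D)^m) + 2 * h * R * (1 + h * D)^(Suc m)"
      using Suc g hR one_le_power[OF g, of "Suc m"]
      by (intro add_mono mult_left_mono mult_le_cancel_left1[THEN iffD2]) (auto simp del: power_Suc simp: not_less mult_nonneg_nonneg mult.commute[of R])
    also have "\<dots> = real (Suc m) * (2 * h * R) * (1 + h * D)^(Suc m)" by (simp add: algebra_simps)
    finally show ?case .
  qed
  from this[of n] have "E n \<le> real n * (2 * h * R) * (1 + h * D)^n" by simp
  also have "\<dots> \<le> real n * (2 * h * R) * exp (real n * (h * D))"
  proof -
    have "(1 + h * D)^n \<le> exp (h * D)^n"
      using h D by (intro power_mono exp_ge_add_one_self) auto
    then show ?thesis using h R by (intro mult_left_mono) (auto simp: exp_of_nat_mult[symmetric])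
  qed
  finally show ?thesis by (simp add: D_def algebra_simps)
qed

section \<open>Coercivity and decay of the discrete energy; the error inequality\<close>

context box_grid
begin

text \<open>The potential is left open because two choices of it are compared,
  \<open>x^4 / 4\<close> and \<open>trunc_quartic M\<close>. The constant cell volume is factored
  out.\<close>

definition energy :: "(real \<Rightarrow> real) \<Rightarrow> real \<Rightarrow> real \<Rightarrow> gridfun \<Rightarrow> real" where
  "energy F \<epsilon> \<eta> V = gsum (\<lambda>i j k. F (V i j k) + (1 - \<eta>)/2 * (V i j k)^2 - grad_prod V V i j k
      + \<epsilon>/2 * (Lap V i j k)^2)"

abbreviation cell :: real where "cell \<equiv> vol (mesh l N)"

lemma cell_pos: "cell > 0"
  using lx ly lz Nx Ny Nz by simp

lemma cell_count: "real Nx * real Ny * real Nz * cell = vol l"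
  using Nx Ny Nz by simp

lemma gsum_times_cell: "gsum (\<lambda>i j k. F i j k * cell) = gsum F * cell"
  using gsum_cmult[of cell F] by (simp add: mult.commute)

lemma grad_sq_d_ext: "grad_sq_d l N U = grad_prod (ext U) (ext U)"
  by (intro ext) (simp add: grad_sq_d_def grad_prod_def power2_norm_eq_inner)

text \<open>Agreement of \<open>F\<close> with the quartic is required only at the grid values of
  \<open>U\<close>, so the truncated potential qualifies as soon as these are bounded by
  \<open>M\<close>.\<close>

lemma H_d_eq_energy:
  assumes "\<And>i j k. (i, j, k) \<in> grid N \<Longrightarrow> F (U i j k) = (U i j k)^4 / 4"
  shows "H_d \<epsilon> \<eta> l N U = energy F \<epsilon> \<eta> (ext U) * cell"
proof -
  have "H_d \<epsilon> \<eta> l N U = gsum (\<lambda>i j k. (F (ext U i j k) + (1 - \<eta>)/2 * (ext U i j k)^2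
     - grad_prod (ext U) (ext U) i j k + \<epsilon>/2 * (Lap (ext U) i j k)^2) * cell)"
    unfolding H_d_def grad_sq_d_ext
    by (rule gsum_cong) (simp add: ext_grid assms del: grid.simps vol.simps)
  then show ?thesis by (simp add: energy_def gsum_times_cell del: mesh.simps vol.simps)
qed

text \<open>Green's formula rewrites the gradient term through \<open>Lap V * V\<close>, so the
  claim becomes nonnegativity of a form in \<open>V\<close> and \<open>Lap V\<close> at each point;
  the lower bound on \<open>F\<close> adds \<open>\<zeta>\<close> to \<open>1 - \<eta>\<close>. The
  denominator 6 in \<open>C_const\<close> comes from the halves in the energy and from
  \<open>\<bar>s * r\<bar> \<le> (s^2 + r^2) / 2\<close>, by which three halves of
  \<open>s^2 + r^2\<close> control \<open>s^2 + r^2 + \<bar>s * r\<bar>\<close>.\<close>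

lemma energy_coercive:
  assumes F: "\<And>x. \<zeta> / 2 * x^2 - \<zeta>^2 / 4 \<le> F x"
    and eps: "\<epsilon> > 0" and zeta: "\<zeta> > 1 / \<epsilon> + \<eta> - 1" and V: "reflected V"
  shows "C_const \<epsilon> \<eta> \<zeta> * (gsum (\<lambda>i j k. (V i j k)^2) + gsum (grad_prod V V) + gsum (\<lambda>i j k. (Lap V i j k)^2))
    \<le> energy F \<epsilon> \<eta> V + \<zeta>^2 / 4 * (real Nx * real Ny * real Nz)"
proof -
  define c where "c = C_const \<epsilon> \<eta> \<zeta>"
  have gp: "gsum (grad_prod V V) = - gsum (\<lambda>i j k. Lap V i j k * V i j k)"
    using sum_Lap_mult[OF V V] by simp
  have "0 \<le> gsum (\<lambda>i j k. F (V i j k) + \<zeta>^2 / 4 + (1 - \<eta>)/2 * (V i j k)^2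
      + (1 + c) * (Lap V i j k * V i j k) + \<epsilon>/2 * (Lap V i j k)^2
      - c * (V i j k)^2 - c * (Lap V i j k)^2)"
  proof (rule gsum_nonneg)
    fix i j k
    have "0 \<le> (1 - \<eta> + \<zeta> - 2 * c) * (V i j k)^2 + (\<epsilon> - 2 * c) * (Lap V i j k)^2
        + 2 * (1 + c) * (V i j k * Lap V i j k)"
      unfolding c_def by (rule C_const_coercive[OF eps zeta])
    with F[of "V i j k"] show "0 \<le> F (V i j k) + \<zeta>^2 / 4 + (1 - \<eta>)/2 * (V i j k)^2
      + (1 + c) * (Lap V i j k * V i j k) + \<epsilon>/2 * (Lap V i j k)^2
      - c * (V i j k)^2 - c * (Lap V i j k)^2"
      by (simp add: field_simps)
  qed
  then show ?thesis
    unfolding energy_def c_def[symmetric]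
    by (simp add: gsum_add gsum_diff gsum_cmult gsum_const gp algebra_simps)
qed

text \<open>Both \<open>F\<close> and the energy bound \<open>H\<close> are left general: the
  initial value is treated with the true quartic, later iterates with the truncated one.\<close>

lemma sobolev_bound:
  assumes C: "discrete_sobolev_const l C"
    and F: "\<And>x. \<zeta> / 2 * x^2 - \<zeta>^2 / 4 \<le> F x"
    and eps: "\<epsilon> > 0" and zeta: "\<zeta> > 1 / \<epsilon> + \<eta> - 1"
    and E: "energy F \<epsilon> \<eta> (ext U) * cell \<le> H"
    and g: "(i, j, k) \<in> grid N"
  shows "\<bar>U i j k\<bar> \<le> sqrt (C^2 / C_const \<epsilon> \<eta> \<zeta> * (H + \<zeta>^2 / 4 * vol l))"
proof -
  define c where "c = C_const \<epsilon> \<eta> \<zeta>"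
  have c: "c > 0" unfolding c_def by (rule C_const_coercive[OF eps zeta])
  have C0: "C > 0" using C by (simp add: discrete_sobolev_const_def)
  define X where "X = gsum (\<lambda>i j k. (ext U i j k)^2) + gsum (grad_prod (ext U) (ext U))
    + gsum (\<lambda>i j k. (Lap (ext U) i j k)^2)"
  have "finite (grid N)" by simp
  then have "\<bar>U i j k\<bar> \<le> Linf_norm_d N U"
    unfolding Linf_norm_d_def using g by (intro Max_ge) (auto simp del: grid.simps intro!: image_eqI[of _ _ "(i, j, k)"])
  also have "\<dots> \<le> C * sqrt ((L2_norm_d l N U)^2 + (D_seminorm_d l N U)^2
          + (L2_norm_d l N (lap_d (mesh l N) (neumann_ext N U)))^2)"
    using C Nx Ny Nz unfolding discrete_sobolev_const_def Let_def by blast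
  also have "(L2_norm_d l N U)^2 + (D_seminorm_d l N U)^2
          + (L2_norm_d l N (lap_d (mesh l N) (neumann_ext N U)))^2 = X * cell"
  proof -
    have "(L2_norm_d l N W)^2 = gsum (\<lambda>i j k. (W i j k)^2) * cell" for W
    proof -
      have "0 \<le> gsum (\<lambda>i j k. (W i j k)^2 * cell)" using cell_pos by (intro gsum_nonneg) (simp del: mesh.simps vol.simps)
      then show ?thesis unfolding L2_norm_d_def
        by (simp add: gsum_times_cell del: mesh.simps vol.simps)
    qed
    moreover have "gsum (\<lambda>i j k. (U i j k)^2) = gsum (\<lambda>i j k. (ext U i j k)^2)"
      by (rule gsum_cong) (simp add: ext_grid del: grid.simps)
    moreover have "(D_seminorm_d l N U)^2 = gsum (grad_prod (ext U) (ext U)) * cell"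
    proof -
      have "0 \<le> gsum (\<lambda>i j k. grad_prod (ext U) (ext U) i j k * cell)"
        using cell_pos grad_prod_self_nonneg by (intro gsum_nonneg) (simp del: mesh.simps vol.simps)
      then show ?thesis unfolding D_seminorm_d_def grad_sq_d_ext
        by (simp add: gsum_times_cell del: mesh.simps vol.simps)
    qed
    ultimately show ?thesis by (simp add: X_def algebra_simps del: vol.simps)
  qed
  also have "C * sqrt (X * cell) \<le> sqrt (C^2 / c * (H + \<zeta>^2 / 4 * vol l))"
  proof -
    have "c * X \<le> energy F \<epsilon> \<eta> (ext U) + \<zeta>^2 / 4 * (real Nx * real Ny * real Nz)"
      unfolding X_def c_def by (rule energy_coercive[OF F eps zeta reflected_ext])
    then have "c * X * cell \<le> (energy F \<epsilon> \<eta> (ext U) + \<zeta>^2 / 4 * (real Nx * real Ny * real Nz)) * cell"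
      using cell_pos by (intro mult_right_mono) simp_all
    also have "\<dots> = energy F \<epsilon> \<eta> (ext U) * cell + \<zeta>^2 / 4 * vol l"
      by (simp only: cell_count[symmetric]) (simp only: algebra_simps)
    finally have "c * (X * cell) \<le> H + \<zeta>^2 / 4 * vol l" using E by (simp only: mult.assoc)
    then have "X * cell \<le> (H + \<zeta>^2 / 4 * vol l) / c"
      using c by (simp only: pos_le_divide_eq mult.commute)
    then have "C^2 * (X * cell) \<le> C^2 * ((H + \<zeta>^2 / 4 * vol l) / c)"
      by (rule mult_left_mono) simp
    then have "sqrt (C^2 * (X * cell)) \<le> sqrt (C^2 / c * (H + \<zeta>^2 / 4 * vol l))"
      by (intro real_sqrt_le_mono) (simp only: times_divide_eq_left times_divide_eq_right)
    then show ?thesis using C0 by (simp only: real_sqrt_mult) simp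
  qed
  finally show ?thesis by (simp only: c_def)
qed

text \<open>The scheme is tested with the increment \<open>d\<close>. Each part of the energy at
  \<open>W\<close> is at most its value at \<open>V\<close> plus the matching term of the scheme
  times \<open>d\<close>: the potential up to the curvature \<open>3 * M^2\<close>, the concave
  gradient part because it is explicit, the convex part with \<open>\<epsilon>\<close> because it is
  implicit. What remains is a multiple of \<open>d^2\<close>, nonpositive by the step-size
  condition.\<close>

lemma energy_decreasing:
  assumes V: "reflected V" and W: "reflected W" and M: "\<And>i j k. (i, j, k) \<in> grid N \<Longrightarrow> \<bar>V i j k\<bar> \<le> M"
    and eps: "\<epsilon> > 0" and dt: "dt > 0" "dt * (3 * M^2 - (\<alpha> - \<beta>)) \<le> 2"
    and ab: "\<alpha> + \<beta> = 1 - \<eta>"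
    and scheme: "\<And>i j k. (i, j, k) \<in> grid N \<Longrightarrow> (W i j k - V i j k) / dt =
      - ((V i j k)^3 + \<alpha> * W i j k + \<beta> * V i j k + \<epsilon> * Lap (Lap W) i j k + 2 * Lap V i j k)"
  shows "energy (trunc_quartic M) \<epsilon> \<eta> W \<le> energy (trunc_quartic M) \<epsilon> \<eta> V"
proof -
  define d where "d = (\<lambda>i j k. W i j k - V i j k)"
  let ?F = "trunc_quartic M"
  have d: "reflected d" unfolding d_def by (rule reflected_diff[OF W V])
  have Ld: "Lap d = (\<lambda>i j k. Lap W i j k - Lap V i j k)"
    unfolding d_def by (intro ext) (rule Lap_diff)
  have gW: "gsum (grad_prod W W) = - gsum (\<lambda>i j k. Lap W i j k * W i j k)"
    and gV: "gsum (grad_prod V V) = - gsum (\<lambda>i j k. Lap V i j k * V i j k)"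
    and gd: "gsum (grad_prod d d) = - gsum (\<lambda>i j k. Lap d i j k * d i j k)"
    using sum_Lap_mult[OF W W] sum_Lap_mult[OF V V] sum_Lap_mult[OF d d] by simp_all
  have "0 \<le> gsum (grad_prod d d)" by (rule gsum_nonneg) (rule grad_prod_self_nonneg)
  \<comment> \<open>The last bracket sums to zero by self-adjointness, and \<open>Lap d * d\<close>
    sums to minus the squared gradient of \<open>d\<close>, which has a favourable sign.\<close>
  moreover have "gsum (\<lambda>i j k. Lap W i j k * W i j k)
      = gsum (\<lambda>i j k. Lap V i j k * V i j k + 2 * (Lap V i j k * d i j k) + Lap d i j k * d i j k
          + (Lap d i j k * V i j k - d i j k * Lap V i j k))"
    unfolding Ld by (rule gsum_cong) (simp add: d_def algebra_simps)
  moreover have "gsum (\<lambda>i j k. Lap d i j k * V i j k) = gsum (\<lambda>i j k. d i j k * Lap V i j k)"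
    by (rule sum_Lap_selfadjoint[OF d V])
  ultimately have grad: "- gsum (grad_prod W W)
      \<le> - gsum (grad_prod V V) + 2 * gsum (\<lambda>i j k. Lap V i j k * d i j k)"
    unfolding gW gV gd
    by (simp add: gsum_add gsum_diff gsum_cmult mult.commute[of "d _ _ _"])
  have lap: "gsum (\<lambda>i j k. Lap (Lap W) i j k * d i j k) = gsum (\<lambda>i j k. Lap W i j k * Lap d i j k)"
    by (rule sum_Lap_selfadjoint[OF reflected_Lap[OF W] d])
  \<comment> \<open>The difference \<open>Lap (Lap W) * d - Lap W * Lap d\<close> has zero sum by
    \<open>lap\<close>; inserting it allows a pointwise proof.\<close>
  have "gsum (\<lambda>i j k. ?F (W i j k) + (1 - \<eta>)/2 * (W i j k)^2 + \<epsilon>/2 * (Lap W i j k)^2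
           + 2 * (Lap V i j k * d i j k) + \<epsilon> * (Lap (Lap W) i j k * d i j k - Lap W i j k * Lap d i j k))
      \<le> gsum (\<lambda>i j k. ?F (V i j k) + (1 - \<eta>)/2 * (V i j k)^2 + \<epsilon>/2 * (Lap V i j k)^2)"
  proof (rule gsum_mono)
    fix i j k assume g: "(i, j, k) \<in> grid N"
    let ?v = "V i j k" and ?w = "W i j k" and ?d = "d i j k"
    have F: "?F ?w \<le> ?F ?v + ?v^3 * ?d + 3/2 * M^2 * ?d^2"
      unfolding d_def by (rule trunc_quartic_upper[OF M[OF g]])
    \<comment> \<open>Exact, because \<open>\<alpha> * w + \<beta> * v\<close> is half of
      \<open>(\<alpha> + \<beta>) * (w + v) + (\<alpha> - \<beta>) * d\<close>.\<close>
    have quad: "(1 - \<eta>)/2 * ?w^2 = (1 - \<eta>)/2 * ?v^2 + (\<alpha> * ?w + \<beta> * ?v) * ?d - (\<alpha> - \<beta>)/2 * ?d^2"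
      unfolding ab[symmetric] d_def by (simp add: field_simps power2_eq_square)
    have "(Lap W i j k)^2 / 2 - Lap W i j k * Lap d i j k \<le> (Lap V i j k)^2 / 2"
      using zero_le_power2[of "Lap d i j k"] unfolding Ld
      by (simp add: power2_eq_square algebra_simps del: zero_le_power2)
    then have "\<epsilon> * ((Lap W i j k)^2 / 2 - Lap W i j k * Lap d i j k) \<le> \<epsilon> * ((Lap V i j k)^2 / 2)"
      using eps by (intro mult_left_mono) simp_all
    then have L: "\<epsilon>/2 * (Lap W i j k)^2 - \<epsilon> * (Lap W i j k * Lap d i j k) \<le> \<epsilon>/2 * (Lap V i j k)^2"
      by (simp add: algebra_simps)
    have "(?v^3 + \<alpha> * ?w + \<beta> * ?v + \<epsilon> * Lap (Lap W) i j k + 2 * Lap V i j k) * ?d = - ?d / dt * ?d"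
    proof -
      have "?v^3 + \<alpha> * ?w + \<beta> * ?v + \<epsilon> * Lap (Lap W) i j k + 2 * Lap V i j k = - ?d / dt"
        using scheme[OF g] unfolding d_def minus_divide_left by linarith
      then show ?thesis by (simp only:)
    qed
    moreover have "- ?d / dt * ?d + (3 * M^2 - (\<alpha> - \<beta>)) / 2 * ?d^2 \<le> 0"
    proof -
      have "(3 * M^2 - (\<alpha> - \<beta>)) / 2 \<le> 1 / dt" using dt by (simp add: field_simps)
      then have "(3 * M^2 - (\<alpha> - \<beta>)) / 2 * ?d^2 \<le> 1 / dt * ?d^2" by (rule mult_right_mono) simp
      then show ?thesis by (simp add: power2_eq_square)
    qed
    ultimately have "?v^3 * ?d + 3/2 * M^2 * ?d^2 + (\<alpha> * ?w + \<beta> * ?v) * ?d - (\<alpha> - \<beta>)/2 * ?d^2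
        + \<epsilon> * (Lap (Lap W) i j k * ?d) + 2 * (Lap V i j k * ?d) \<le> 0"
      by (simp add: field_simps)
    with F quad L show "?F ?w + (1 - \<eta>)/2 * ?w^2 + \<epsilon>/2 * (Lap W i j k)^2
           + 2 * (Lap V i j k * ?d) + \<epsilon> * (Lap (Lap W) i j k * ?d - Lap W i j k * Lap d i j k)
        \<le> ?F ?v + (1 - \<eta>)/2 * ?v^2 + \<epsilon>/2 * (Lap V i j k)^2"
      unfolding right_diff_distrib by linarith
  qed
  then show ?thesis
    using grad lap unfolding energy_def
    by (simp add: gsum_add gsum_diff gsum_cmult)
qed

text \<open>Here \<open>q\<close> stands for the difference quotient of the cube, and the implicit
  term with \<open>\<alpha> \<ge> 0\<close> only helps. In the factors,
  \<open>K + \<bar>\<beta>\<bar>\<close> comes from splitting the product of old and new error, the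
  1 from the truncation error, and \<open>2 / \<epsilon>\<close> from absorbing the explicit
  Laplacian.\<close>

lemma error_step:
  assumes e: "reflected e" and e': "reflected e'" and eps: "\<epsilon> > 0" and dt: "dt > 0"
    and a: "\<alpha> \<ge> 0"
    and q: "\<And>i j k. (i, j, k) \<in> grid N \<Longrightarrow> \<bar>q i j k\<bar> \<le> K"
    and \<tau>: "\<And>i j k. (i, j, k) \<in> grid N \<Longrightarrow> \<bar>\<tau> i j k\<bar> \<le> \<tau>0"
    and eq: "\<And>i j k. (i, j, k) \<in> grid N \<Longrightarrow> (e' i j k - e i j k) / dt =
      - (q i j k * e i j k + \<alpha> * e' i j k + \<beta> * e i j k + \<epsilon> * Lap (Lap e') i j k + 2 * Lap e i j k) - \<tau> i j k"
  shows "(1 - dt * (K + \<bar>\<beta>\<bar> + 1)) * gsum (\<lambda>i j k. (e' i j k)^2)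
    \<le> (1 + dt * (K + \<bar>\<beta>\<bar> + 2 / \<epsilon>)) * gsum (\<lambda>i j k. (e i j k)^2) + dt * (\<tau>0^2 * (real Nx * real Ny * real Nz))"
proof -
  have s1: "gsum (\<lambda>i j k. Lap (Lap e') i j k * e' i j k) = gsum (\<lambda>i j k. Lap e' i j k * Lap e' i j k)"
    by (rule sum_Lap_selfadjoint[OF reflected_Lap[OF e'] e'])
  have s2: "gsum (\<lambda>i j k. Lap e i j k * e' i j k) = gsum (\<lambda>i j k. e i j k * Lap e' i j k)"
    by (rule sum_Lap_selfadjoint[OF e e'])
  \<comment> \<open>The two differences of Laplacian products have zero sum by \<open>s1\<close> and
    \<open>s2\<close>; they are inserted to allow a pointwise proof.\<close>
  have "gsum (\<lambda>i j k. 2 * (e' i j k)^2 + 2 * dt * \<epsilon> * (Lap (Lap e') i j k * e' i j k - Lap e' i j k * Lap e' i j k)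
        + 4 * dt * (Lap e i j k * e' i j k - e i j k * Lap e' i j k))
    \<le> gsum (\<lambda>i j k. (1 + dt * (K + \<bar>\<beta>\<bar> + 2 / \<epsilon>)) * (e i j k)^2 + dt * \<tau>0^2
        + (1 + dt * (K + \<bar>\<beta>\<bar> + 1)) * (e' i j k)^2)"
  proof (rule gsum_mono)
    fix i j k assume g: "(i, j, k) \<in> grid N"
    let ?e = "e i j k" and ?f = "e' i j k" and ?L = "Lap e' i j k" and ?t = "\<tau> i j k" and ?q = "q i j k"
    have eq': "?f = ?e - dt * (?q * ?e + \<alpha> * ?f + \<beta> * ?e + \<epsilon> * Lap (Lap e') i j k + 2 * Lap e i j k) - dt * ?t"
    proof -
      have "?f - ?e = (- (?q * ?e + \<alpha> * ?f + \<beta> * ?e + \<epsilon> * Lap (Lap e') i j k + 2 * Lap e i j k) - ?t) * dt"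
        using eq[OF g] dt by (simp only: divide_eq_eq)
      then show ?thesis by (simp add: algebra_simps)
    qed
    have K: "K \<ge> 0" using q[OF g] by simp
    have ef: "2 * \<bar>?e * ?f\<bar> \<le> ?e^2 + ?f^2"
      using sum_squares_bound[of "\<bar>?e\<bar>" "\<bar>?f\<bar>"] by (simp add: abs_mult)
    have tf: "2 * \<bar>?t * ?f\<bar> \<le> \<tau>0^2 + ?f^2"
    proof -
      have "?t^2 \<le> \<tau>0^2" using \<tau>[OF g] abs_le_square_iff[of ?t \<tau>0] by simp
      then show ?thesis using sum_squares_bound[of "\<bar>?t\<bar>" "\<bar>?f\<bar>"] by (simp add: abs_mult)
    qed
    have gen: "- 2 * z \<le> A * X" if "\<bar>z\<bar> \<le> A * w" "A * (2 * w) \<le> A * X" for z A w X :: real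
      using that by linarith
    have qf: "- 2 * ((?q + \<beta>) * (?e * ?f)) \<le> (K + \<bar>\<beta>\<bar>) * (?e^2 + ?f^2)"
    proof (rule gen)
      show "\<bar>(?q + \<beta>) * (?e * ?f)\<bar> \<le> (K + \<bar>\<beta>\<bar>) * \<bar>?e * ?f\<bar>"
        unfolding abs_mult[of "?q + \<beta>"] using q[OF g] by (intro mult_right_mono) auto
      show "(K + \<bar>\<beta>\<bar>) * (2 * \<bar>?e * ?f\<bar>) \<le> (K + \<bar>\<beta>\<bar>) * (?e^2 + ?f^2)"
        using ef K by (intro mult_left_mono) auto
    qed
    \<comment> \<open>Completing the square with exactly the weight that uses up
      \<open>2 * \<epsilon> * ?L^2\<close>.\<close>
    have L: "- 2 * \<epsilon> * ?L^2 - 4 * (?e * ?L) \<le> 2 / \<epsilon> * ?e^2"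
    proof -
      have "0 \<le> 2 / \<epsilon> * (\<epsilon> * ?L + ?e)^2" using eps by simp
      also have "\<dots> = 2 / \<epsilon> * ?e^2 + 2 * \<epsilon> * ?L^2 + 4 * (?e * ?L)"
        using eps by (simp add: field_simps power2_eq_square)
      finally show ?thesis by linarith
    qed
    have *: "dt * (- 2 * ((?q + \<beta>) * (?e * ?f)) - 2 * \<epsilon> * ?L^2 - 4 * (?e * ?L) - 2 * (\<alpha> * ?f^2) - 2 * (?t * ?f))
        \<le> dt * ((K + \<bar>\<beta>\<bar>) * (?e^2 + ?f^2) + 2 / \<epsilon> * ?e^2 + (\<tau>0^2 + ?f^2))"
    proof (rule mult_left_mono)
      have "0 \<le> \<alpha> * ?f^2" using a by simp
      moreover have "- 2 * (?t * ?f) \<le> \<tau>0^2 + ?f^2" using tf by linarith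
      ultimately show "- 2 * ((?q + \<beta>) * (?e * ?f)) - 2 * \<epsilon> * ?L^2 - 4 * (?e * ?L) - 2 * (\<alpha> * ?f^2) - 2 * (?t * ?f)
        \<le> (K + \<bar>\<beta>\<bar>) * (?e^2 + ?f^2) + 2 / \<epsilon> * ?e^2 + (\<tau>0^2 + ?f^2)"
        using qf L by linarith
    qed (use dt in simp)
    have **: "2 * ?f^2 = 2 * (?e * ?f) + dt * (- 2 * ((?q + \<beta>) * (?e * ?f)) - 2 * (\<alpha> * ?f^2) - 2 * (?t * ?f)
        - 2 * \<epsilon> * (Lap (Lap e') i j k * ?f) - 4 * (Lap e i j k * ?f))"
    proof -
      have "2 * f^2 = 2 * (e * f) + dt * (- 2 * ((q + \<beta>) * (e * f)) - 2 * (\<alpha> * f^2) - 2 * (t * f)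
          - 2 * \<epsilon> * (X * f) - 4 * (Y * f))"
        if "f = e - dt * (q * e + \<alpha> * f + \<beta> * e + \<epsilon> * X + 2 * Y) - dt * t" for e f q t X Y :: real
      proof -
        have "2 * f^2 = 2 * (f * f)" by (simp add: power2_eq_square)
        also have "\<dots> = 2 * ((e - dt * (q * e + \<alpha> * f + \<beta> * e + \<epsilon> * X + 2 * Y) - dt * t) * f)"
          by (rule arg_cong[where f = "\<lambda>x. 2 * (x * f)", OF that])
        also have "\<dots> = 2 * (e * f) + dt * (- 2 * ((q + \<beta>) * (e * f)) - 2 * (\<alpha> * f^2) - 2 * (t * f)
          - 2 * \<epsilon> * (X * f) - 4 * (Y * f))"
          by (simp add: algebra_simps power2_eq_square)
        finally show ?thesis .
      qed
      from this[OF eq'] show ?thesis .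
    qed
    have "2 * ?f^2 + 2 * dt * \<epsilon> * (Lap (Lap e') i j k * ?f - ?L * ?L)
        + 4 * dt * (Lap e i j k * ?f - ?e * ?L)
      = 2 * (?e * ?f) + dt * (- 2 * ((?q + \<beta>) * (?e * ?f)) - 2 * \<epsilon> * ?L^2 - 4 * (?e * ?L)
          - 2 * (\<alpha> * ?f^2) - 2 * (?t * ?f))"
      unfolding ** by (simp add: algebra_simps power2_eq_square)
    also have "\<dots> \<le> (?e^2 + ?f^2) + dt * ((K + \<bar>\<beta>\<bar>) * (?e^2 + ?f^2) + 2 / \<epsilon> * ?e^2 + (\<tau>0^2 + ?f^2))"
      using ef * by (intro add_mono) auto
    also have "\<dots> = (1 + dt * (K + \<bar>\<beta>\<bar> + 2 / \<epsilon>)) * ?e^2 + dt * \<tau>0^2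
        + (1 + dt * (K + \<bar>\<beta>\<bar> + 1)) * ?f^2"
      by (simp add: algebra_simps)
    finally show "2 * ?f^2 + 2 * dt * \<epsilon> * (Lap (Lap e') i j k * ?f - ?L * ?L)
        + 4 * dt * (Lap e i j k * ?f - ?e * ?L)
      \<le> (1 + dt * (K + \<bar>\<beta>\<bar> + 2 / \<epsilon>)) * ?e^2 + dt * \<tau>0^2 + (1 + dt * (K + \<bar>\<beta>\<bar> + 1)) * ?f^2" .
  qed
  then show ?thesis
    using s1 s2 by (simp only: gsum_add gsum_diff gsum_cmult gsum_const) (simp add: algebra_simps)
qed

text \<open>Both cases of the scheme split \<open>1 - \<eta>\<close> into its positive part
  \<open>\<alpha>\<close>, taken implicitly, and its negative part \<open>\<beta>\<close>, taken
  explicitly. This is how \<open>\<bar>1 - \<eta>\<bar>\<close>, the difference of the two, enters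
  the step-size condition.\<close>

lemma scheme_on_extension:
  assumes "SH_scheme \<epsilon> \<eta> l N dt U"
  obtains \<alpha> \<beta> where "\<alpha> \<ge> 0" "\<alpha> + \<beta> = 1 - \<eta>" "\<alpha> - \<beta> = \<bar>1 - \<eta>\<bar>" "\<bar>\<beta>\<bar> \<le> \<bar>1 - \<eta>\<bar>"
    "\<And>n i j k. (i, j, k) \<in> grid N \<Longrightarrow> (ext (U (Suc n)) i j k - ext (U n) i j k) / dt =
      - ((ext (U n) i j k)^3 + \<alpha> * ext (U (Suc n)) i j k + \<beta> * ext (U n) i j k
        + \<epsilon> * Lap (Lap (ext (U (Suc n)))) i j k + 2 * Lap (ext (U n)) i j k)"
proof -
  define \<alpha> where "\<alpha> = (if \<eta> < 1 then 1 - \<eta> else 0)"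
  define \<beta> where "\<beta> = (if \<eta> < 1 then 0 else 1 - \<eta>)"
  have "(ext (U (Suc n)) i j k - ext (U n) i j k) / dt =
      - ((ext (U n) i j k)^3 + \<alpha> * ext (U (Suc n)) i j k + \<beta> * ext (U n) i j k
        + \<epsilon> * Lap (Lap (ext (U (Suc n)))) i j k + 2 * Lap (ext (U n)) i j k)"
    if g: "(i, j, k) \<in> grid N" for n i j k
  proof -
    have "(U (n + 1) i j k - U n i j k) / dt =
          (if \<eta> < 1
           then - ((U n i j k)^3 + ((1 - \<eta>) * U (n + 1) i j k + \<epsilon> * Lap (Lap (ext (U (n + 1)))) i j k)
             + 2 * Lap (ext (U n)) i j k)
           else - ((U n i j k)^3 + \<epsilon> * Lap (Lap (ext (U (n + 1)))) i j k
             - ((\<eta> - 1) * U n i j k - 2 * Lap (ext (U n)) i j k)))"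
      using assms g unfolding SH_scheme_def Let_def mesh.simps by blast
    then show ?thesis
      unfolding ext_grid[OF g] \<alpha>_def \<beta>_def by (simp add: algebra_simps split: if_splits)
  qed
  then show ?thesis by (rule that[rotated -1]) (auto simp: \<alpha>_def \<beta>_def)
qed

text \<open>Induction carrying the truncated energy bound along with the pointwise bound: the
  pointwise bound permits the next energy step, and the energy bound returns the pointwise one
  through \<open>sobolev_bound\<close>.\<close>

lemma numerical_bound:
  assumes C: "discrete_sobolev_const l C" and eps: "\<epsilon> > 0" and zeta: "\<zeta> > 1 / \<epsilon> + \<eta> - 1"
    and dt: "dt > 0" and scheme: "SH_scheme \<epsilon> \<eta> l N dt U"
    and M: "M = M_const C \<epsilon> \<eta> \<zeta> l N (U 0)"
    and cond: "3 * M^2 \<le> \<bar>1 - \<eta>\<bar> \<or> 3 * M^2 > \<bar>1 - \<eta>\<bar> \<and> dt \<le> 2 / (3 * M^2 - \<bar>1 - \<eta>\<bar>)"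
    and g: "(i, j, k) \<in> grid N"
  shows "\<bar>U n i j k\<bar> \<le> M"
proof -
  let ?F = "trunc_quartic M"
  define H where "H = H_d \<epsilon> \<eta> l N (U 0)"
  have M1: "sqrt (max 0 \<zeta>) \<le> M" and M2: "sqrt (C^2 / C_const \<epsilon> \<eta> \<zeta> * (H + \<zeta>^2 / 4 * vol l)) \<le> M"
    unfolding M M_const_def H_def by simp_all
  have "0 \<le> sqrt (max 0 \<zeta>)" by simp
  then have M0: "M \<ge> 0" using M1 by linarith
  have "(sqrt (max 0 \<zeta>))^2 \<le> M^2" using M1 by (intro power_mono) auto
  then have MZ: "\<zeta> \<le> M^2" by simp
  have F: "\<zeta> / 2 * x^2 - \<zeta>^2 / 4 \<le> ?F x" for x by (rule trunc_quartic_lower[OF M0 MZ])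
  have F4: "\<zeta> / 2 * x^2 - \<zeta>^2 / 4 \<le> x^4 / 4" for x
  proof -
    have "0 \<le> (x^2 - \<zeta>)^2" by simp
    also have "(x^2 - \<zeta>)^2 = x^4 - 2 * \<zeta> * x^2 + \<zeta>^2" by (simp add: power2_eq_square power4_eq_xxxx algebra_simps)
    finally show ?thesis by simp
  qed
  have dtM: "dt * (3 * M^2 - \<bar>1 - \<eta>\<bar>) \<le> 2"
    using cond
  proof
    assume "3 * M^2 \<le> \<bar>1 - \<eta>\<bar>"
    then have "dt * (3 * M^2 - \<bar>1 - \<eta>\<bar>) \<le> 0" using dt by (intro mult_nonneg_nonpos) auto
    then show ?thesis by linarith
  next
    assume "3 * M^2 > \<bar>1 - \<eta>\<bar> \<and> dt \<le> 2 / (3 * M^2 - \<bar>1 - \<eta>\<bar>)"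
    then have "3 * M^2 - \<bar>1 - \<eta>\<bar> > 0" "dt \<le> 2 / (3 * M^2 - \<bar>1 - \<eta>\<bar>)" by auto
    then show ?thesis by (simp only: pos_le_divide_eq)
  qed
  have bound: "\<bar>V i j k\<bar> \<le> M"
    if "energy G \<epsilon> \<eta> (ext V) * cell \<le> H" "\<And>x. \<zeta> / 2 * x^2 - \<zeta>^2 / 4 \<le> G x" "(i, j, k) \<in> grid N" for V G i j k
    using sobolev_bound[OF C that(2) eps zeta that(1,3)] M2 by linarith
  obtain \<alpha> \<beta> where ab: "\<alpha> + \<beta> = 1 - \<eta>" "\<alpha> - \<beta> = \<bar>1 - \<eta>\<bar>"
    and sch: "\<And>n i j k. (i, j, k) \<in> grid N \<Longrightarrow> (ext (U (Suc n)) i j k - ext (U n) i j k) / dt =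
      - ((ext (U n) i j k)^3 + \<alpha> * ext (U (Suc n)) i j k + \<beta> * ext (U n) i j k
        + \<epsilon> * Lap (Lap (ext (U (Suc n)))) i j k + 2 * Lap (ext (U n)) i j k)"
    using scheme_on_extension[OF scheme] by metis
  have "(\<forall>(i, j, k)\<in>grid N. \<bar>U n i j k\<bar> \<le> M) \<and> energy ?F \<epsilon> \<eta> (ext (U n)) * cell \<le> H" for n
  proof (induction n)
    case 0
    \<comment> \<open>The untruncated quartic comes first: that the truncated energy equals
      \<open>H\<close> is deduced from the bound by \<open>M\<close> on \<open>U 0\<close>.\<close>
    have "energy (\<lambda>x. x^4 / 4) \<epsilon> \<eta> (ext (U 0)) * cell = H"
      unfolding H_def by (rule H_d_eq_energy[symmetric]) simp
    then have b: "\<bar>U 0 i j k\<bar> \<le> M" if "(i, j, k) \<in> grid N" for i j k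
      using bound[of "\<lambda>x. x^4 / 4" "U 0" i j k] F4 that by simp
    have "energy ?F \<epsilon> \<eta> (ext (U 0)) * cell = H"
      unfolding H_def by (rule H_d_eq_energy[symmetric]) (use b in \<open>simp add: trunc_quartic_def\<close>)
    then show ?case using b by auto
  next
    case (Suc n)
    have "energy ?F \<epsilon> \<eta> (ext (U (Suc n))) \<le> energy ?F \<epsilon> \<eta> (ext (U n))"
    proof (rule energy_decreasing[OF reflected_ext reflected_ext _ eps dt _ ab(1) sch])
      show "\<bar>ext (U n) i j k\<bar> \<le> M" if "(i, j, k) \<in> grid N" for i j k
        using Suc that unfolding ext_grid[OF that] by auto
      show "dt * (3 * M^2 - (\<alpha> - \<beta>)) \<le> 2" unfolding ab(2) by (rule dtM)
    qed
    then have "energy ?F \<epsilon> \<eta> (ext (U (Suc n))) * cell \<le> energy ?F \<epsilon> \<eta> (ext (U n)) * cell"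
      using cell_pos by (intro mult_right_mono) auto
    then have E: "energy ?F \<epsilon> \<eta> (ext (U (Suc n))) * cell \<le> H" using Suc by linarith
    have "\<bar>U (Suc n) i j k\<bar> \<le> M" if "(i, j, k) \<in> grid N" for i j k
      by (rule bound[OF E F that])
    then show ?case using E by blast
  qed
  then show ?thesis using g by blast
qed

end

section \<open>Second differences\<close>

text \<open>Two-sided derivatives along single directions suffice for Taylor expansion on
  axis-parallel lines; nothing is claimed about joint differentiability of the reflected
  solution.\<close>

definition deriv_along :: "'a::real_vector \<Rightarrow> ('a \<Rightarrow> real) \<Rightarrow> ('a \<Rightarrow> real) \<Rightarrow> 'a \<Rightarrow> bool" where
  "deriv_along v f f' p \<longleftrightarrow> ((\<lambda>s. f (p + s *\<^sub>R v)) has_real_derivative f' p) (at 0)"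

text \<open>The stencil acts on functions of a continuous point, so that it can itself be
  differentiated, as in \<open>deriv_along_diff2\<close>.\<close>

definition diff2 :: "real \<Rightarrow> 'a::real_vector \<Rightarrow> ('a \<Rightarrow> real) \<Rightarrow> 'a \<Rightarrow> real" where
  "diff2 h v f p = (f (p + h *\<^sub>R v) - 2 * f p + f (p - h *\<^sub>R v)) / h^2"

definition lap_h :: "real \<Rightarrow> real \<Rightarrow> real \<Rightarrow> (point \<Rightarrow> real) \<Rightarrow> point \<Rightarrow> real" where
  "lap_h hx hy hz f p = diff2 hx (1, 0, 0) f p + diff2 hy (0, 1, 0) f p + diff2 hz (0, 0, 1) f p"

lemma deriv_along_line:
  assumes "deriv_along v f f' (p + s *\<^sub>R v)"
  shows "((\<lambda>s. f (p + s *\<^sub>R v)) has_real_derivative f' (p + s *\<^sub>R v)) (at s)"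
proof -
  have "((\<lambda>t. f (p + (s + t) *\<^sub>R v)) has_real_derivative f' (p + s *\<^sub>R v)) (at 0)"
    using assms by (simp add: deriv_along_def algebra_simps)
  then show ?thesis
    using DERIV_shift[of "\<lambda>s. f (p + s *\<^sub>R v)" _ 0 s] by (simp add: add.commute)
qed

lemma diff2_add: "diff2 h v (\<lambda>p. f p + g p) p = diff2 h v f p + diff2 h v g p"
  by (simp add: diff2_def add_divide_distrib diff_divide_distrib algebra_simps)

lemma deriv_along_diff:
  assumes "deriv_along w f f' p" "deriv_along w g g' p"
  shows "deriv_along w (\<lambda>p. f p - g p) (\<lambda>p. f' p - g' p) p"
  using assms unfolding deriv_along_def by (rule DERIV_diff)

lemma deriv_along_diff2:
  assumes "\<And>s. s \<in> {0, h, - h} \<Longrightarrow> deriv_along w f f' (p + s *\<^sub>R v)"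
  shows "deriv_along w (diff2 h v f) (diff2 h v f') p"
proof -
  have "((\<lambda>s. f (p + h *\<^sub>R v + s *\<^sub>R w)) has_real_derivative f' (p + h *\<^sub>R v)) (at 0)"
    "((\<lambda>s. f (p + s *\<^sub>R w)) has_real_derivative f' p) (at 0)"
    "((\<lambda>s. f (p - h *\<^sub>R v + s *\<^sub>R w)) has_real_derivative f' (p - h *\<^sub>R v)) (at 0)"
    using assms[of h] assms[of 0] assms[of "- h"] by (simp_all add: deriv_along_def)
  then have "((\<lambda>s. (f (p + h *\<^sub>R v + s *\<^sub>R w) - 2 * f (p + s *\<^sub>R w) + f (p - h *\<^sub>R v + s *\<^sub>R w)) / h^2)
     has_real_derivative (f' (p + h *\<^sub>R v) - 2 * f' p + f' (p - h *\<^sub>R v)) / h^2) (at 0)"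
    by (intro DERIV_cdivide DERIV_add DERIV_diff DERIV_cmult)
  then show ?thesis by (simp add: deriv_along_def diff2_def algebra_simps)
qed

text \<open>In the Taylor expansions at \<open>h\<close> and \<open>- h\<close> the constant and
  linear terms cancel, so the second difference is the mean of two values of the second
  derivative.\<close>

lemma diff2_bound:
  assumes h: "h > 0"
    and d: "\<And>s. \<bar>s\<bar> \<le> h \<Longrightarrow> deriv_along v f f1 (p + s *\<^sub>R v)"
      "\<And>s. \<bar>s\<bar> \<le> h \<Longrightarrow> deriv_along v f1 f2 (p + s *\<^sub>R v)"
    and B: "\<And>s. \<bar>s\<bar> \<le> h \<Longrightarrow> \<bar>f2 (p + s *\<^sub>R v)\<bar> \<le> B"
  shows "\<bar>diff2 h v f p\<bar> \<le> B"
proof -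
  define F where "F = (\<lambda>(m::nat) s. (if m = 0 then f else if m = 1 then f1 else f2) (p + s *\<^sub>R v))"
  have "\<forall>m t. m < 2 \<and> \<bar>t\<bar> \<le> h \<longrightarrow> DERIV (F m) t :> F (Suc m) t"
    using deriv_along_line[OF d(1)] deriv_along_line[OF d(2)] by (auto simp: F_def less_2_cases_iff)
  then have tay: "\<exists>t. \<bar>t\<bar> \<le> h \<and> F 0 x = (\<Sum>m<2. F m 0 / fact m * x ^ m) + F 2 t / fact 2 * x ^ 2"
    if "\<bar>x\<bar> = h" for x
    using Maclaurin_bi_le[of F "F 0" 2 x] that by auto
  obtain t1 where t1: "\<bar>t1\<bar> \<le> h" "F 0 h = F 0 0 + F 1 0 * h + F 2 t1 / 2 * h^2"
    using tay[of h] h by (auto simp: numeral_2_eq_2)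
  obtain t2 where t2: "\<bar>t2\<bar> \<le> h" "F 0 (- h) = F 0 0 - F 1 0 * h + F 2 t2 / 2 * h^2"
    using tay[of "- h"] h by (auto simp: numeral_2_eq_2)
  have "diff2 h v f p = (F 0 h - 2 * F 0 0 + F 0 (- h)) / h^2"
    by (simp add: diff2_def F_def)
  also have "\<dots> = (F 2 t1 + F 2 t2) / 2"
    unfolding t1 t2 using h by (simp add: field_simps)
  finally show ?thesis using B[OF t1(1)] B[OF t2(1)] by (simp add: F_def abs_le_iff)
qed

lemma diff2_taylor:
  assumes h: "h > 0"
    and d: "\<And>i s. i < 4 \<Longrightarrow> \<bar>s\<bar> \<le> h \<Longrightarrow> deriv_along v (a i) (a (Suc i)) (p + s *\<^sub>R v)"
    and B: "\<And>s. \<bar>s\<bar> \<le> h \<Longrightarrow> \<bar>a 4 (p + s *\<^sub>R v)\<bar> \<le> B"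
  shows "\<bar>diff2 h v (a 0) p - a 2 p\<bar> \<le> B * h^2 / 12"
proof -
  define F where "F m s = a m (p + s *\<^sub>R v)" for m s
  have "\<forall>m t. m < 4 \<and> \<bar>t\<bar> \<le> h \<longrightarrow> DERIV (F m) t :> F (Suc m) t"
    using d deriv_along_line unfolding F_def by blast
  then have tay: "\<exists>t. \<bar>t\<bar> \<le> h \<and> F 0 x = (\<Sum>m<4. F m 0 / fact m * x ^ m) + F 4 t / fact 4 * x ^ 4"
    if "\<bar>x\<bar> = h" for x
    using Maclaurin_bi_le[of F "F 0" 4 x] that by auto
  have s4: "(\<Sum>m<4. g m) = g 0 + g 1 + g 2 + g (3::nat)" for g :: "nat \<Rightarrow> real"
    by (simp add: eval_nat_numeral)
  obtain t1 where t1: "\<bar>t1\<bar> \<le> h"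
    "F 0 h = F 0 0 + F 1 0 * h + F 2 0 / 2 * h^2 + F 3 0 / 6 * h^3 + F 4 t1 / 24 * h^4"
    using tay[of h] h by (auto simp: s4 fact_numeral)
  obtain t2 where t2: "\<bar>t2\<bar> \<le> h"
    "F 0 (- h) = F 0 0 - F 1 0 * h + F 2 0 / 2 * h^2 - F 3 0 / 6 * h^3 + F 4 t2 / 24 * h^4"
    using tay[of "- h"] h by (auto simp: s4 fact_numeral)
  have "diff2 h v (a 0) p - a 2 p = (F 0 h - 2 * F 0 0 + F 0 (- h)) / h^2 - F 2 0"
    by (simp add: diff2_def F_def)
  also have "\<dots> = (F 4 t1 + F 4 t2) * h^2 / 24"
    unfolding t1 t2 using h by (simp add: field_simps power2_eq_square power4_eq_xxxx)
  finally have *: "diff2 h v (a 0) p - a 2 p = (F 4 t1 + F 4 t2) * h^2 / 24" .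
  have "\<bar>F 4 t1 + F 4 t2\<bar> \<le> 2 * B" using B[OF t1(1)] B[OF t2(1)] by (simp add: F_def abs_le_iff)
  then have "\<bar>F 4 t1 + F 4 t2\<bar> * h^2 \<le> 2 * B * h^2" by (rule mult_right_mono) simp
  moreover have "\<bar>(F 4 t1 + F 4 t2) * h^2 / 24\<bar> = \<bar>F 4 t1 + F 4 t2\<bar> * h^2 / 24" by (simp add: abs_mult)
  ultimately show ?thesis unfolding * by linarith
qed

text \<open>Differencing the inner Taylor error by size alone would cost a factor
  \<open>1 / k^2\<close>. Instead the inner error \<open>diff2 h v f - a 0\<close> is differentiated
  twice along \<open>w\<close>; the result is the inner Taylor error of \<open>f2\<close>, of order
  \<open>h^2\<close>, and \<open>diff2_bound\<close> applies. In use, \<open>a\<close> lists the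
  \<open>w\<close>-derivatives of the second \<open>v\<close>-derivative of \<open>f\<close>,
  \<open>b\<close> the \<open>v\<close>-derivatives of \<open>f2\<close>, and
  \<open>a 2 = b 2\<close> is the symmetry of the mixed fourth derivative.\<close>

lemma diff2_diff2_taylor:
  assumes h: "h > 0" and k: "k > 0"
    and f: "\<And>s r. \<bar>s\<bar> \<le> h \<Longrightarrow> \<bar>r\<bar> \<le> k \<Longrightarrow> deriv_along w f f1 (p + r *\<^sub>R w + s *\<^sub>R v)"
      "\<And>s r. \<bar>s\<bar> \<le> h \<Longrightarrow> \<bar>r\<bar> \<le> k \<Longrightarrow> deriv_along w f1 f2 (p + r *\<^sub>R w + s *\<^sub>R v)"
    and a: "\<And>i r. i < 4 \<Longrightarrow> \<bar>r\<bar> \<le> k \<Longrightarrow> deriv_along w (a i) (a (Suc i)) (p + r *\<^sub>R w)"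
    and b: "\<And>i s r. i < 4 \<Longrightarrow> \<bar>s\<bar> \<le> h \<Longrightarrow> \<bar>r\<bar> \<le> k \<Longrightarrow>
      deriv_along v (b i) (b (Suc i)) (p + r *\<^sub>R w + s *\<^sub>R v)"
    and b0: "b 0 = f2" and ab: "a 2 = b 2"
    and Ba: "\<And>r. \<bar>r\<bar> \<le> k \<Longrightarrow> \<bar>a 4 (p + r *\<^sub>R w)\<bar> \<le> B"
    and Bb: "\<And>s r. \<bar>s\<bar> \<le> h \<Longrightarrow> \<bar>r\<bar> \<le> k \<Longrightarrow> \<bar>b 4 (p + r *\<^sub>R w + s *\<^sub>R v)\<bar> \<le> B"
  shows "\<bar>diff2 k w (diff2 h v f) p - a 2 p\<bar> \<le> B * h^2 / 12 + B * k^2 / 12"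
proof -
  define g where "g q = diff2 h v f q - a 0 q" for q
  have "\<bar>diff2 k w g p\<bar> \<le> B * h^2 / 12"
  proof (rule diff2_bound[OF k])
    fix r assume r: "\<bar>r\<bar> \<le> k"
    have f': "deriv_along w f f1 (p + r *\<^sub>R w + s *\<^sub>R v)" "deriv_along w f1 f2 (p + r *\<^sub>R w + s *\<^sub>R v)"
      if "s \<in> {0, h, - h}" for s
      using f[of s r] that r h by auto
    show "deriv_along w g (\<lambda>q. diff2 h v f1 q - a 1 q) (p + r *\<^sub>R w)"
      unfolding g_def using a[of 0 r] f'(1) r
      by (intro deriv_along_diff deriv_along_diff2) auto
    show "deriv_along w (\<lambda>q. diff2 h v f1 q - a 1 q) (\<lambda>q. diff2 h v f2 q - a 2 q) (p + r *\<^sub>R w)"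
      using a[of 1 r] f'(2) r
      by (intro deriv_along_diff deriv_along_diff2) (auto simp: numeral_2_eq_2)
    show "\<bar>diff2 h v f2 (p + r *\<^sub>R w) - a 2 (p + r *\<^sub>R w)\<bar> \<le> B * h^2 / 12"
      using diff2_taylor[OF h, of v b "p + r *\<^sub>R w" B] b Bb r unfolding b0 ab by blast
  qed
  moreover have "\<bar>diff2 k w (a 0) p - a 2 p\<bar> \<le> B * k^2 / 12"
    by (rule diff2_taylor[OF k a Ba])
  moreover have "diff2 k w (diff2 h v f) p = diff2 k w g p + diff2 k w (a 0) p"
    unfolding diff2_add[symmetric] g_def by simp
  ultimately show ?thesis by linarith
qed

section \<open>Second-order consistency of the difference Laplacian and its square\<close>

locale partials =
  fixes G :: "nat \<Rightarrow> nat \<Rightarrow> nat \<Rightarrow> point \<Rightarrow> real" and R :: "point set" and B :: real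
  assumes Gx: "\<And>a b c q. a + b + c \<le> 5 \<Longrightarrow> q \<in> R \<Longrightarrow> deriv_along (1, 0, 0) (G a b c) (G (Suc a) b c) q"
    and Gy: "\<And>a b c q. a + b + c \<le> 5 \<Longrightarrow> q \<in> R \<Longrightarrow> deriv_along (0, 1, 0) (G a b c) (G a (Suc b) c) q"
    and Gz: "\<And>a b c q. a + b + c \<le> 5 \<Longrightarrow> q \<in> R \<Longrightarrow> deriv_along (0, 0, 1) (G a b c) (G a b (Suc c)) q"
    and bound: "\<And>a b c q. a + b + c \<le> 6 \<Longrightarrow> q \<in> R \<Longrightarrow> \<bar>G a b c q\<bar> \<le> B"
begin

context
  fixes hx hy hz :: real and p :: point
  assumes h: "hx > 0" "hy > 0" "hz > 0"
    and R: "\<And>x y z. \<bar>x\<bar> \<le> 2 * hx \<Longrightarrow> \<bar>y\<bar> \<le> 2 * hy \<Longrightarrow> \<bar>z\<bar> \<le> 2 * hz \<Longrightarrow> p + (x, y, z) \<in> R"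
begin

lemma stencil_mem:
  "\<bar>s\<bar> \<le> hx \<Longrightarrow> \<bar>r\<bar> \<le> hx \<Longrightarrow> p + r *\<^sub>R (1, 0, 0) + s *\<^sub>R (1, 0, 0) \<in> R"
  "\<bar>s\<bar> \<le> hx \<Longrightarrow> \<bar>r\<bar> \<le> hy \<Longrightarrow> p + r *\<^sub>R (0, 1, 0) + s *\<^sub>R (1, 0, 0) \<in> R"
  "\<bar>s\<bar> \<le> hx \<Longrightarrow> \<bar>r\<bar> \<le> hz \<Longrightarrow> p + r *\<^sub>R (0, 0, 1) + s *\<^sub>R (1, 0, 0) \<in> R"
  "\<bar>s\<bar> \<le> hy \<Longrightarrow> \<bar>r\<bar> \<le> hx \<Longrightarrow> p + r *\<^sub>R (1, 0, 0) + s *\<^sub>R (0, 1, 0) \<in> R"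
  "\<bar>s\<bar> \<le> hy \<Longrightarrow> \<bar>r\<bar> \<le> hy \<Longrightarrow> p + r *\<^sub>R (0, 1, 0) + s *\<^sub>R (0, 1, 0) \<in> R"
  "\<bar>s\<bar> \<le> hy \<Longrightarrow> \<bar>r\<bar> \<le> hz \<Longrightarrow> p + r *\<^sub>R (0, 0, 1) + s *\<^sub>R (0, 1, 0) \<in> R"
  "\<bar>s\<bar> \<le> hz \<Longrightarrow> \<bar>r\<bar> \<le> hx \<Longrightarrow> p + r *\<^sub>R (1, 0, 0) + s *\<^sub>R (0, 0, 1) \<in> R"
  "\<bar>s\<bar> \<le> hz \<Longrightarrow> \<bar>r\<bar> \<le> hy \<Longrightarrow> p + r *\<^sub>R (0, 1, 0) + s *\<^sub>R (0, 0, 1) \<in> R"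
  "\<bar>s\<bar> \<le> hz \<Longrightarrow> \<bar>r\<bar> \<le> hz \<Longrightarrow> p + r *\<^sub>R (0, 0, 1) + s *\<^sub>R (0, 0, 1) \<in> R"
  using R[of "r + s" 0 0] R[of s r 0] R[of s 0 r] R[of r s 0] R[of 0 "r + s" 0] R[of 0 s r]
    R[of r 0 s] R[of 0 r s] R[of 0 0 "r + s"] h
  by (simp_all add: add.assoc)

lemma stencil_mem_axis:
  "\<bar>r\<bar> \<le> hx \<Longrightarrow> p + r *\<^sub>R (1, 0, 0) \<in> R"
  "\<bar>r\<bar> \<le> hy \<Longrightarrow> p + r *\<^sub>R (0, 1, 0) \<in> R"
  "\<bar>r\<bar> \<le> hz \<Longrightarrow> p + r *\<^sub>R (0, 0, 1) \<in> R"
  using R[of r 0 0] R[of 0 r 0] R[of 0 0 r] h by simp_all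

lemma lap_h_consistent:
  "\<bar>lap_h hx hy hz (G 0 0 0) p - (G 2 0 0 p + G 0 2 0 p + G 0 0 2 p)\<bar> \<le> B * (hx^2 + hy^2 + hz^2) / 12"
proof -
  have "\<bar>diff2 hx (1, 0, 0) (G 0 0 0) p - G 2 0 0 p\<bar> \<le> B * hx^2 / 12"
    using diff2_taylor[OF h(1), of "(1, 0, 0)" "\<lambda>i. G i 0 0" p B] Gx bound stencil_mem_axis by simp
  moreover have "\<bar>diff2 hy (0, 1, 0) (G 0 0 0) p - G 0 2 0 p\<bar> \<le> B * hy^2 / 12"
    using diff2_taylor[OF h(2), of "(0, 1, 0)" "\<lambda>i. G 0 i 0" p B] Gy bound stencil_mem_axis by simp
  moreover have "\<bar>diff2 hz (0, 0, 1) (G 0 0 0) p - G 0 0 2 p\<bar> \<le> B * hz^2 / 12"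
    using diff2_taylor[OF h(3), of "(0, 0, 1)" "\<lambda>i. G 0 0 i" p B] Gz bound stencil_mem_axis by simp
  moreover have "B * (hx^2 + hy^2 + hz^2) / 12 = B * hx^2 / 12 + B * hy^2 / 12 + B * hz^2 / 12"
    by (simp add: algebra_simps)
  ultimately show ?thesis unfolding lap_h_def by linarith
qed

text \<open>The nine compositions of axis differences are expanded separately; symmetry of mixed
  partials is built into the indexing of \<open>G\<close>. Each squared mesh width enters six times
  with weight \<open>1 / 12\<close>, hence the final \<open>1 / 2\<close>.\<close>

lemma lap_h_lap_h_consistent:
  "\<bar>lap_h hx hy hz (lap_h hx hy hz (G 0 0 0)) p
    - (G 4 0 0 p + G 0 4 0 p + G 0 0 4 p + 2 * G 2 2 0 p + 2 * G 2 0 2 p + 2 * G 0 2 2 p)\<bar>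
    \<le> B * (hx^2 + hy^2 + hz^2) / 2"
proof -
  note * = diff2_diff2_taylor[where p = p and B = B and f = "G 0 0 0"]
  note s = stencil_mem stencil_mem_axis
  have xx: "\<bar>diff2 hx (1, 0, 0) (diff2 hx (1, 0, 0) (G 0 0 0)) p - G 4 0 0 p\<bar>
      \<le> B * hx^2 / 12 + B * hx^2 / 12"
    using *[where h = hx and k = hx and v = "(1, 0, 0)" and w = "(1, 0, 0)"
        and ?f1.0 = "G (Suc 0) 0 0" and ?f2.0 = "G (Suc (Suc 0)) 0 0"
        and a = "\<lambda>i. G (Suc (Suc i)) 0 0" and b = "\<lambda>i. G (Suc (Suc i)) 0 0",
        OF h(1) h(1) Gx Gx Gx Gx _ _ bound bound]
    by (simp add: s eval_nat_numeral del: scaleR_Pair)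
  have xy: "\<bar>diff2 hx (1, 0, 0) (diff2 hy (0, 1, 0) (G 0 0 0)) p - G 2 2 0 p\<bar>
      \<le> B * hy^2 / 12 + B * hx^2 / 12"
    using *[where h = hy and k = hx and v = "(0, 1, 0)" and w = "(1, 0, 0)"
        and ?f1.0 = "G (Suc 0) 0 0" and ?f2.0 = "G (Suc (Suc 0)) 0 0"
        and a = "\<lambda>i. G i (Suc (Suc 0)) 0" and b = "\<lambda>i. G (Suc (Suc 0)) i 0",
        OF h(2) h(1) Gx Gx Gx Gy _ _ bound bound]
    by (simp add: s eval_nat_numeral del: scaleR_Pair)
  have xz: "\<bar>diff2 hx (1, 0, 0) (diff2 hz (0, 0, 1) (G 0 0 0)) p - G 2 0 2 p\<bar>
      \<le> B * hz^2 / 12 + B * hx^2 / 12"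
    using *[where h = hz and k = hx and v = "(0, 0, 1)" and w = "(1, 0, 0)"
        and ?f1.0 = "G (Suc 0) 0 0" and ?f2.0 = "G (Suc (Suc 0)) 0 0"
        and a = "\<lambda>i. G i 0 (Suc (Suc 0))" and b = "\<lambda>i. G (Suc (Suc 0)) 0 i",
        OF h(3) h(1) Gx Gx Gx Gz _ _ bound bound]
    by (simp add: s eval_nat_numeral del: scaleR_Pair)
  have yx: "\<bar>diff2 hy (0, 1, 0) (diff2 hx (1, 0, 0) (G 0 0 0)) p - G 2 2 0 p\<bar>
      \<le> B * hx^2 / 12 + B * hy^2 / 12"
    using *[where h = hx and k = hy and v = "(1, 0, 0)" and w = "(0, 1, 0)"
        and ?f1.0 = "G 0 (Suc 0) 0" and ?f2.0 = "G 0 (Suc (Suc 0)) 0"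
        and a = "\<lambda>i. G (Suc (Suc 0)) i 0" and b = "\<lambda>i. G i (Suc (Suc 0)) 0",
        OF h(1) h(2) Gy Gy Gy Gx _ _ bound bound]
    by (simp add: s eval_nat_numeral del: scaleR_Pair)
  have yy: "\<bar>diff2 hy (0, 1, 0) (diff2 hy (0, 1, 0) (G 0 0 0)) p - G 0 4 0 p\<bar>
      \<le> B * hy^2 / 12 + B * hy^2 / 12"
    using *[where h = hy and k = hy and v = "(0, 1, 0)" and w = "(0, 1, 0)"
        and ?f1.0 = "G 0 (Suc 0) 0" and ?f2.0 = "G 0 (Suc (Suc 0)) 0"
        and a = "\<lambda>i. G 0 (Suc (Suc i)) 0" and b = "\<lambda>i. G 0 (Suc (Suc i)) 0",
        OF h(2) h(2) Gy Gy Gy Gy _ _ bound bound]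
    by (simp add: s eval_nat_numeral del: scaleR_Pair)
  have yz: "\<bar>diff2 hy (0, 1, 0) (diff2 hz (0, 0, 1) (G 0 0 0)) p - G 0 2 2 p\<bar>
      \<le> B * hz^2 / 12 + B * hy^2 / 12"
    using *[where h = hz and k = hy and v = "(0, 0, 1)" and w = "(0, 1, 0)"
        and ?f1.0 = "G 0 (Suc 0) 0" and ?f2.0 = "G 0 (Suc (Suc 0)) 0"
        and a = "\<lambda>i. G 0 i (Suc (Suc 0))" and b = "\<lambda>i. G 0 (Suc (Suc 0)) i",
        OF h(3) h(2) Gy Gy Gy Gz _ _ bound bound]
    by (simp add: s eval_nat_numeral del: scaleR_Pair)
  have zx: "\<bar>diff2 hz (0, 0, 1) (diff2 hx (1, 0, 0) (G 0 0 0)) p - G 2 0 2 p\<bar>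
      \<le> B * hx^2 / 12 + B * hz^2 / 12"
    using *[where h = hx and k = hz and v = "(1, 0, 0)" and w = "(0, 0, 1)"
        and ?f1.0 = "G 0 0 (Suc 0)" and ?f2.0 = "G 0 0 (Suc (Suc 0))"
        and a = "\<lambda>i. G (Suc (Suc 0)) 0 i" and b = "\<lambda>i. G i 0 (Suc (Suc 0))",
        OF h(1) h(3) Gz Gz Gz Gx _ _ bound bound]
    by (simp add: s eval_nat_numeral del: scaleR_Pair)
  have zy: "\<bar>diff2 hz (0, 0, 1) (diff2 hy (0, 1, 0) (G 0 0 0)) p - G 0 2 2 p\<bar>
      \<le> B * hy^2 / 12 + B * hz^2 / 12"
    using *[where h = hy and k = hz and v = "(0, 1, 0)" and w = "(0, 0, 1)"
        and ?f1.0 = "G 0 0 (Suc 0)" and ?f2.0 = "G 0 0 (Suc (Suc 0))"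
        and a = "\<lambda>i. G 0 (Suc (Suc 0)) i" and b = "\<lambda>i. G 0 i (Suc (Suc 0))",
        OF h(2) h(3) Gz Gz Gz Gy _ _ bound bound]
    by (simp add: s eval_nat_numeral del: scaleR_Pair)
  have zz: "\<bar>diff2 hz (0, 0, 1) (diff2 hz (0, 0, 1) (G 0 0 0)) p - G 0 0 4 p\<bar>
      \<le> B * hz^2 / 12 + B * hz^2 / 12"
    using *[where h = hz and k = hz and v = "(0, 0, 1)" and w = "(0, 0, 1)"
        and ?f1.0 = "G 0 0 (Suc 0)" and ?f2.0 = "G 0 0 (Suc (Suc 0))"
        and a = "\<lambda>i. G 0 0 (Suc (Suc i))" and b = "\<lambda>i. G 0 0 (Suc (Suc i))",
        OF h(3) h(3) Gz Gz Gz Gz _ _ bound bound]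
    by (simp add: s eval_nat_numeral del: scaleR_Pair)
  have "diff2 k w (lap_h hx hy hz f) p = diff2 k w (diff2 hx (1, 0, 0) f) p
      + diff2 k w (diff2 hy (0, 1, 0) f) p + diff2 k w (diff2 hz (0, 0, 1) f) p" for k w f
    unfolding lap_h_def diff2_add ..
  then have "lap_h hx hy hz (lap_h hx hy hz (G 0 0 0)) p =
      diff2 hx (1, 0, 0) (diff2 hx (1, 0, 0) (G 0 0 0)) p + diff2 hx (1, 0, 0) (diff2 hy (0, 1, 0) (G 0 0 0)) p
      + diff2 hx (1, 0, 0) (diff2 hz (0, 0, 1) (G 0 0 0)) p
      + diff2 hy (0, 1, 0) (diff2 hx (1, 0, 0) (G 0 0 0)) p + diff2 hy (0, 1, 0) (diff2 hy (0, 1, 0) (G 0 0 0)) p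
      + diff2 hy (0, 1, 0) (diff2 hz (0, 0, 1) (G 0 0 0)) p
      + diff2 hz (0, 0, 1) (diff2 hx (1, 0, 0) (G 0 0 0)) p + diff2 hz (0, 0, 1) (diff2 hy (0, 1, 0) (G 0 0 0)) p
      + diff2 hz (0, 0, 1) (diff2 hz (0, 0, 1) (G 0 0 0)) p"
    unfolding lap_h_def[of _ _ _ "lap_h hx hy hz (G 0 0 0)"] by simp
  moreover have "B * (hx^2 + hy^2 + hz^2) / 2 = 6 * (B * hx^2 / 12) + 6 * (B * hy^2 / 12) + 6 * (B * hz^2 / 12)"
    by (simp add: algebra_simps)
  ultimately show ?thesis
    using xx xy xz yx yy yz zx zy zz by (simp only: abs_le_iff) linarith
qed

end

end

section \<open>Directional derivatives on closed boxes\<close>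

text \<open>
  Every point is the vertex of a small axis-parallel cube inside the set: this makes derivatives within the
  set unique and leaves room for the parallelograms behind the symmetry of mixed derivatives.
\<close>

definition corner_set :: "'a::euclidean_space set \<Rightarrow> bool" where
  "corner_set S \<longleftrightarrow> (\<forall>p\<in>S. \<exists>s r. r > 0 \<and> (\<forall>b\<in>Basis. s b = (1::real) \<or> s b = - 1) \<and>
     (\<forall>x. (\<forall>b\<in>Basis. 0 \<le> s b * ((x - p) \<bullet> b) \<and> s b * ((x - p) \<bullet> b) \<le> r) \<longrightarrow> x \<in> S))"

lemma corner_setE:
  assumes "corner_set S" "p \<in> S"
  obtains s r where "r > 0" "\<And>b. b \<in> Basis \<Longrightarrow> s b = (1::real) \<or> s b = - 1"
    "\<And>x. (\<And>b. b \<in> Basis \<Longrightarrow> 0 \<le> s b * ((x - p) \<bullet> b) \<and> s b * ((x - p) \<bullet> b) \<le> r) \<Longrightarrow> x \<in> S"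
proof -
  have "\<exists>s r. r > 0 \<and> (\<forall>b\<in>Basis. s b = (1::real) \<or> s b = - 1) \<and>
     (\<forall>x. (\<forall>b\<in>Basis. 0 \<le> s b * ((x - p) \<bullet> b) \<and> s b * ((x - p) \<bullet> b) \<le> r) \<longrightarrow> x \<in> S)"
    using assms(1) unfolding corner_set_def by (rule bspec) (rule assms(2))
  then obtain s r where "r > 0" "\<forall>b\<in>Basis. s b = (1::real) \<or> s b = - 1"
    "\<forall>x. (\<forall>b\<in>Basis. 0 \<le> s b * ((x - p) \<bullet> b) \<and> s b * ((x - p) \<bullet> b) \<le> r) \<longrightarrow> x \<in> S"
    by (elim exE conjE) simp
  then show ?thesis by (intro that[of r s]) auto
qed

text \<open>Directional derivatives are set to zero off the domain so that identities between them hold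
  as equations of functions.\<close>

definition ddir :: "'a::euclidean_space set \<Rightarrow> 'a \<Rightarrow> ('a \<Rightarrow> real) \<Rightarrow> 'a \<Rightarrow> real" where
  "ddir S v f p = (if p \<in> S then frechet_derivative f (at p within S) v else 0)"

lemma corner_set_line:
  assumes "corner_set S" "p \<in> S" "b \<in> Basis"
  obtains s r where "r > 0" "s = 1 \<or> s = (- 1::real)" "\<And>t. 0 \<le> t \<Longrightarrow> t \<le> r \<Longrightarrow> p + t *\<^sub>R (s *\<^sub>R b) \<in> S"
proof -
  from corner_setE[OF assms(1,2)] obtain s r where r: "r > 0"
    and s: "\<And>b. b \<in> Basis \<Longrightarrow> s b = (1::real) \<or> s b = - 1"
    and S: "\<And>x. (\<And>b. b \<in> Basis \<Longrightarrow> 0 \<le> s b * ((x - p) \<bullet> b) \<and> s b * ((x - p) \<bullet> b) \<le> r) \<Longrightarrow> x \<in> S"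
    by metis
  have "p + t *\<^sub>R (s b *\<^sub>R b) \<in> S" if "0 \<le> t" "t \<le> r" for t
    using that s[OF assms(3)] assms(3) r by (intro S) (auto simp: inner_Basis)
  with r s[OF assms(3)] show ?thesis by (intro that)
qed

text \<open>A segment from \<open>p\<close> inside \<open>S\<close> along each basis direction
  determines the derivative within \<open>S\<close>, also at boundary points.\<close>

lemma ddir_eqI:
  assumes S: "corner_set S" and p: "p \<in> S" and f: "(f has_derivative f') (at p within S)"
  shows "ddir S v f p = f' v"
proof -
  have "(f has_derivative frechet_derivative f (at p within S)) (at p within S)"
    using f frechet_derivative_works differentiable_def by blast
  then have "frechet_derivative f (at p within S) = f'"
  proof (rule frechet_derivative_unique_within[OF _ f])
    fix i :: 'a and e :: real assume i: "i \<in> Basis" and e: "e > 0"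
    obtain s r where "r > 0" "s = 1 \<or> s = (- 1::real)"
      and *: "\<And>t. 0 \<le> t \<Longrightarrow> t \<le> r \<Longrightarrow> p + t *\<^sub>R (s *\<^sub>R i) \<in> S"
      using corner_set_line[OF S p i] by blast
    then have "0 < \<bar>min r (e / 2) * s\<bar>" "\<bar>min r (e / 2) * s\<bar> < e" using e by auto
    then show "\<exists>d. 0 < \<bar>d\<bar> \<and> \<bar>d\<bar> < e \<and> p + d *\<^sub>R i \<in> S"
      using *[of "min r (e / 2)"] \<open>r > 0\<close> e by (intro exI[of _ "min r (e / 2) * s"]) auto
  qed
  then show ?thesis using p by (simp add: ddir_def)
qed

lemma ddir_has_derivative:
  assumes "f differentiable_on S" "p \<in> S"
  shows "(f has_derivative (\<lambda>v. ddir S v f p)) (at p within S)"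
  using assms frechet_derivative_works[of f "at p within S"]
  unfolding differentiable_on_def by (auto simp: ddir_def)

lemma has_derivative_cong_on:
  assumes "\<And>x. x \<in> S \<Longrightarrow> f x = g x" "p \<in> S"
  shows "(f has_derivative f') (at p within S) \<longleftrightarrow> (g has_derivative f') (at p within S)"
proof
  assume "(f has_derivative f') (at p within S)"
  then show "(g has_derivative f') (at p within S)"
    by (rule has_derivative_transform[OF assms(2), rotated]) (simp add: assms(1))
next
  assume "(g has_derivative f') (at p within S)"
  then show "(f has_derivative f') (at p within S)"
    by (rule has_derivative_transform[OF assms(2), rotated]) (simp add: assms(1))
qed

lemma frechet_derivative_cong_on:
  assumes "\<And>x. x \<in> S \<Longrightarrow> f x = g x" "p \<in> S"
  shows "frechet_derivative f (at p within S) = frechet_derivative g (at p within S)"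
  using has_derivative_cong_on[of S f g, OF assms] by (simp add: frechet_derivative_def)

lemma ddir_cong:
  assumes "\<And>x. x \<in> S \<Longrightarrow> f x = g x"
  shows "ddir S v f = ddir S v g"
  using frechet_derivative_cong_on[of S f g, OF assms] by (intro ext) (simp add: ddir_def)

lemma Ck_on_cong:
  assumes "\<And>x. x \<in> S \<Longrightarrow> f x = g x"
  shows "Ck_on k f S \<longleftrightarrow> Ck_on k g S"
  using assms
proof (induction k arbitrary: f g)
  case 0 show ?case using continuous_on_cong[OF refl 0] by simp
next
  case (Suc k)
  have "f differentiable_on S \<longleftrightarrow> g differentiable_on S"
    using has_derivative_cong_on[of S f g, OF Suc.prems] by (simp add: differentiable_on_def differentiable_def)
  moreover have "Ck_on k (\<lambda>x. frechet_derivative f (at x within S) v) S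
      \<longleftrightarrow> Ck_on k (\<lambda>x. frechet_derivative g (at x within S) v) S" for v
    by (rule Suc.IH) (simp add: frechet_derivative_cong_on[of S f g, OF Suc.prems])
  ultimately show ?case by simp
qed

lemma Ck_on_ddir:
  assumes "Ck_on (Suc k) f S"
  shows "Ck_on k (ddir S v f) S"
  using assms Ck_on_cong[of S "ddir S v f" "\<lambda>x. frechet_derivative f (at x within S) v" k]
  by (simp add: ddir_def)

lemma Ck_on_SucD: "Ck_on (Suc k) f S \<Longrightarrow> Ck_on k f S"
proof (induction k arbitrary: f)
  case 0 then show ?case by (simp add: differentiable_imp_continuous_on)
next
  case (Suc k)
  show ?case
    unfolding Ck_on.simps(2)[of k]
    using Suc.prems[unfolded Ck_on.simps(2)[of "Suc k"]] Suc.IH by blast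
qed

lemma Ck_on_le: "Ck_on k f S \<Longrightarrow> j \<le> k \<Longrightarrow> Ck_on j f S"
  by (induction k) (auto simp: le_Suc_eq simp del: Ck_on.simps dest: Ck_on_SucD)

lemma Ck_on_differentiable: "Ck_on k f S \<Longrightarrow> k > 0 \<Longrightarrow> f differentiable_on S"
  by (cases k) auto

lemma Ck_on_continuous: "Ck_on k f S \<Longrightarrow> continuous_on S f"
  using Ck_on_le[of k f S 0] by simp

declare Ck_on.simps(2) [simp del]

lemma Ck_on_ddir_pow: "Ck_on (a + k) f S \<Longrightarrow> Ck_on k ((ddir S v ^^ a) f) S"
proof (induction a arbitrary: k)
  case (Suc a)
  then have "Ck_on (Suc k) ((ddir S v ^^ a) f) S" by (metis add_Suc_shift)
  then show ?case using Ck_on_ddir by simp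
qed simp

lemma ddir_line:
  assumes f: "f differentiable_on S" and A: "\<And>t. t \<in> A \<Longrightarrow> p + t *\<^sub>R v \<in> S" and t: "t \<in> A"
  shows "((\<lambda>t. f (p + t *\<^sub>R v)) has_real_derivative ddir S v f (p + t *\<^sub>R v)) (at t within A)"
proof -
  define q where "q = p + t *\<^sub>R v"
  have d: "(f has_derivative (\<lambda>v. ddir S v f q)) (at q within S)"
    using ddir_has_derivative[OF f] A[OF t] by (simp add: q_def)
  have "((\<lambda>t. p + t *\<^sub>R v) has_derivative (\<lambda>s. s *\<^sub>R v)) (at t within A)"
    by (auto intro!: derivative_eq_intros)
  moreover have "(f has_derivative (\<lambda>v. ddir S v f q)) (at (p + t *\<^sub>R v) within (\<lambda>t. p + t *\<^sub>R v) ` A)"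
    using has_derivative_subset[OF d, of "(\<lambda>t. p + t *\<^sub>R v) ` A"] A unfolding q_def by blast
  ultimately have "((\<lambda>t. f (p + t *\<^sub>R v)) has_derivative (\<lambda>s. ddir S (s *\<^sub>R v) f q)) (at t within A)"
    by (rule has_derivative_in_compose)
  moreover have "ddir S (s *\<^sub>R v) f q = ddir S v f q * s" for s
    using linear_scale[OF has_derivative_linear[OF d]] by simp
  ultimately show ?thesis by (simp add: has_field_derivative_def q_def)
qed

lemma ddir_scaleR:
  assumes "f differentiable_on S"
  shows "ddir S (c *\<^sub>R v) f = (\<lambda>p. c * ddir S v f p)"
proof
  fix p
  show "ddir S (c *\<^sub>R v) f p = c * ddir S v f p"
  proof (cases "p \<in> S")
    case True
    show ?thesis using linear_scale[OF has_derivative_linear[OF ddir_has_derivative[OF assms True]]] by simp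
  qed (simp add: ddir_def)
qed

lemma ddir_cmult:
  assumes S: "corner_set S" and f: "f differentiable_on S"
  shows "ddir S v (\<lambda>p. c * f p) = (\<lambda>p. c * ddir S v f p)"
proof
  fix p
  show "ddir S v (\<lambda>p. c * f p) p = c * ddir S v f p"
  proof (cases "p \<in> S")
    case True
    show ?thesis using ddir_eqI[OF S True has_derivative_mult_right[OF ddir_has_derivative[OF f True]]] .
  qed (simp add: ddir_def)
qed

lemma ddir_add:
  assumes S: "corner_set S" and f: "f differentiable_on S" and g: "g differentiable_on S"
  shows "ddir S v (\<lambda>p. f p + g p) = (\<lambda>p. ddir S v f p + ddir S v g p)"
proof
  fix p
  show "ddir S v (\<lambda>p. f p + g p) p = ddir S v f p + ddir S v g p"
  proof (cases "p \<in> S")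
    case True
    show ?thesis
      using ddir_eqI[OF S True has_derivative_add[OF ddir_has_derivative[OF f True] ddir_has_derivative[OF g True]]] .
  qed (simp add: ddir_def)
qed

lemma mvt_within:
  fixes f :: "real \<Rightarrow> real"
  assumes "a < b" "\<And>x. x \<in> {a..b} \<Longrightarrow> (f has_real_derivative f' x) (at x within {a..b})"
  shows "\<exists>x>a. x < b \<and> f b - f a = (b - a) * f' x"
  using mvt_simple[of a b f "\<lambda>x. (*) (f' x)"] assms by (auto simp: has_field_derivative_def mult.commute)

text \<open>The mean value theorem along \<open>v\<close> and then along \<open>w\<close> turns the
  second-order difference over a parallelogram into one value of the mixed derivative.\<close>

lemma ddir_double_difference:
  fixes v w :: "'a::euclidean_space"
  assumes f: "f differentiable_on S" "ddir S v f differentiable_on S" and h: "h > 0"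
    and par: "\<And>s t. 0 \<le> s \<Longrightarrow> s \<le> h \<Longrightarrow> 0 \<le> t \<Longrightarrow> t \<le> h \<Longrightarrow> p + s *\<^sub>R v + t *\<^sub>R w \<in> S"
  obtains s t where "0 \<le> s" "s \<le> h" "0 \<le> t" "t \<le> h"
    "f (p + h *\<^sub>R v + h *\<^sub>R w) - f (p + h *\<^sub>R v) - f (p + h *\<^sub>R w) + f p
      = h * h * ddir S w (ddir S v f) (p + s *\<^sub>R v + t *\<^sub>R w)"
proof -
  define \<phi> where "\<phi> s = f ((p + h *\<^sub>R w) + s *\<^sub>R v) - f (p + s *\<^sub>R v)" for s
  have "(\<phi> has_real_derivative
      ddir S v f ((p + h *\<^sub>R w) + s *\<^sub>R v) - ddir S v f (p + s *\<^sub>R v)) (at s within {0..h})"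
    if "s \<in> {0..h}" for s
    unfolding \<phi>_def using that par[of _ h] par[of _ 0] h
    by (intro DERIV_diff ddir_line f) (auto simp: algebra_simps)
  then have "\<exists>s>0. s < h \<and> \<phi> h - \<phi> 0
      = (h - 0) * (ddir S v f ((p + h *\<^sub>R w) + s *\<^sub>R v) - ddir S v f (p + s *\<^sub>R v))"
    by (rule mvt_within[OF h])
  then obtain s where s: "0 < s" "s < h"
    "\<phi> h - \<phi> 0 = h * (ddir S v f ((p + h *\<^sub>R w) + s *\<^sub>R v) - ddir S v f (p + s *\<^sub>R v))"
    by auto
  define \<psi> where "\<psi> t = ddir S v f ((p + s *\<^sub>R v) + t *\<^sub>R w)" for t
  have "(\<psi> has_real_derivative ddir S w (ddir S v f) ((p + s *\<^sub>R v) + t *\<^sub>R w)) (at t within {0..h})"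
    if "t \<in> {0..h}" for t
    unfolding \<psi>_def using that par[of s] s by (intro ddir_line f) auto
  from mvt_within[OF h this] obtain t where t: "0 < t" "t < h"
    "\<psi> h - \<psi> 0 = h * ddir S w (ddir S v f) ((p + s *\<^sub>R v) + t *\<^sub>R w)"
    by auto
  have "f (p + h *\<^sub>R v + h *\<^sub>R w) - f (p + h *\<^sub>R v) - f (p + h *\<^sub>R w) + f p = \<phi> h - \<phi> 0"
    by (simp add: \<phi>_def algebra_simps)
  also have "\<dots> = h * (\<psi> h - \<psi> 0)" using s(3) by (simp add: \<psi>_def algebra_simps)
  finally show ?thesis using that[of s t] s(1,2) t by (simp add: algebra_simps)
qed

text \<open>Both orders of differentiation are limits of the same difference over a shrinking
  parallelogram. It is placed in the cube provided by \<open>corner_set\<close>, so its sides are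
  basis vectors with signs.\<close>

lemma ddir_commute_basis:
  fixes b c :: "'a::euclidean_space"
  assumes S: "corner_set S" and f: "Ck_on 2 f S" and bc: "b \<in> Basis" "c \<in> Basis" "b \<noteq> c" and p: "p \<in> S"
  shows "ddir S c (ddir S b f) p = ddir S b (ddir S c f) p"
proof -
  have f0: "f differentiable_on S" using f by (simp add: Ck_on_differentiable)
  have Ck1: "Ck_on 1 (ddir S v f) S" for v
    using f Ck_on_ddir[of 1 f S v] by (simp only: Suc_1)
  then have f1: "ddir S v f differentiable_on S" for v
    using Ck_on_differentiable[OF Ck1] by simp
  have f2: "continuous_on S (ddir S w (ddir S v f))" for v w
    using Ck_on_ddir[of 0 "ddir S v f"] Ck1 by simp
  from corner_setE[OF S p] obtain s r where r: "r > 0"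
    and s: "\<And>b. b \<in> Basis \<Longrightarrow> s b = (1::real) \<or> s b = - 1"
    and mem: "\<And>x. (\<And>b. b \<in> Basis \<Longrightarrow> 0 \<le> s b * ((x - p) \<bullet> b) \<and> s b * ((x - p) \<bullet> b) \<le> r) \<Longrightarrow> x \<in> S"
    by metis
  define v where "v = s b *\<^sub>R b"
  define w where "w = s c *\<^sub>R c"
  have nv: "norm v = 1" "norm w = 1" using s[OF bc(1)] s[OF bc(2)] bc by (auto simp: v_def w_def)
  have par: "p + x *\<^sub>R v + y *\<^sub>R w \<in> S" if "0 \<le> x" "x \<le> r" "0 \<le> y" "y \<le> r" for x y
  proof (rule mem)
    fix i :: 'a assume i: "i \<in> Basis"
    have "(p + x *\<^sub>R v + y *\<^sub>R w - p) \<bullet> i = (if i = b then x * s b else if i = c then y * s c else 0)"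
      using bc i by (auto simp: v_def w_def inner_add_left inner_diff_left inner_Basis)
    then show "0 \<le> s i * ((p + x *\<^sub>R v + y *\<^sub>R w - p) \<bullet> i) \<and> s i * ((p + x *\<^sub>R v + y *\<^sub>R w - p) \<bullet> i) \<le> r"
      using that s[OF bc(1)] s[OF bc(2)] r by auto
  qed
  have "\<bar>ddir S w (ddir S v f) p - ddir S v (ddir S w f) p\<bar> < 2 * e" if e: "e > 0" for e
  proof -
    obtain d1 where d1: "d1 > 0" "\<And>q. q \<in> S \<Longrightarrow> dist q p < d1 \<Longrightarrow>
        \<bar>ddir S w (ddir S v f) q - ddir S w (ddir S v f) p\<bar> < e"
      using f2[of w v] p e unfolding continuous_on_iff dist_real_def by meson
    obtain d2 where d2: "d2 > 0" "\<And>q. q \<in> S \<Longrightarrow> dist q p < d2 \<Longrightarrow>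
        \<bar>ddir S v (ddir S w f) q - ddir S v (ddir S w f) p\<bar> < e"
      using f2[of v w] p e unfolding continuous_on_iff dist_real_def by meson
    \<comment> \<open>Points of the parallelogram have distance at most \<open>2 * h\<close> from
      \<open>p\<close>; the thirds keep this strictly below \<open>d1\<close> and
      \<open>d2\<close>.\<close>
    define h where "h = Min {r, d1 / 3, d2 / 3}"
    have h: "h > 0" "h \<le> r" "2 * h < d1" "2 * h < d2" using r d1 d2 by (auto simp: h_def min_def)
    have near: "dist (p + x *\<^sub>R v + y *\<^sub>R w) p \<le> 2 * h" if "0 \<le> x" "x \<le> h" "0 \<le> y" "y \<le> h" for x y
    proof -
      have "norm (x *\<^sub>R v + y *\<^sub>R w) \<le> norm (x *\<^sub>R v) + norm (y *\<^sub>R w)" by (rule norm_triangle_ineq)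
      then show ?thesis using that nv by (simp add: dist_norm add.assoc)
    qed
    obtain x1 y1 where 1: "0 \<le> x1" "x1 \<le> h" "0 \<le> y1" "y1 \<le> h"
      "f (p + h *\<^sub>R v + h *\<^sub>R w) - f (p + h *\<^sub>R v) - f (p + h *\<^sub>R w) + f p
      = h * h * ddir S w (ddir S v f) (p + x1 *\<^sub>R v + y1 *\<^sub>R w)"
      by (rule ddir_double_difference[OF f0 f1 h(1), of p v w]) (use par h in auto)
    obtain y2 x2 where 2: "0 \<le> y2" "y2 \<le> h" "0 \<le> x2" "x2 \<le> h"
      "f (p + h *\<^sub>R w + h *\<^sub>R v) - f (p + h *\<^sub>R w) - f (p + h *\<^sub>R v) + f p
      = h * h * ddir S v (ddir S w f) (p + y2 *\<^sub>R w + x2 *\<^sub>R v)"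
    proof (rule ddir_double_difference[OF f0 f1 h(1), of p w v])
      show "p + y *\<^sub>R w + x *\<^sub>R v \<in> S" if "0 \<le> y" "y \<le> h" "0 \<le> x" "x \<le> h" for x y
        using par[of x y] that h by (simp add: add_ac)
    qed
    have sw: "p + y *\<^sub>R w + x *\<^sub>R v = p + x *\<^sub>R v + y *\<^sub>R w" for x y by simp
    have "h * h * ddir S w (ddir S v f) (p + x1 *\<^sub>R v + y1 *\<^sub>R w)
        = h * h * ddir S v (ddir S w f) (p + x2 *\<^sub>R v + y2 *\<^sub>R w)"
      using 1(5) 2(5) unfolding sw by linarith
    then have "ddir S w (ddir S v f) (p + x1 *\<^sub>R v + y1 *\<^sub>R w)
        = ddir S v (ddir S w f) (p + x2 *\<^sub>R v + y2 *\<^sub>R w)"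
      using h by simp
    moreover have "\<bar>ddir S w (ddir S v f) (p + x1 *\<^sub>R v + y1 *\<^sub>R w) - ddir S w (ddir S v f) p\<bar> < e"
      using 1 h near[of x1 y1] by (intro d1 par) auto
    moreover have "\<bar>ddir S v (ddir S w f) (p + x2 *\<^sub>R v + y2 *\<^sub>R w) - ddir S v (ddir S w f) p\<bar> < e"
      using 2 h near[of x2 y2] by (intro d2 par) auto
    ultimately show ?thesis by linarith
  qed
  from this[of "\<bar>ddir S w (ddir S v f) p - ddir S v (ddir S w f) p\<bar> / 2"]
  have "ddir S w (ddir S v f) p = ddir S v (ddir S w f) p" by force
  \<comment> \<open>The signs in \<open>v\<close> and \<open>w\<close> enter both mixed derivatives
    as the same nonzero factor.\<close>
  then show ?thesis
    using s[OF bc(1)] s[OF bc(2)]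
    by (auto simp: v_def w_def ddir_scaleR[OF f0] ddir_scaleR[OF f1] ddir_cmult[OF S f1])
qed

lemma ddir_commute:
  assumes "corner_set S" "Ck_on 2 f S" "b \<in> Basis" "c \<in> Basis"
  shows "ddir S c (ddir S b f) = ddir S b (ddir S c f)"
proof
  fix p
  show "ddir S c (ddir S b f) p = ddir S b (ddir S c f) p"
  proof (cases "b = c \<or> p \<notin> S")
    case True
    then show ?thesis by (auto simp: ddir_def)
  next
    case False
    then show ?thesis using assms by (intro ddir_commute_basis) auto
  qed
qed

lemma ddir_pow_commute1:
  assumes S: "corner_set S" and bc: "b \<in> Basis" "c \<in> Basis"
  shows "Ck_on (Suc a) f S \<Longrightarrow> ddir S c ((ddir S b ^^ a) f) = (ddir S b ^^ a) (ddir S c f)"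
proof (induction a)
  case (Suc a)
  have "Ck_on 2 ((ddir S b ^^ a) f) S"
    using Suc.prems by (intro Ck_on_ddir_pow[of a 2]) (simp only: add_2_eq_Suc')
  moreover have "Ck_on (Suc a) f S" using Suc.prems by (rule Ck_on_SucD)
  ultimately show ?case using ddir_commute[OF S _ bc] Suc.IH by simp
qed simp

text \<open>A segment from \<open>p\<close> in direction \<open>b\<close> or \<open>- b\<close>
  stays in the hyperplane, where \<open>f\<close> is constantly zero; its one-sided derivative
  already determines the directional derivative.\<close>

lemma ddir_tangential_zero:
  assumes S: "corner_set S" and b: "b \<in> Basis" and e: "b \<bullet> e = 0" and f: "f differentiable_on S"
    and zero: "\<And>q. q \<in> S \<Longrightarrow> q \<bullet> e = c \<Longrightarrow> f q = 0" and p: "p \<in> S" "p \<bullet> e = c"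
  shows "ddir S b f p = 0"
proof -
  obtain s r where r: "r > 0" and s: "s = 1 \<or> s = (- 1::real)"
    and mem: "\<And>t. 0 \<le> t \<Longrightarrow> t \<le> r \<Longrightarrow> p + t *\<^sub>R (s *\<^sub>R b) \<in> S"
    using corner_set_line[OF S p(1) b] by blast
  have "((\<lambda>t. f (p + t *\<^sub>R (s *\<^sub>R b))) has_real_derivative ddir S (s *\<^sub>R b) f (p + 0 *\<^sub>R (s *\<^sub>R b))) (at 0 within {0..r})"
    using mem r by (intro ddir_line f) auto
  moreover have "f (p + t *\<^sub>R (s *\<^sub>R b)) = 0" if "t \<in> {0..r}" for t
    using mem[of t] that p(2) e by (intro zero) (auto simp: inner_add_left)
  ultimately have "((\<lambda>t. 0) has_real_derivative ddir S (s *\<^sub>R b) f p) (at 0 within {0..r})"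
    using r by (intro has_field_derivative_transform_within[where d = 1 and g = "\<lambda>t. 0"
          and f = "\<lambda>t. f (p + t *\<^sub>R (s *\<^sub>R b))"]) auto
  moreover have "((\<lambda>t. 0) has_real_derivative 0) (at 0 within {0..r})" by simp
  ultimately have "ddir S (s *\<^sub>R b) f p = 0"
    using r by (intro has_field_derivative_unique) (auto simp: at_within_Icc_at_right)
  then show ?thesis using s unfolding ddir_scaleR[OF f] by auto
qed

lemma corner_set_Times:
  fixes A :: "'a::euclidean_space set" and B :: "'b::euclidean_space set"
  assumes A: "corner_set A" and B: "corner_set B"
  shows "corner_set (A \<times> B)"
  unfolding corner_set_def
proof
  fix p assume "p \<in> A \<times> B"
  then have p: "fst p \<in> A" "snd p \<in> B" by auto
  from corner_setE[OF A p(1)] obtain s1 r1 where 1: "r1 > 0" "\<And>b. b \<in> Basis \<Longrightarrow> s1 b = (1::real) \<or> s1 b = - 1"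
    "\<And>x. (\<And>b. b \<in> Basis \<Longrightarrow> 0 \<le> s1 b * ((x - fst p) \<bullet> b) \<and> s1 b * ((x - fst p) \<bullet> b) \<le> r1) \<Longrightarrow> x \<in> A"
    by metis
  from corner_setE[OF B p(2)] obtain s2 r2 where 2: "r2 > 0" "\<And>b. b \<in> Basis \<Longrightarrow> s2 b = (1::real) \<or> s2 b = - 1"
    "\<And>x. (\<And>b. b \<in> Basis \<Longrightarrow> 0 \<le> s2 b * ((x - snd p) \<bullet> b) \<and> s2 b * ((x - snd p) \<bullet> b) \<le> r2) \<Longrightarrow> x \<in> B"
    by metis
  \<comment> \<open>A basis vector of the product has exactly one nonzero component, so
    \<open>snd c = 0\<close> tells which factor it comes from.\<close>
  define s where "s c = (if snd c = 0 then s1 (fst c) else s2 (snd c))" for c :: "'a \<times> 'b"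
  have s1: "s (b, 0) = s1 b" for b by (simp add: s_def)
  have s2: "s (0, b) = s2 b" if "b \<in> Basis" for b using that nonzero_Basis by (auto simp: s_def)
  have "\<forall>b\<in>Basis. s b = 1 \<or> s b = - 1"
  proof -
    have "\<forall>b\<in>Basis. s1 b = 1 \<or> s1 b = - 1" "\<forall>b\<in>Basis. s2 b = 1 \<or> s2 b = - 1"
      using 1(2) 2(2) by blast+
    then show ?thesis by (auto simp: Basis_prod_def s1 s2)
  qed
  moreover have "x \<in> A \<times> B"
    if x: "\<forall>b\<in>Basis. 0 \<le> s b * ((x - p) \<bullet> b) \<and> s b * ((x - p) \<bullet> b) \<le> min r1 r2" for x
  proof -
    have "fst x \<in> A"
    proof (rule 1(3))
      fix b :: 'a assume "b \<in> Basis"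
      then have "(b, 0::'b) \<in> Basis" by (auto simp: Basis_prod_def)
      from bspec[OF x this] show "0 \<le> s1 b * ((fst x - fst p) \<bullet> b) \<and> s1 b * ((fst x - fst p) \<bullet> b) \<le> r1"
        by (simp add: s1 inner_prod_def)
    qed
    moreover have "snd x \<in> B"
    proof (rule 2(3))
      fix b :: 'b assume b: "b \<in> Basis"
      then have "(0::'a, b) \<in> Basis" by (auto simp: Basis_prod_def)
      from bspec[OF x this] show "0 \<le> s2 b * ((snd x - snd p) \<bullet> b) \<and> s2 b * ((snd x - snd p) \<bullet> b) \<le> r2"
        by (simp add: s2 b inner_prod_def)
    qed
    ultimately show ?thesis by (cases x) simp
  qed
  ultimately show "\<exists>s r. r > 0 \<and> (\<forall>b\<in>Basis. s b = (1::real) \<or> s b = - 1) \<and>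
     (\<forall>x. (\<forall>b\<in>Basis. 0 \<le> s b * ((x - p) \<bullet> b) \<and> s b * ((x - p) \<bullet> b) \<le> r) \<longrightarrow> x \<in> A \<times> B)"
    using 1(1) 2(1) by (intro exI[of _ s] exI[of _ "min r1 r2"]) auto
qed

lemma corner_set_Icc:
  assumes "(0::real) < l"
  shows "corner_set {0..l}"
  unfolding corner_set_def
proof
  fix p assume p: "p \<in> {0..l}"
  show "\<exists>s r. r > 0 \<and> (\<forall>b\<in>Basis. s b = (1::real) \<or> s b = - 1) \<and>
     (\<forall>x. (\<forall>b\<in>Basis. 0 \<le> s b * ((x - p) \<bullet> b) \<and> s b * ((x - p) \<bullet> b) \<le> r) \<longrightarrow> x \<in> {0..l})"
  proof (cases "p < l")
    case True
    then show ?thesis using p by (intro exI[of _ "\<lambda>_. 1"] exI[of _ "l - p"]) auto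
  next
    case False
    then show ?thesis using p assms by (intro exI[of _ "\<lambda>_. - 1"] exI[of _ l]) auto
  qed
qed

lemma corner_set_atLeast: "corner_set {0::real..}"
  unfolding corner_set_def
proof
  fix p :: real assume p: "p \<in> {0..}"
  show "\<exists>s r. r > 0 \<and> (\<forall>b\<in>Basis. s b = (1::real) \<or> s b = - 1) \<and>
     (\<forall>x. (\<forall>b\<in>Basis. 0 \<le> s b * ((x - p) \<bullet> b) \<and> s b * ((x - p) \<bullet> b) \<le> r) \<longrightarrow> x \<in> {0..})"
    using p by (intro exI[of _ "\<lambda>_. 1"] exI[of _ 1]) auto
qed

section \<open>Even reflection and odd normal derivatives\<close>

definition fold_pos :: "real \<Rightarrow> real \<Rightarrow> real" where
  "fold_pos l x = (if x < 0 then - x else if x \<le> l then x else 2 * l - x)"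

text \<open>The slope of \<open>fold_pos\<close>, with the value 1 at the kinks \<open>0\<close> and
  \<open>l\<close>; its odd powers will multiply quantities that vanish there.\<close>

definition fold_sgn :: "real \<Rightarrow> real \<Rightarrow> real" where
  "fold_sgn l x = (if 0 \<le> x \<and> x \<le> l then 1 else - 1)"

lemma fold_pos_mem: "- l < x \<Longrightarrow> x < 2 * l \<Longrightarrow> fold_pos l x \<in> {0..l}"
  by (auto simp: fold_pos_def)

text \<open>Makes the derivative within a closed piece vacuous at points outside it, so that the
  three pieces of the reflection are glued at every point by one argument.\<close>

lemma has_field_derivative_within_bot:
  fixes f :: "real \<Rightarrow> real"
  assumes "closed P" "x \<notin> P"
  shows "(f has_real_derivative D) (at x within P)"
proof -
  have "at x within P = bot"
    using assms by (auto simp: closed_limpt trivial_limit_within)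
  then show ?thesis by (simp add: has_field_derivative_iff)
qed

text \<open>For odd \<open>a\<close> the reflected function changes sign across an end, so
  \<open>f\<close> must vanish there for continuity; for even \<open>a\<close> the same applies to
  the derivative. Under these conditions the derivatives on \<open>{- l..0}\<close>,
  \<open>{0..l}\<close> and \<open>{l..2 * l}\<close> fit together.\<close>

lemma reflect_has_derivative:
  fixes f f' :: "real \<Rightarrow> real"
  assumes l: "l > 0" and x: "- l < x" "x < 2 * l"
    and f: "\<And>x. x \<in> {0..l} \<Longrightarrow> (f has_real_derivative f' x) (at x within {0..l})"
    and even: "even a \<Longrightarrow> f' 0 = 0 \<and> f' l = 0" and odd: "odd a \<Longrightarrow> f 0 = 0 \<and> f l = 0"
  shows "((\<lambda>x. fold_sgn l x ^ a * f (fold_pos l x)) has_real_derivative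
      fold_sgn l x ^ Suc a * f' (fold_pos l x)) (at x)"
proof -
  define F where "F x = fold_sgn l x ^ a * f (fold_pos l x)" for x
  define F' where "F' x = fold_sgn l x ^ Suc a * f' (fold_pos l x)" for x
  have pm: "(- 1::real) ^ a = (if even a then 1 else - 1)" by simp
  have left: "(F has_real_derivative F' x) (at x within {- l..0})" if x: "x \<in> {- l..0}" for x
  proof -
    have "((\<lambda>x. - x) has_real_derivative - 1) (at x within {- l..0})"
      by (auto intro!: derivative_eq_intros)
    moreover have "(f has_real_derivative f' (- x)) (at (- x) within uminus ` {- l..0})"
      using f[of "- x"] x l by (intro DERIV_subset[OF f]) auto
    ultimately have "((\<lambda>x. f (- x)) has_real_derivative f' (- x) * - 1) (at x within {- l..0})"
      using DERIV_image_chain[of f "f' (- x)" uminus x "{- l..0}" "- 1"] by (simp add: o_def)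
    from DERIV_cmult[OF this, of "(- 1) ^ a"]
    have "((\<lambda>x. (- 1) ^ a * f (- x)) has_real_derivative (- 1) ^ Suc a * f' (- x)) (at x within {- l..0})"
      by simp
    moreover have "F y = (- 1) ^ a * f (- y)" if "y \<in> {- l..0}" for y
      using that odd by (auto simp: F_def fold_sgn_def fold_pos_def pm)
    moreover have "F' x = (- 1) ^ Suc a * f' (- x)"
      using x even by (auto simp: F'_def fold_sgn_def fold_pos_def pm)
    ultimately show ?thesis
      using x by (intro has_field_derivative_transform_within[where d = 1 and g = F
            and f = "\<lambda>x. (- 1) ^ a * f (- x)"]) (auto simp del: power_Suc)
  qed
  have mid: "(F has_real_derivative F' x) (at x within {0..l})" if x: "x \<in> {0..l}" for x
    using f[OF x] x
    by (intro has_field_derivative_transform_within[where d = 1 and f = f and g = F])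
       (auto simp: F_def F'_def fold_sgn_def fold_pos_def)
  have right: "(F has_real_derivative F' x) (at x within {l..2 * l})" if x: "x \<in> {l..2 * l}" for x
  proof -
    have "((\<lambda>x. 2 * l - x) has_real_derivative - 1) (at x within {l..2 * l})"
      by (auto intro!: derivative_eq_intros)
    moreover have "(f has_real_derivative f' (2 * l - x)) (at (2 * l - x) within (\<lambda>x. 2 * l - x) ` {l..2 * l})"
      using x l by (intro DERIV_subset[OF f]) auto
    ultimately have "((\<lambda>x. f (2 * l - x)) has_real_derivative f' (2 * l - x) * - 1) (at x within {l..2 * l})"
      using DERIV_image_chain[of f "f' (2 * l - x)" "\<lambda>x. 2 * l - x" x "{l..2 * l}" "- 1"] by (simp add: o_def)
    from DERIV_cmult[OF this, of "(- 1) ^ a"]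
    have "((\<lambda>x. (- 1) ^ a * f (2 * l - x)) has_real_derivative (- 1) ^ Suc a * f' (2 * l - x)) (at x within {l..2 * l})"
      by simp
    moreover have "F y = (- 1) ^ a * f (2 * l - y)" if "y \<in> {l..2 * l}" for y
      using that odd l by (cases "y = l") (auto simp: F_def fold_sgn_def fold_pos_def pm)
    moreover have "F' x = (- 1) ^ Suc a * f' (2 * l - x)"
      using x even l by (cases "x = l") (auto simp: F'_def fold_sgn_def fold_pos_def pm)
    ultimately show ?thesis
      using x by (intro has_field_derivative_transform_within[where d = 1 and g = F
            and f = "\<lambda>x. (- 1) ^ a * f (2 * l - x)"]) (auto simp del: power_Suc)
  qed
  have un: "(F has_real_derivative D) (at x within A \<union> B)"
    if "(F has_real_derivative D) (at x within A)" "(F has_real_derivative D) (at x within B)" for A B D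
    using that filterlim_sup[of "\<lambda>y. (F y - F x) / (y - x)" "nhds D" "at x within A" "at x within B"]
    unfolding has_field_derivative_iff[of _ _ _ A] has_field_derivative_iff[of _ _ _ B]
      has_field_derivative_iff[of _ _ _ "A \<union> B"] by (simp add: at_within_union)
  have "(F has_real_derivative F' x) (at x within {- l..0} \<union> {0..l} \<union> {l..2 * l})"
    using left[of x] mid[of x] right[of x] has_field_derivative_within_bot[OF closed_atLeastAtMost]
    by (intro un) blast+
  moreover have "{- l..0} \<union> {0..l} \<union> {l..2 * l} = {- l..2 * l}" using l by auto
  moreover have "at x within {- l..2 * l} = at x" using x by (intro at_within_interior) auto
  ultimately show ?thesis by (simp add: F_def[abs_def] F'_def)
qed

text \<open>At a face with normal \<open>e\<close> the fifth normal derivative vanishes because the equation itself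
  can be differentiated in the normal direction.\<close>

lemma odd_normal_derivatives_zero:
  fixes m :: "nat \<Rightarrow> nat \<Rightarrow> nat \<Rightarrow> 'a::euclidean_space \<Rightarrow> real"
  assumes S: "corner_set S"
    and basis: "v \<in> Basis" "w \<in> Basis" "\<tau> \<in> Basis"
      "v \<bullet> e = 0" "w \<bullet> e = 0" "\<tau> \<bullet> e = 0"
    and m: "\<And>a b c. a + b + c \<le> 5 \<Longrightarrow> ddir S e (m a b c) = m (Suc a) b c"
      "\<And>a b c. a + b + c \<le> 5 \<Longrightarrow> ddir S v (m a b c) = m a (Suc b) c"
      "\<And>a b c. a + b + c \<le> 5 \<Longrightarrow> ddir S w (m a b c) = m a b (Suc c)"
      "\<And>a b c. a + b + c \<le> 5 \<Longrightarrow> m a b c differentiable_on S"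
    and mt: "ddir S \<tau> (m 0 0 0) differentiable_on S"
      "ddir S e (ddir S \<tau> (m 0 0 0)) = ddir S \<tau> (m 1 0 0)"
    and eps: "\<epsilon> > 0"
    and pde: "\<And>q. q \<in> S \<Longrightarrow> ddir S \<tau> (m 0 0 0) q + (m 0 0 0 q)^3 + k * m 0 0 0 q
      + \<epsilon> * (m 4 0 0 q + m 0 4 0 q + m 0 0 4 q + 2 * m 2 2 0 q + 2 * m 2 0 2 q + 2 * m 0 2 2 q)
      + 2 * (m 2 0 0 q + m 0 2 0 q + m 0 0 2 q) = 0"
    and bc1: "\<And>q. q \<in> S \<Longrightarrow> q \<bullet> e = d \<Longrightarrow> m 1 0 0 q = 0"
    and bc3: "\<And>q. q \<in> S \<Longrightarrow> q \<bullet> e = d \<Longrightarrow> m 3 0 0 q + m 1 2 0 q + m 1 0 2 q = 0"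
    and a: "odd a" "a + b + c \<le> 6" and q: "q \<in> S" "q \<bullet> e = d"
  shows "m a b c q = 0"
proof -
  \<comment> \<open>Once the pure normal derivative of order \<open>a\<close> vanishes on the whole
    face, so do its tangential derivatives, by differentiating within the face.\<close>
  have tang: "\<forall>q. q \<in> S \<longrightarrow> q \<bullet> e = d \<longrightarrow> m a b c q = 0"
    if 0: "\<And>q. q \<in> S \<Longrightarrow> q \<bullet> e = d \<Longrightarrow> m a 0 0 q = 0" and abc: "a + b + c \<le> 6" for a b c
  proof -
    have "a + b \<le> 6 \<longrightarrow> (\<forall>q. q \<in> S \<longrightarrow> q \<bullet> e = d \<longrightarrow> m a b 0 q = 0)" for b
    proof (induction b)
      case 0 then show ?case using that(1) by simp
    next
      case (Suc b)
      show ?case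
      proof (intro impI allI)
        fix q assume b: "a + Suc b \<le> 6" and q: "q \<in> S" "q \<bullet> e = d"
        have "ddir S v (m a b 0) q = 0"
          using Suc b by (intro ddir_tangential_zero[OF S basis(1,4) m(4) _ q]) auto
        then show "m a (Suc b) 0 q = 0" using m(2)[of a b 0] b by simp
      qed
    qed
    then have b0: "\<forall>q. q \<in> S \<longrightarrow> q \<bullet> e = d \<longrightarrow> m a b 0 q = 0" using abc by simp
    have "a + b + c \<le> 6 \<longrightarrow> (\<forall>q. q \<in> S \<longrightarrow> q \<bullet> e = d \<longrightarrow> m a b c q = 0)" for c
    proof (induction c)
      case 0 then show ?case using b0 by simp
    next
      case (Suc c)
      show ?case
      proof (intro impI allI)
        fix q assume c: "a + b + Suc c \<le> 6" and q: "q \<in> S" "q \<bullet> e = d"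
        have "ddir S w (m a b c) q = 0"
          using Suc c by (intro ddir_tangential_zero[OF S basis(2,5) m(4) _ q]) auto
        then show "m a b (Suc c) q = 0" using m(3)[of a b c] c by simp
      qed
    qed
    then show ?thesis using abc by blast
  qed
  have z1: "m 1 b c q = 0" if "1 + b + c \<le> 6" "q \<in> S" "q \<bullet> e = d" for b c q
    using tang[of 1 b c] bc1 that by blast
  \<comment> \<open>In the normal derivative of the Laplacian the two mixed terms have normal order
    one and vanish already.\<close>
  have z30: "m 3 0 0 q = 0" if "q \<in> S" "q \<bullet> e = d" for q
    using bc3[OF that] z1[OF _ that, of 2 0] z1[OF _ that, of 0 2] by simp
  have z3: "m 3 b c q = 0" if "3 + b + c \<le> 6" "q \<in> S" "q \<bullet> e = d" for b c q
    using tang[of 3 b c] z30 that by blast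
  have z5: "m 5 0 0 q = 0" if q: "q \<in> S" "q \<bullet> e = d" for q
  proof -
    let ?P = "\<lambda>q. ddir S \<tau> (m 0 0 0) q + (m 0 0 0 q)^3 + k * m 0 0 0 q
      + \<epsilon> * (m 4 0 0 q + m 0 4 0 q + m 0 0 4 q + 2 * m 2 2 0 q + 2 * m 2 0 2 q + 2 * m 0 2 2 q)
      + 2 * (m 2 0 0 q + m 0 2 0 q + m 0 0 2 q)"
    have d: "(m a b c has_derivative (\<lambda>v. ddir S v (m a b c) q)) (at q within S)" if "a + b + c \<le> 5" for a b c
      using m(4)[OF that] q(1) by (rule ddir_has_derivative)
    have dt: "(ddir S \<tau> (m 0 0 0) has_derivative (\<lambda>v. ddir S v (ddir S \<tau> (m 0 0 0)) q)) (at q within S)"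
      using mt(1) q(1) by (rule ddir_has_derivative)
    have "(?P has_derivative (\<lambda>v. ddir S v (ddir S \<tau> (m 0 0 0)) q
        + 3 * (m 0 0 0 q)^2 * ddir S v (m 0 0 0) q + k * ddir S v (m 0 0 0) q
        + \<epsilon> * (ddir S v (m 4 0 0) q + ddir S v (m 0 4 0) q + ddir S v (m 0 0 4) q + 2 * ddir S v (m 2 2 0) q
          + 2 * ddir S v (m 2 0 2) q + 2 * ddir S v (m 0 2 2) q)
        + 2 * (ddir S v (m 2 0 0) q + ddir S v (m 0 2 0) q + ddir S v (m 0 0 2) q))) (at q within S)"
      by (rule has_derivative_eq_rhs, (rule derivative_intros d dt | simp)+) (simp add: fun_eq_iff algebra_simps)
    from ddir_eqI[OF S q(1) this, of e]
    have "ddir S e ?P q = ddir S \<tau> (m 1 0 0) q + 3 * (m 0 0 0 q)^2 * m 1 0 0 q + k * m 1 0 0 q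
        + \<epsilon> * (m 5 0 0 q + m 1 4 0 q + m 1 0 4 q + 2 * m 3 2 0 q + 2 * m 3 0 2 q + 2 * m 1 2 2 q)
        + 2 * (m 3 0 0 q + m 1 2 0 q + m 1 0 2 q)"
      by (simp add: m(1) mt(2) eval_nat_numeral)
    moreover have "ddir S e ?P q = 0"
    proof -
      have eq: "ddir S e ?P = ddir S e (\<lambda>_. 0)" by (rule ddir_cong) (rule pde)
      show ?thesis unfolding eq by (rule ddir_eqI[OF S q(1) has_derivative_const])
    qed
    moreover have "ddir S \<tau> (m 1 0 0) q = 0"
      using bc1 by (intro ddir_tangential_zero[OF S basis(3,6) m(4) _ q]) auto
    \<comment> \<open>Every other spatial term of the differentiated equation has normal order one
      or three and vanishes on the face; the cube contributes only with the factor
      \<open>m 1 0 0 q\<close>.\<close>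
    ultimately have "\<epsilon> * m 5 0 0 q = 0"
      using z1[OF _ q, of 0 0] z1[OF _ q, of 4 0] z1[OF _ q, of 0 4] z1[OF _ q, of 2 2] z1[OF _ q, of 2 0] z1[OF _ q, of 0 2]
        z3[OF _ q, of 0 0] z3[OF _ q, of 2 0] z3[OF _ q, of 0 2] by simp
    then show ?thesis using eps by simp
  qed
  have "a = 1 \<or> a = 3 \<or> a = 5" using a by (auto elim!: oddE)
  then show ?thesis using tang[of a b c] a z1[of 0 0] z3[of 0 0] z5 q by auto
qed

section \<open>The exact solution and its reflection\<close>

locale SH_solution =
  fixes lx ly lz \<epsilon> \<eta> :: real and u0 :: "point \<Rightarrow> real" and u :: "point \<Rightarrow> real \<Rightarrow> real"
  assumes lx: "lx > 0" and ly: "ly > 0" and lz: "lz > 0" and eps: "\<epsilon> > 0"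
    and exact: "SH_exact_solution \<epsilon> \<eta> (lx, ly, lz) u0 u"
    and smooth: "Ck_on 6 (\<lambda>(x, t). u x t) (Omega (lx, ly, lz) \<times> {0..})"
begin

abbreviation l :: point where "l \<equiv> (lx, ly, lz)"
definition dom_x :: "point set" where "dom_x = Omega l"
definition cyl :: "(point \<times> real) set" where "cyl = dom_x \<times> {0..}"
definition u_xt :: "point \<times> real \<Rightarrow> real" where "u_xt = (\<lambda>(x, t). u x t)"

abbreviation ex :: "point \<times> real" where "ex \<equiv> ((1, 0, 0), 0)"
abbreviation ey :: "point \<times> real" where "ey \<equiv> ((0, 1, 0), 0)"
abbreviation ez :: "point \<times> real" where "ez \<equiv> ((0, 0, 1), 0)"
abbreviation et :: "point \<times> real" where "et \<equiv> ((0, 0, 0), 1)"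
abbreviation pd :: "point \<times> real \<Rightarrow> (point \<times> real \<Rightarrow> real) \<Rightarrow> point \<times> real \<Rightarrow> real" where "pd \<equiv> ddir cyl"

text \<open>The order of differentiation is fixed, with \<open>x\<close> outermost; raising the
  index of \<open>y\<close> or \<open>z\<close> rests on the symmetry of mixed derivatives.\<close>

definition u_deriv :: "nat \<Rightarrow> nat \<Rightarrow> nat \<Rightarrow> point \<times> real \<Rightarrow> real" where
  "u_deriv a b c = (pd ex ^^ a) ((pd ey ^^ b) ((pd ez ^^ c) u_xt))"

definition u_lap :: "point \<times> real \<Rightarrow> real" where
  "u_lap q = u_deriv 2 0 0 q + u_deriv 0 2 0 q + u_deriv 0 0 2 q"

definition u_bilap :: "point \<times> real \<Rightarrow> real" where
  "u_bilap q = u_deriv 4 0 0 q + u_deriv 0 4 0 q + u_deriv 0 0 4 q + 2 * u_deriv 2 2 0 q + 2 * u_deriv 2 0 2 q + 2 * u_deriv 0 2 2 q"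

lemma dom_x_iff: "(x, y, z) \<in> dom_x \<longleftrightarrow> x \<in> {0..lx} \<and> y \<in> {0..ly} \<and> z \<in> {0..lz}"
  by (auto simp: dom_x_def)

lemma corner_dom_x: "corner_set dom_x"
  unfolding dom_x_def using lx ly lz by (simp add: corner_set_Times corner_set_Icc)

lemma corner_cyl: "corner_set cyl"
  unfolding cyl_def by (intro corner_set_Times corner_dom_x corner_set_atLeast)

lemma basis: "ex \<in> Basis" "ey \<in> Basis" "ez \<in> Basis" "et \<in> Basis"
  by (auto simp: Basis_prod_def zero_prod_def)

lemma Ck_u_xt: "Ck_on 6 u_xt cyl"
  using smooth by (simp add: u_xt_def cyl_def dom_x_def)

lemma Ck_u_deriv:
  assumes "a + b + c + k \<le> 6"
  shows "Ck_on k (u_deriv a b c) cyl"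
proof -
  have "Ck_on (c + (b + (a + k))) u_xt cyl" by (rule Ck_on_le[OF Ck_u_xt]) (use assms in simp)
  then have "Ck_on (b + (a + k)) ((pd ez ^^ c) u_xt) cyl" by (rule Ck_on_ddir_pow)
  then have "Ck_on (a + k) ((pd ey ^^ b) ((pd ez ^^ c) u_xt)) cyl" by (rule Ck_on_ddir_pow)
  then show ?thesis unfolding u_deriv_def by (rule Ck_on_ddir_pow)
qed

lemma diff_u_deriv: "a + b + c \<le> 5 \<Longrightarrow> u_deriv a b c differentiable_on cyl"
  using Ck_on_differentiable[OF Ck_u_deriv[of a b c 1]] by simp

lemma u_deriv_0: "u_deriv 0 0 0 = u_xt"
  by (simp add: u_deriv_def)

lemma u_deriv_x: "pd ex (u_deriv a b c) = u_deriv (Suc a) b c"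
  by (simp add: u_deriv_def)

lemma u_deriv_y:
  assumes "a + b + c \<le> 5"
  shows "pd ey (u_deriv a b c) = u_deriv a (Suc b) c"
proof -
  have "Ck_on (c + (b + Suc a)) u_xt cyl" by (rule Ck_on_le[OF Ck_u_xt]) (use assms in simp)
  then have "Ck_on (b + Suc a) ((pd ez ^^ c) u_xt) cyl" by (rule Ck_on_ddir_pow)
  then have "Ck_on (Suc a) ((pd ey ^^ b) ((pd ez ^^ c) u_xt)) cyl" by (rule Ck_on_ddir_pow)
  from ddir_pow_commute1[OF corner_cyl basis(1,2) this] show ?thesis by (simp add: u_deriv_def)
qed

lemma u_deriv_z:
  assumes "a + b + c \<le> 5"
  shows "pd ez (u_deriv a b c) = u_deriv a b (Suc c)"
proof -
  have 0: "Ck_on (c + (b + Suc a)) u_xt cyl" by (rule Ck_on_le[OF Ck_u_xt]) (use assms in simp)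
  then have 1: "Ck_on (b + Suc a) ((pd ez ^^ c) u_xt) cyl" by (rule Ck_on_ddir_pow)
  then have 2: "Ck_on (Suc a) ((pd ey ^^ b) ((pd ez ^^ c) u_xt)) cyl" by (rule Ck_on_ddir_pow)
  have 3: "Ck_on (Suc b) ((pd ez ^^ c) u_xt) cyl" by (rule Ck_on_le[OF 1]) simp
  from ddir_pow_commute1[OF corner_cyl basis(1,3) 2] ddir_pow_commute1[OF corner_cyl basis(2,3) 3]
  show ?thesis by (simp add: u_deriv_def)
qed

lemma diff_dt: "pd et u_xt differentiable_on cyl"
  using Ck_on_differentiable[OF Ck_on_ddir[OF Ck_on_le[OF Ck_u_xt, of "Suc 1"]]] by simp

lemma dt_commute: "e \<in> Basis \<Longrightarrow> pd e (pd et u_xt) = pd et (pd e u_xt)"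
  by (rule ddir_commute[OF corner_cyl Ck_on_le[OF Ck_u_xt] basis(4)]) simp

lemma ddir_add3:
  assumes "f differentiable_on cyl" "g differentiable_on cyl" "h differentiable_on cyl"
  shows "pd v (\<lambda>q. f q + g q + h q) = (\<lambda>q. pd v f q + pd v g q + pd v h q)"
  using ddir_add[OF corner_cyl assms(1,2)] ddir_add[OF corner_cyl differentiable_on_add[OF assms(1,2)] assms(3)] by simp

lemma u_lap_fun: "u_lap = (\<lambda>q. u_deriv 2 0 0 q + u_deriv 0 2 0 q + u_deriv 0 0 2 q)"
  by (rule HOL.ext) (rule u_lap_def)

lemma diff_u_lap: "u_lap differentiable_on cyl"
  unfolding u_lap_fun by (intro differentiable_on_add diff_u_deriv) simp_all

lemma d_u_lap:
  "pd ex u_lap = (\<lambda>q. u_deriv 3 0 0 q + u_deriv 1 2 0 q + u_deriv 1 0 2 q)"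
  "pd ey u_lap = (\<lambda>q. u_deriv 2 1 0 q + u_deriv 0 3 0 q + u_deriv 0 1 2 q)"
  "pd ez u_lap = (\<lambda>q. u_deriv 2 0 1 q + u_deriv 0 2 1 q + u_deriv 0 0 3 q)"
  unfolding u_lap_fun by (simp_all add: ddir_add3 diff_u_deriv u_deriv_x u_deriv_y u_deriv_z eval_nat_numeral)

lemma dd_u_lap:
  "pd ex (pd ex u_lap) = (\<lambda>q. u_deriv 4 0 0 q + u_deriv 2 2 0 q + u_deriv 2 0 2 q)"
  "pd ey (pd ey u_lap) = (\<lambda>q. u_deriv 2 2 0 q + u_deriv 0 4 0 q + u_deriv 0 2 2 q)"
  "pd ez (pd ez u_lap) = (\<lambda>q. u_deriv 2 0 2 q + u_deriv 0 2 2 q + u_deriv 0 0 4 q)"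
  unfolding d_u_lap by (simp_all add: ddir_add3 diff_u_deriv u_deriv_x u_deriv_y u_deriv_z eval_nat_numeral)

text \<open>Links the derivatives of a time slice, in which the equation is stated, to derivatives
  within the space-time cylinder, for which smoothness is given. It is the chain rule for the
  inclusion of the slice, with uniqueness on \<open>dom_x\<close>.\<close>

lemma partial_slice:
  assumes f: "f differentiable_on cyl" and x: "x \<in> dom_x" and t: "t \<ge> 0"
  shows "partial dom_x b (\<lambda>y. f (y, t)) x = pd (b, 0) f (x, t)"
proof -
  have "(f has_derivative (\<lambda>v. pd v f (x, t))) (at (x, t) within cyl)"
    using x t by (intro ddir_has_derivative f) (simp add: cyl_def)
  then have 1: "(f has_derivative (\<lambda>v. pd v f (x, t))) (at (x, t) within (\<lambda>y. (y, t)) ` dom_x)"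
    by (rule has_derivative_subset) (use t in \<open>auto simp: cyl_def\<close>)
  have "((\<lambda>y. (y, t)) has_derivative (\<lambda>b. (b, 0))) (at x within dom_x)"
    by (auto intro!: derivative_eq_intros)
  from has_derivative_in_compose[OF this 1]
  have "((\<lambda>y. f (y, t)) has_derivative (\<lambda>b. pd (b, 0) f (x, t))) (at x within dom_x)" .
  from ddir_eqI[OF corner_dom_x x this, of b] show ?thesis
    using x by (simp add: ddir_def partial_def)
qed

lemma partial_cong:
  assumes "\<And>y. y \<in> dom_x \<Longrightarrow> f y = g y" "x \<in> dom_x"
  shows "partial dom_x b f x = partial dom_x b g x"
  unfolding partial_def using frechet_derivative_cong_on[of dom_x f g, OF assms] by simp

lemma lap_cong:
  assumes "\<And>y. y \<in> dom_x \<Longrightarrow> f y = g y" "x \<in> dom_x"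
  shows "lap dom_x f x = lap dom_x g x"
  unfolding lap_def using assms by (simp add: partial_cong[of "partial dom_x _ f" "partial dom_x _ g"] partial_cong[of f g])

lemma partial2_slice:
  assumes f: "f differentiable_on cyl" "pd (b, 0) f differentiable_on cyl" and x: "x \<in> dom_x" and t: "t \<ge> 0"
  shows "partial dom_x b (partial dom_x b (\<lambda>y. f (y, t))) x = pd (b, 0) (pd (b, 0) f) (x, t)"
proof -
  have "partial dom_x b (partial dom_x b (\<lambda>y. f (y, t))) x = partial dom_x b (\<lambda>y. pd (b, 0) f (y, t)) x"
    using t by (intro partial_cong partial_slice f x) auto
  also have "\<dots> = pd (b, 0) (pd (b, 0) f) (x, t)"
    by (rule partial_slice[OF f(2) x t])
  finally show ?thesis .
qed

lemma lap_slice: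
  assumes "x \<in> dom_x" "t \<ge> 0"
  shows "lap dom_x (\<lambda>y. u y t) x = u_lap (x, t)"
proof -
  have "lap dom_x (\<lambda>y. u_xt (y, t)) x = pd ex (pd ex u_xt) (x, t) + pd ey (pd ey u_xt) (x, t) + pd ez (pd ez u_xt) (x, t)"
    using diff_u_deriv[of 0 0 0] diff_u_deriv[of 1 0 0] diff_u_deriv[of 0 1 0] diff_u_deriv[of 0 0 1] assms
    by (simp add: lap_def partial2_slice u_deriv_def)
  then show ?thesis by (simp add: u_lap_def u_deriv_def u_xt_def eval_nat_numeral)
qed

lemma lap_lap_slice:
  assumes "x \<in> dom_x" "t \<ge> 0"
  shows "lap dom_x (lap dom_x (\<lambda>y. u y t)) x = u_bilap (x, t)"
proof -
  have "lap dom_x (lap dom_x (\<lambda>y. u y t)) x = lap dom_x (\<lambda>y. u_lap (y, t)) x"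
    using assms lap_slice by (intro lap_cong) auto
  also have "\<dots> = pd ex (pd ex u_lap) (x, t) + pd ey (pd ey u_lap) (x, t) + pd ez (pd ez u_lap) (x, t)"
    unfolding lap_def using assms diff_u_lap
    by (simp add: partial2_slice d_u_lap differentiable_on_add diff_u_deriv)
  also have "\<dots> = u_bilap (x, t)" by (simp add: dd_u_lap u_bilap_def)
  finally show ?thesis .
qed

lemma pde:
  assumes "q \<in> cyl"
  shows "pd et u_xt q + (u_xt q)^3 + (1 - \<eta>) * u_xt q + \<epsilon> * u_bilap q + 2 * u_lap q = 0"
proof -
  obtain x t where q: "q = (x, t)" "x \<in> dom_x" "t \<ge> 0" using assms by (cases q) (auto simp: cyl_def)
  have d1: "((\<lambda>s. u x s) has_real_derivative
           - ((u x t)^3 + (1 - \<eta>) * u x t + \<epsilon> * u_bilap (x, t) + 2 * u_lap (x, t))) (at t within {0..})"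
  proof -
    have "((\<lambda>s. u x s) has_real_derivative - ((u x t)^3 + (1 - \<eta>) * u x t
        + \<epsilon> * lap dom_x (lap dom_x (\<lambda>y. u y t)) x + 2 * lap dom_x (\<lambda>y. u y t) x)) (at t within {0..})"
      using exact q unfolding SH_exact_solution_def dom_x_def by blast
    then show ?thesis by (simp only: lap_slice[OF q(2,3)] lap_lap_slice[OF q(2,3)])
  qed
  have "((\<lambda>s. u_xt ((x, 0) + s *\<^sub>R et)) has_real_derivative pd et u_xt ((x, 0) + t *\<^sub>R et)) (at t within {0..})"
    using diff_u_deriv[of 0 0 0] q by (intro ddir_line) (auto simp: u_deriv_0 cyl_def zero_prod_def[symmetric])
  then have "((\<lambda>s. u x s) has_real_derivative pd et u_xt q) (at t within {0..})"
    using q by (simp add: u_xt_def zero_prod_def[symmetric])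
  \<comment> \<open>Both derivatives are restricted to \<open>{t..t + 1}\<close>, which lies in the
    time domain even for \<open>t = 0\<close> and determines a derivative from the right.\<close>
  then have "- ((u x t)^3 + (1 - \<eta>) * u x t + \<epsilon> * u_bilap (x, t) + 2 * u_lap (x, t)) = pd et u_xt q"
    using DERIV_subset[OF d1, of "{t..t + 1}"] DERIV_subset[of _ _ t "{0..}" "{t..t + 1}"] q(3)
    by (intro has_field_derivative_unique[of "\<lambda>s. u x s" _ t "{t..t + 1}"]) (auto simp: at_within_Icc_at_right)
  then show ?thesis using q by (simp add: u_xt_def)
qed

text \<open>As \<open>outward_normals\<close> lists the normals of all faces through a point, each
  condition holds on the closed face, edges and corners included. This is needed for differentiating
  it tangentially.\<close>

lemma neumann_faces:
  assumes "q \<in> cyl"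
  shows "q \<bullet> ex = 0 \<or> q \<bullet> ex = lx \<Longrightarrow> u_deriv 1 0 0 q = 0 \<and> pd ex u_lap q = 0"
    and "q \<bullet> ey = 0 \<or> q \<bullet> ey = ly \<Longrightarrow> u_deriv 0 1 0 q = 0 \<and> pd ey u_lap q = 0"
    and "q \<bullet> ez = 0 \<or> q \<bullet> ez = lz \<Longrightarrow> u_deriv 0 0 1 q = 0 \<and> pd ez u_lap q = 0"
proof -
  obtain x y z t where q: "q = ((x, y, z), t)" "(x, y, z) \<in> dom_x" "t \<ge> 0"
    using assms by (cases q) (auto simp: cyl_def)
  have 1: "partial dom_x b (\<lambda>y. u y t) (x, y, z) = pd (b, 0) u_xt q" for b
    using partial_slice[of u_xt "(x, y, z)" t b] diff_u_deriv[of 0 0 0] q by (simp add: u_deriv_0 u_xt_def)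
  have 2: "partial dom_x b (lap dom_x (\<lambda>y. u y t)) (x, y, z) = pd (b, 0) u_lap q" for b
  proof -
    have "partial dom_x b (lap dom_x (\<lambda>y. u y t)) (x, y, z) = partial dom_x b (\<lambda>y. u_lap (y, t)) (x, y, z)"
      using lap_slice q by (intro partial_cong) auto
    then show ?thesis using partial_slice[OF diff_u_lap] q by simp
  qed
  have n: "inner (grad dom_x v (x, y, z)) n = 0"
    if "v = (\<lambda>y. u y t) \<or> v = lap dom_x (\<lambda>y. u y t)" "n \<in> outward_normals l (x, y, z)" for v n
    using exact q that unfolding SH_exact_solution_def neumann_def dom_x_def by blast
  have g: "grad dom_x (\<lambda>y. u y t) (x, y, z) = (u_deriv 1 0 0 q, u_deriv 0 1 0 q, u_deriv 0 0 1 q)"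
    "grad dom_x (lap dom_x (\<lambda>y. u y t)) (x, y, z) = (pd ex u_lap q, pd ey u_lap q, pd ez u_lap q)"
    by (simp_all add: grad_def 1 2 u_deriv_def)
  show "u_deriv 1 0 0 q = 0 \<and> pd ex u_lap q = 0" if "q \<bullet> ex = 0 \<or> q \<bullet> ex = lx"
  proof -
    from that have "(- 1, 0, 0) \<in> outward_normals l (x, y, z) \<or> (1, 0, 0) \<in> outward_normals l (x, y, z)"
      using q by auto
    then show ?thesis using n[of "\<lambda>y. u y t"] n[of "lap dom_x (\<lambda>y. u y t)"] g by fastforce
  qed
  show "u_deriv 0 1 0 q = 0 \<and> pd ey u_lap q = 0" if "q \<bullet> ey = 0 \<or> q \<bullet> ey = ly"
  proof -
    from that have "(0, - 1, 0) \<in> outward_normals l (x, y, z) \<or> (0, 1, 0) \<in> outward_normals l (x, y, z)"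
      using q by auto
    then show ?thesis using n[of "\<lambda>y. u y t"] n[of "lap dom_x (\<lambda>y. u y t)"] g by fastforce
  qed
  show "u_deriv 0 0 1 q = 0 \<and> pd ez u_lap q = 0" if "q \<bullet> ez = 0 \<or> q \<bullet> ez = lz"
  proof -
    from that have "(0, 0, - 1) \<in> outward_normals l (x, y, z) \<or> (0, 0, 1) \<in> outward_normals l (x, y, z)"
      using q by auto
    then show ?thesis using n[of "\<lambda>y. u y t"] n[of "lap dom_x (\<lambda>y. u y t)"] g by fastforce
  qed
qed

lemma u_deriv_face_x:
  assumes "odd a" "a + b + c \<le> 6" "q \<in> cyl" "q \<bullet> ex = 0 \<or> q \<bullet> ex = lx"
  shows "u_deriv a b c q = 0"
proof -
  have "u_deriv a b c q = 0" if d: "d = 0 \<or> d = lx" "q \<bullet> ex = d" for d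
  proof (rule odd_normal_derivatives_zero[where m = u_deriv and e = ex and v = ey and w = ez and \<tau> = et
        and S = cyl and \<epsilon> = \<epsilon> and k = "1 - \<eta>" and d = d])
    show "pd ex (pd et (u_deriv 0 0 0)) = pd et (u_deriv 1 0 0)"
      by (simp add: u_deriv_0 dt_commute[OF basis(1)]) (simp add: u_deriv_def)
    fix q assume q: "q \<in> cyl"
    show "pd et (u_deriv 0 0 0) q + (u_deriv 0 0 0 q)^3 + (1 - \<eta>) * u_deriv 0 0 0 q
      + \<epsilon> * (u_deriv 4 0 0 q + u_deriv 0 4 0 q + u_deriv 0 0 4 q + 2 * u_deriv 2 2 0 q + 2 * u_deriv 2 0 2 q + 2 * u_deriv 0 2 2 q)
      + 2 * (u_deriv 2 0 0 q + u_deriv 0 2 0 q + u_deriv 0 0 2 q) = 0"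
      using pde[OF q] by (simp add: u_deriv_0 u_lap_def u_bilap_def)
    assume "q \<bullet> ex = d"
    then have *: "u_deriv 1 0 0 q = 0 \<and> pd ex u_lap q = 0" using d by (intro neumann_faces[OF q]) auto
    then show "u_deriv 1 0 0 q = 0" ..
    show "u_deriv 3 0 0 q + u_deriv 1 2 0 q + u_deriv 1 0 2 q = 0" using * by (simp add: d_u_lap)
  qed (use assms d basis corner_cyl diff_dt eps in \<open>auto simp: u_deriv_x u_deriv_y u_deriv_z diff_u_deriv u_deriv_0\<close>)
  then show ?thesis using assms(4) by blast
qed

text \<open>The indices of \<open>u_deriv\<close> are permuted so that the normal direction comes
  first, as in \<open>odd_normal_derivatives_zero\<close>.\<close>

lemma u_deriv_face_y:
  assumes "odd b" "a + b + c \<le> 6" "q \<in> cyl" "q \<bullet> ey = 0 \<or> q \<bullet> ey = ly"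
  shows "u_deriv a b c q = 0"
proof -
  have "u_deriv a b c q = 0" if d: "d = 0 \<or> d = ly" "q \<bullet> ey = d" for d
  proof (rule odd_normal_derivatives_zero[where m = "\<lambda>b a c. u_deriv a b c" and e = ey and v = ex and w = ez and \<tau> = et
        and S = cyl and \<epsilon> = \<epsilon> and k = "1 - \<eta>" and d = d])
    show "pd ey (pd et (u_deriv 0 0 0)) = pd et (u_deriv 0 1 0)"
      by (simp add: u_deriv_0 dt_commute[OF basis(2)]) (simp add: u_deriv_def)
    fix q assume q: "q \<in> cyl"
    show "pd et (u_deriv 0 0 0) q + (u_deriv 0 0 0 q)^3 + (1 - \<eta>) * u_deriv 0 0 0 q
      + \<epsilon> * (u_deriv 0 4 0 q + u_deriv 4 0 0 q + u_deriv 0 0 4 q + 2 * u_deriv 2 2 0 q + 2 * u_deriv 0 2 2 q + 2 * u_deriv 2 0 2 q)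
      + 2 * (u_deriv 0 2 0 q + u_deriv 2 0 0 q + u_deriv 0 0 2 q) = 0"
      using pde[OF q] by (simp add: u_deriv_0 u_lap_def u_bilap_def algebra_simps)
    assume "q \<bullet> ey = d"
    then have *: "u_deriv 0 1 0 q = 0 \<and> pd ey u_lap q = 0" using d by (intro neumann_faces[OF q]) auto
    then show "u_deriv 0 1 0 q = 0" ..
    show "u_deriv 0 3 0 q + u_deriv 2 1 0 q + u_deriv 0 1 2 q = 0" using * by (simp add: d_u_lap)
  qed (use assms d basis corner_cyl diff_dt eps in \<open>auto simp: u_deriv_x u_deriv_y u_deriv_z diff_u_deriv u_deriv_0\<close>)
  then show ?thesis using assms(4) by blast
qed

lemma u_deriv_face_z:
  assumes "odd c" "a + b + c \<le> 6" "q \<in> cyl" "q \<bullet> ez = 0 \<or> q \<bullet> ez = lz"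
  shows "u_deriv a b c q = 0"
proof -
  have "u_deriv a b c q = 0" if d: "d = 0 \<or> d = lz" "q \<bullet> ez = d" for d
  proof (rule odd_normal_derivatives_zero[where m = "\<lambda>c a b. u_deriv a b c" and e = ez and v = ex and w = ey and \<tau> = et
        and S = cyl and \<epsilon> = \<epsilon> and k = "1 - \<eta>" and d = d])
    show "pd ez (pd et (u_deriv 0 0 0)) = pd et (u_deriv 0 0 1)"
      by (simp add: u_deriv_0 dt_commute[OF basis(3)]) (simp add: u_deriv_def)
    fix q assume q: "q \<in> cyl"
    show "pd et (u_deriv 0 0 0) q + (u_deriv 0 0 0 q)^3 + (1 - \<eta>) * u_deriv 0 0 0 q
      + \<epsilon> * (u_deriv 0 0 4 q + u_deriv 4 0 0 q + u_deriv 0 4 0 q + 2 * u_deriv 2 0 2 q + 2 * u_deriv 0 2 2 q + 2 * u_deriv 2 2 0 q)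
      + 2 * (u_deriv 0 0 2 q + u_deriv 2 0 0 q + u_deriv 0 2 0 q) = 0"
      using pde[OF q] by (simp add: u_deriv_0 u_lap_def u_bilap_def algebra_simps)
    assume "q \<bullet> ez = d"
    then have *: "u_deriv 0 0 1 q = 0 \<and> pd ez u_lap q = 0" using d by (intro neumann_faces[OF q]) auto
    then show "u_deriv 0 0 1 q = 0" ..
    show "u_deriv 0 0 3 q + u_deriv 2 0 1 q + u_deriv 0 2 1 q = 0" using * by (simp add: d_u_lap)
  qed (use assms d basis corner_cyl diff_dt eps in \<open>auto simp: u_deriv_x u_deriv_y u_deriv_z diff_u_deriv u_deriv_0\<close>)
  then show ?thesis using assms(4) by blast
qed

text \<open>
  Derivatives of the even reflection of \<open>u\<close>; each odd order brings a sign on the reflected side.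
\<close>

definition refl_deriv :: "real \<Rightarrow> nat \<Rightarrow> nat \<Rightarrow> nat \<Rightarrow> point \<Rightarrow> real" where
  "refl_deriv t a b c p = (case p of (x, y, z) \<Rightarrow>
     fold_sgn lx x ^ a * fold_sgn ly y ^ b * fold_sgn lz z ^ c *
       u_deriv a b c ((fold_pos lx x, fold_pos ly y, fold_pos lz z), t))"

text \<open>One reflection across each face covers this box, and its openness makes the derivatives
  two-sided.\<close>

definition refl_box :: "point set" where
  "refl_box = {- lx<..<2 * lx} \<times> {- ly<..<2 * ly} \<times> {- lz<..<2 * lz}"

lemma reflect_along:
  assumes l: "m > 0" and x: "- m < x" "x < 2 * m"
    and f: "\<And>s. s \<in> {0..m} \<Longrightarrow> (f a has_real_derivative f (Suc a) s) (at s within {0..m})"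
    and odd: "\<And>k. odd k \<Longrightarrow> k \<in> {a, Suc a} \<Longrightarrow> f k 0 = 0 \<and> f k m = (0::real)"
  shows "((\<lambda>s. k * (fold_sgn m (x + s) ^ a * f a (fold_pos m (x + s)))) has_real_derivative
      k * (fold_sgn m x ^ Suc a * f (Suc a) (fold_pos m x))) (at 0)"
proof -
  have "((\<lambda>x. fold_sgn m x ^ a * f a (fold_pos m x)) has_real_derivative
      fold_sgn m x ^ Suc a * f (Suc a) (fold_pos m x)) (at x)"
    using odd[of a] odd[of "Suc a"] by (intro reflect_has_derivative l x f) auto
  then show ?thesis
    using DERIV_shift[of "\<lambda>x. fold_sgn m x ^ a * f a (fold_pos m x)" _ 0 x]
    by (intro DERIV_cmult) (simp add: add.commute)
qed

lemma refl_deriv_x: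
  assumes "a + b + c \<le> 5" "q \<in> refl_box" "t \<ge> 0"
  shows "deriv_along (1, 0, 0) (refl_deriv t a b c) (refl_deriv t (Suc a) b c) q"
proof -
  obtain x y z where q: "q = (x, y, z)" and x: "- lx < x" "x < 2 * lx"
    and y: "fold_pos ly y \<in> {0..ly}" and z: "fold_pos lz z \<in> {0..lz}"
    using assms(2) fold_pos_mem[of ly] fold_pos_mem[of lz] by (cases q) (auto simp: refl_box_def)
  define f where "f a s = u_deriv a b c ((s, fold_pos ly y, fold_pos lz z), t)" for a s
  have mem: "((s, fold_pos ly y, fold_pos lz z), t) \<in> cyl" if "s \<in> {0..lx}" for s
    using that y z assms(3) by (simp add: cyl_def dom_x_iff)
  have "(f a has_real_derivative f (Suc a) s) (at s within {0..lx})" if s: "s \<in> {0..lx}" for s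
    using ddir_line[OF diff_u_deriv[OF assms(1)], of "{0..lx}" "((0, fold_pos ly y, fold_pos lz z), t)" ex s] mem s
    by (simp add: f_def[abs_def] u_deriv_x)
  moreover have "f k 0 = 0 \<and> f k lx = 0" if "odd k" "k \<in> {a, Suc a}" for k
    unfolding f_def using that mem lx assms(1) by (auto intro!: u_deriv_face_x)
  ultimately have "((\<lambda>s. (fold_sgn ly y ^ b * fold_sgn lz z ^ c) * (fold_sgn lx (x + s) ^ a * f a (fold_pos lx (x + s))))
     has_real_derivative (fold_sgn ly y ^ b * fold_sgn lz z ^ c) * (fold_sgn lx x ^ Suc a * f (Suc a) (fold_pos lx x))) (at 0)"
    by (intro reflect_along lx x) auto
  then show ?thesis
    by (simp add: deriv_along_def q refl_deriv_def f_def mult_ac)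
qed

lemma refl_deriv_y:
  assumes "a + b + c \<le> 5" "q \<in> refl_box" "t \<ge> 0"
  shows "deriv_along (0, 1, 0) (refl_deriv t a b c) (refl_deriv t a (Suc b) c) q"
proof -
  obtain x y z where q: "q = (x, y, z)" and y: "- ly < y" "y < 2 * ly"
    and x: "fold_pos lx x \<in> {0..lx}" and z: "fold_pos lz z \<in> {0..lz}"
    using assms(2) fold_pos_mem[of lx] fold_pos_mem[of lz] by (cases q) (auto simp: refl_box_def)
  define f where "f b s = u_deriv a b c ((fold_pos lx x, s, fold_pos lz z), t)" for b s
  have mem: "((fold_pos lx x, s, fold_pos lz z), t) \<in> cyl" if "s \<in> {0..ly}" for s
    using that x z assms(3) by (simp add: cyl_def dom_x_iff)
  have "(f b has_real_derivative f (Suc b) s) (at s within {0..ly})" if s: "s \<in> {0..ly}" for s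
    using ddir_line[OF diff_u_deriv[OF assms(1)], of "{0..ly}" "((fold_pos lx x, 0, fold_pos lz z), t)" ey s] mem s
    by (simp add: f_def[abs_def] u_deriv_y[OF assms(1)])
  moreover have "f k 0 = 0 \<and> f k ly = 0" if "odd k" "k \<in> {b, Suc b}" for k
    unfolding f_def using that mem ly assms(1) by (auto intro!: u_deriv_face_y)
  ultimately have "((\<lambda>s. (fold_sgn lx x ^ a * fold_sgn lz z ^ c) * (fold_sgn ly (y + s) ^ b * f b (fold_pos ly (y + s))))
     has_real_derivative (fold_sgn lx x ^ a * fold_sgn lz z ^ c) * (fold_sgn ly y ^ Suc b * f (Suc b) (fold_pos ly y))) (at 0)"
    by (intro reflect_along ly y) auto
  then show ?thesis
    by (simp add: deriv_along_def q refl_deriv_def f_def mult_ac)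
qed

lemma refl_deriv_z:
  assumes "a + b + c \<le> 5" "q \<in> refl_box" "t \<ge> 0"
  shows "deriv_along (0, 0, 1) (refl_deriv t a b c) (refl_deriv t a b (Suc c)) q"
proof -
  obtain x y z where q: "q = (x, y, z)" and z: "- lz < z" "z < 2 * lz"
    and x: "fold_pos lx x \<in> {0..lx}" and y: "fold_pos ly y \<in> {0..ly}"
    using assms(2) fold_pos_mem[of lx] fold_pos_mem[of ly] by (cases q) (auto simp: refl_box_def)
  define f where "f c s = u_deriv a b c ((fold_pos lx x, fold_pos ly y, s), t)" for c s
  have mem: "((fold_pos lx x, fold_pos ly y, s), t) \<in> cyl" if "s \<in> {0..lz}" for s
    using that x y assms(3) by (simp add: cyl_def dom_x_iff)
  have "(f c has_real_derivative f (Suc c) s) (at s within {0..lz})" if s: "s \<in> {0..lz}" for s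
    using ddir_line[OF diff_u_deriv[OF assms(1)], of "{0..lz}" "((fold_pos lx x, fold_pos ly y, 0), t)" ez s] mem s
    by (simp add: f_def[abs_def] u_deriv_z[OF assms(1)])
  moreover have "f k 0 = 0 \<and> f k lz = 0" if "odd k" "k \<in> {c, Suc c}" for k
    unfolding f_def using that mem lz assms(1) by (auto intro!: u_deriv_face_z)
  ultimately have "((\<lambda>s. (fold_sgn lx x ^ a * fold_sgn ly y ^ b) * (fold_sgn lz (z + s) ^ c * f c (fold_pos lz (z + s))))
     has_real_derivative (fold_sgn lx x ^ a * fold_sgn ly y ^ b) * (fold_sgn lz z ^ Suc c * f (Suc c) (fold_pos lz z))) (at 0)"
    by (intro reflect_along lz z) auto
  then show ?thesis
    by (simp add: deriv_along_def q refl_deriv_def f_def mult_ac)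
qed

lemma refl_deriv_inside:
  assumes "p \<in> dom_x"
  shows "refl_deriv t a b c p = u_deriv a b c (p, t)"
  using assms by (cases p) (auto simp: refl_deriv_def dom_x_iff fold_sgn_def fold_pos_def)

lemma compact_bound:
  fixes f :: "point \<times> real \<Rightarrow> real"
  assumes "continuous_on cyl f"
  obtains B where "B \<ge> 0" "\<And>x t. x \<in> dom_x \<Longrightarrow> t \<in> {0..T} \<Longrightarrow> \<bar>f (x, t)\<bar> \<le> B"
proof -
  have "compact (dom_x \<times> {0..T})"
    by (simp add: dom_x_def compact_Times)
  moreover have "continuous_on (dom_x \<times> {0..T}) f"
    by (rule continuous_on_subset[OF assms]) (auto simp: cyl_def)
  ultimately have "bounded (f ` (dom_x \<times> {0..T}))"
    by (intro compact_imp_bounded compact_continuous_image)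
  then obtain B where B: "\<forall>y\<in>f ` (dom_x \<times> {0..T}). norm y \<le> B" by (auto simp: bounded_iff)
  then show ?thesis by (intro that[of "max B 0"]) (auto simp: le_max_iff_disj)
qed

lemma u_deriv_bound:
  obtains B where "B \<ge> 0"
    "\<And>a b c x t. a + b + c \<le> 6 \<Longrightarrow> x \<in> dom_x \<Longrightarrow> t \<in> {0..T} \<Longrightarrow> \<bar>u_deriv a b c (x, t)\<bar> \<le> B"
proof -
  have "\<forall>i. \<exists>B. B \<ge> 0 \<and> (case i of (a, b, c) \<Rightarrow> a + b + c \<le> 6 \<longrightarrow>
      (\<forall>x\<in>dom_x. \<forall>t\<in>{0..T}. \<bar>u_deriv a b c (x, t)\<bar> \<le> B))"
  proof
    fix i :: "nat \<times> nat \<times> nat"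
    obtain a b c where i: "i = (a, b, c)" by (cases i)
    show "\<exists>B. B \<ge> 0 \<and> (case i of (a, b, c) \<Rightarrow> a + b + c \<le> 6 \<longrightarrow>
      (\<forall>x\<in>dom_x. \<forall>t\<in>{0..T}. \<bar>u_deriv a b c (x, t)\<bar> \<le> B))"
    proof (cases "a + b + c \<le> 6")
      case True
      then obtain B where "B \<ge> 0" "\<And>x t. x \<in> dom_x \<Longrightarrow> t \<in> {0..T} \<Longrightarrow> \<bar>u_deriv a b c (x, t)\<bar> \<le> B"
        using compact_bound[OF Ck_on_continuous[OF Ck_u_deriv[of a b c 0]]] by auto
      then show ?thesis using i by auto
    qed (use i in auto)
  qed
  from choice[OF this] obtain \<beta> where *: "\<forall>i. \<beta> i \<ge> 0 \<and> (case i of (a, b, c) \<Rightarrow> a + b + c \<le> 6 \<longrightarrow>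
      (\<forall>x\<in>dom_x. \<forall>t\<in>{0..T}. \<bar>u_deriv a b c (x, t)\<bar> \<le> \<beta> i))"
    by blast
  have \<beta>: "\<And>i. \<beta> i \<ge> 0" "\<And>a b c x t. a + b + c \<le> 6 \<Longrightarrow> x \<in> dom_x \<Longrightarrow> t \<in> {0..T} \<Longrightarrow>
      \<bar>u_deriv a b c (x, t)\<bar> \<le> \<beta> (a, b, c)"
    using * by blast (use * in fastforce)
  \<comment> \<open>A finite cube containing all orders with \<open>a + b + c \<le> 6\<close>; the
    sum of the nonnegative bounds over it dominates each of them.\<close>
  define I where "I = {..6::nat} \<times> {..6::nat} \<times> {..6::nat}"
  have "\<beta> i \<le> sum \<beta> I" if "i \<in> I" for i
    using that \<beta>(1) by (intro member_le_sum) (auto simp: I_def)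
  then have "\<bar>u_deriv a b c (x, t)\<bar> \<le> sum \<beta> I" if "a + b + c \<le> 6" "x \<in> dom_x" "t \<in> {0..T}" for a b c x t
    using \<beta>(2)[OF that] that(1) by (intro order_trans[OF \<beta>(2)[OF that]]) (auto simp: I_def)
  moreover have "sum \<beta> I \<ge> 0" using \<beta>(1) by (intro sum_nonneg) auto
  ultimately show ?thesis by (rule that[rotated])
qed

lemma refl_deriv_partials:
  assumes "t \<ge> 0" and B: "\<And>a b c x. a + b + c \<le> 6 \<Longrightarrow> x \<in> dom_x \<Longrightarrow> \<bar>u_deriv a b c (x, t)\<bar> \<le> B"
  shows "partials (refl_deriv t) refl_box B"
proof
  fix a b c :: nat and q :: point assume abc: "a + b + c \<le> 6" and q: "q \<in> refl_box"
  obtain x y z where xyz: "q = (x, y, z)" by (cases q)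
  have "(fold_pos lx x, fold_pos ly y, fold_pos lz z) \<in> dom_x"
    using q fold_pos_mem[of lx x] fold_pos_mem[of ly y] fold_pos_mem[of lz z] by (simp add: xyz dom_x_iff refl_box_def)
  then have "\<bar>u_deriv a b c ((fold_pos lx x, fold_pos ly y, fold_pos lz z), t)\<bar> \<le> B" by (rule B[OF abc])
  moreover have "\<bar>fold_sgn m s ^ k\<bar> = 1" for m s k by (simp add: fold_sgn_def)
  ultimately show "\<bar>refl_deriv t a b c q\<bar> \<le> B" by (simp add: refl_deriv_def xyz abs_mult)
qed (use refl_deriv_x refl_deriv_y refl_deriv_z assms(1) in auto)

lemma time_lipschitz:
  assumes f: "f differentiable_on cyl" and x: "x \<in> dom_x" and s: "0 \<le> s" "s < t"
    and B: "\<And>r. s \<le> r \<Longrightarrow> r \<le> t \<Longrightarrow> \<bar>pd et f (x, r)\<bar> \<le> B"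
  shows "\<bar>f (x, t) - f (x, s)\<bar> \<le> B * (t - s)"
    and "\<exists>r. s < r \<and> r < t \<and> f (x, t) - f (x, s) = (t - s) * pd et f (x, r)"
proof -
  have *: "(x, 0) + r *\<^sub>R et = (x, r)" for r by (simp add: zero_prod_def[symmetric])
  have "((\<lambda>r. f ((x, 0) + r *\<^sub>R et)) has_real_derivative pd et f ((x, 0) + r *\<^sub>R et)) (at r within {s..t})"
    if "r \<in> {s..t}" for r
  proof (rule ddir_line[OF f _ that])
    fix r assume "r \<in> {s..t}"
    then show "(x, 0) + r *\<^sub>R et \<in> cyl" unfolding * using x s by (simp add: cyl_def)
  qed
  then have "((\<lambda>r. f (x, r)) has_real_derivative pd et f (x, r)) (at r within {s..t})" if "r \<in> {s..t}" for r
    using that unfolding * by blast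
  from mvt_within[OF s(2) this]
  show 1: "\<exists>r. s < r \<and> r < t \<and> f (x, t) - f (x, s) = (t - s) * pd et f (x, r)" by auto
  then obtain r where "s < r" "r < t" "f (x, t) - f (x, s) = (t - s) * pd et f (x, r)" by blast
  then show "\<bar>f (x, t) - f (x, s)\<bar> \<le> B * (t - s)"
    using B[of r] by (simp add: abs_mult mult.commute)
qed

lemma time_derivative_bounds:
  obtains Bt Btt BtL where
    "Bt \<ge> 0" "\<And>x t. x \<in> dom_x \<Longrightarrow> t \<in> {0..T} \<Longrightarrow> \<bar>pd et u_xt (x, t)\<bar> \<le> Bt"
    "Btt \<ge> 0" "\<And>x t. x \<in> dom_x \<Longrightarrow> t \<in> {0..T} \<Longrightarrow> \<bar>pd et (pd et u_xt) (x, t)\<bar> \<le> Btt"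
    "BtL \<ge> 0" "\<And>x t. x \<in> dom_x \<Longrightarrow> t \<in> {0..T} \<Longrightarrow> \<bar>pd et u_lap (x, t)\<bar> \<le> BtL"
proof -
  have cont: "continuous_on cyl (pd v f)" if "Ck_on (Suc 0) f cyl" for v f
    by (rule Ck_on_continuous[OF Ck_on_ddir[OF that]])
  have "Ck_on (Suc 0) u_xt cyl" "Ck_on (Suc (Suc 0)) u_xt cyl"
    by (rule Ck_on_le[OF Ck_u_xt], simp)+
  then have c1: "continuous_on cyl (pd et u_xt)" "continuous_on cyl (pd et (pd et u_xt))"
    by (blast intro: cont Ck_on_ddir)+
  have "Ck_on (Suc 0) (u_deriv 2 0 0) cyl" "Ck_on (Suc 0) (u_deriv 0 2 0) cyl" "Ck_on (Suc 0) (u_deriv 0 0 2) cyl"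
    by (rule Ck_u_deriv, simp)+
  then have "continuous_on cyl (\<lambda>q. pd et (u_deriv 2 0 0) q + pd et (u_deriv 0 2 0) q + pd et (u_deriv 0 0 2) q)"
    by (intro continuous_on_add cont)
  then have c2: "continuous_on cyl (pd et u_lap)"
    unfolding u_lap_fun by (simp add: ddir_add3 diff_u_deriv)
  obtain B1 where B1: "B1 \<ge> 0" "\<And>x t. x \<in> dom_x \<Longrightarrow> t \<in> {0..T} \<Longrightarrow> \<bar>pd et u_xt (x, t)\<bar> \<le> B1"
    using compact_bound[OF c1(1), of T] by blast
  obtain B2 where B2: "B2 \<ge> 0" "\<And>x t. x \<in> dom_x \<Longrightarrow> t \<in> {0..T} \<Longrightarrow> \<bar>pd et (pd et u_xt) (x, t)\<bar> \<le> B2"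
    using compact_bound[OF c1(2), of T] by blast
  obtain B3 where B3: "B3 \<ge> 0" "\<And>x t. x \<in> dom_x \<Longrightarrow> t \<in> {0..T} \<Longrightarrow> \<bar>pd et u_lap (x, t)\<bar> \<le> B3"
    using compact_bound[OF c2, of T] by blast
  show ?thesis by (rule that[OF B1 B2 B3])
qed

end

section \<open>Consistency and convergence\<close>

text \<open>Within two ghost layers of a grid with at least two cells, a single reflection brings an
  index back, and \<open>fold_pos\<close> performs the same reflection on positions.\<close>

lemma fold_pos_node:
  assumes N: "N \<ge> 2" and i: "- 2 \<le> i" "i \<le> int N + 2" and l: "l > 0"
  shows "fold_pos l (real_of_int i * (l / real N)) = real_of_int (fold_index N i) * (l / real N)"
proof -
  define h where "h = l / real N"
  have h: "h > 0" "l = real N * h" using N l by (auto simp: h_def)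
  consider "i < 0" | "0 \<le> i" "i \<le> int N" | "i > int N" by linarith
  then show ?thesis unfolding h_def[symmetric]
  proof cases
    case 1
    have "fold_index N i = - i"
      using fold_index_minus[of N "- i"] fold_index_id[of "- i" N] 1 i N by simp
    moreover have "real_of_int i * h < 0" using 1 h by (simp add: mult_neg_pos)
    ultimately show "fold_pos l (real_of_int i * h) = real_of_int (fold_index N i) * h"
      by (simp add: fold_pos_def)
  next
    case 2
    have "real_of_int i \<le> real N" using 2 by linarith
    then have "0 \<le> real_of_int i * h" "real_of_int i * h \<le> l" using 2 h by (auto intro: mult_right_mono)
    then show "fold_pos l (real_of_int i * h) = real_of_int (fold_index N i) * h"
      using 2 N by (simp add: fold_pos_def fold_index_id)
  next
    case 3
    have "fold_index N i = 2 * int N - i"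
      using fold_index_reflect[of N "i - int N"] fold_index_id[of "2 * int N - i" N] 3 i N by simp
    moreover have "real N < real_of_int i" using 3 by linarith
    then have "l < real_of_int i * h" using h by simp
    moreover have "0 < l" by (rule l)
    ultimately show "fold_pos l (real_of_int i * h) = real_of_int (fold_index N i) * h"
      by (simp add: fold_pos_def) (simp add: h(2) algebra_simps)
  qed
qed

lemma lap_d_eq_lap_h:
  assumes "\<And>i' j' k'. \<bar>i' - i\<bar> \<le> 1 \<Longrightarrow> \<bar>j' - j\<bar> \<le> 1 \<Longrightarrow> \<bar>k' - k\<bar> \<le> 1 \<Longrightarrow>
    A i' j' k' = g (node (dx, dy, dz) i' j' k')"
  shows "lap_d (dx, dy, dz) A i j k = lap_h dx dy dz g (node (dx, dy, dz) i j k)"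
  by (simp add: lap_d.simps second_difference lap_h_def diff2_def assms distrib_right left_diff_distrib)

section \<open>Consistency and error estimate on a fixed mesh\<close>

locale SH_grid = SH_solution lx ly lz \<epsilon> \<eta> u0 u + grid: box_grid lx ly lz Nx Ny Nz
  for lx ly lz \<epsilon> \<eta> :: real and u0 :: "point \<Rightarrow> real" and u :: "point \<Rightarrow> real \<Rightarrow> real" and Nx Ny Nz :: nat +
  assumes N2: "Nx > 2" "Ny > 2" "Nz > 2"
begin

abbreviation gnode :: "int \<Rightarrow> int \<Rightarrow> int \<Rightarrow> point" where "gnode \<equiv> node (grid.dx, grid.dy, grid.dz)"

definition exact_grid :: "real \<Rightarrow> gridfun" where
  "exact_grid t i j k = u (gnode i j k) t"

definition mesh_sq :: real where "mesh_sq = grid.dx^2 + grid.dy^2 + grid.dz^2"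

lemma dpos: "grid.dx > 0" "grid.dy > 0" "grid.dz > 0"
  using lx ly lz N2 by simp_all

lemma node_dom_x:
  assumes "(i, j, k) \<in> grid grid.N"
  shows "gnode i j k \<in> dom_x"
proof -
  have "0 \<le> real_of_int i * (l / real N) \<and> real_of_int i * (l / real N) \<le> l"
    if "0 \<le> i" "i \<le> int N" "N > 2" "l > 0" for i l N
  proof -
    have "real_of_int i \<le> real N" using that by linarith
    then have "real_of_int i * l \<le> real N * l" using that by (intro mult_right_mono) auto
    then show ?thesis using that by (simp add: field_simps)
  qed
  then show ?thesis using assms N2 lx ly lz by (simp add: dom_x_iff)
qed

text \<open>The bilaplacian stencil reaches two cells outwards; with more than two cells per axis it
  stays strictly inside \<open>refl_box\<close>.\<close>

lemma node_stencil:
  assumes g: "(i, j, k) \<in> grid grid.N"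
    and xyz: "\<bar>x\<bar> \<le> 2 * grid.dx" "\<bar>y\<bar> \<le> 2 * grid.dy" "\<bar>z\<bar> \<le> 2 * grid.dz"
  shows "gnode i j k + (x, y, z) \<in> refl_box"
proof -
  have "2 * grid.dx < lx" "2 * grid.dy < ly" "2 * grid.dz < lz"
    using N2 lx ly lz by (simp_all add: field_simps)
  then show ?thesis using node_dom_x[OF g] xyz by (auto simp: dom_x_iff refl_box_def)
qed

text \<open>The ghost values produced by the Neumann extension are samples of the smooth reflected
  solution, so nodes on the faces need no separate treatment.\<close>

lemma ext_exact_grid:
  assumes "- 2 \<le> i" "i \<le> int Nx + 2" "- 2 \<le> j" "j \<le> int Ny + 2" "- 2 \<le> k" "k \<le> int Nz + 2"
  shows "grid.ext (exact_grid t) i j k = refl_deriv t 0 0 0 (gnode i j k)"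
proof -
  have "fold_pos lx (real_of_int i * grid.dx) = real_of_int (fold_index Nx i) * grid.dx"
    "fold_pos ly (real_of_int j * grid.dy) = real_of_int (fold_index Ny j) * grid.dy"
    "fold_pos lz (real_of_int k * grid.dz) = real_of_int (fold_index Nz k) * grid.dz"
    by (rule fold_pos_node; use assms N2 lx ly lz in linarith)+
  then show ?thesis
    by (simp only: neumann_ext.simps exact_grid_def refl_deriv_def node.simps prod.case power_0 mult_1_left u_deriv_0 u_xt_def)
qed

lemma Lap_ext_exact_grid:
  assumes "- 1 \<le> i" "i \<le> int Nx + 1" "- 1 \<le> j" "j \<le> int Ny + 1" "- 1 \<le> k" "k \<le> int Nz + 1"
  shows "grid.Lap (grid.ext (exact_grid t)) i j k = lap_h grid.dx grid.dy grid.dz (refl_deriv t 0 0 0) (gnode i j k)"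
  by (rule lap_d_eq_lap_h, rule ext_exact_grid) (use assms in auto)

lemma Lap_Lap_ext_exact_grid:
  assumes "(i, j, k) \<in> grid grid.N"
  shows "grid.Lap (grid.Lap (grid.ext (exact_grid t))) i j k
    = lap_h grid.dx grid.dy grid.dz (lap_h grid.dx grid.dy grid.dz (refl_deriv t 0 0 0)) (gnode i j k)"
  by (rule lap_d_eq_lap_h, rule Lap_ext_exact_grid) (use assms in auto)

context
  fixes B T :: real
  assumes B: "\<And>a b c x t. a + b + c \<le> 6 \<Longrightarrow> x \<in> dom_x \<Longrightarrow> t \<in> {0..T} \<Longrightarrow> \<bar>u_deriv a b c (x, t)\<bar> \<le> B"
begin

lemma Lap_consistent:
  assumes t: "t \<in> {0..T}" and g: "(i, j, k) \<in> grid grid.N"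
  shows "\<bar>grid.Lap (grid.ext (exact_grid t)) i j k - u_lap (gnode i j k, t)\<bar> \<le> B * mesh_sq / 12"
proof -
  interpret partials "refl_deriv t" refl_box B
    using t B by (intro refl_deriv_partials) auto
  have "\<bar>lap_h grid.dx grid.dy grid.dz (refl_deriv t 0 0 0) (gnode i j k)
      - (refl_deriv t 2 0 0 (gnode i j k) + refl_deriv t 0 2 0 (gnode i j k) + refl_deriv t 0 0 2 (gnode i j k))\<bar> \<le> B * mesh_sq / 12"
    unfolding mesh_sq_def by (rule lap_h_consistent[OF dpos node_stencil[OF g]])
  moreover have "grid.Lap (grid.ext (exact_grid t)) i j k = lap_h grid.dx grid.dy grid.dz (refl_deriv t 0 0 0) (gnode i j k)"
    by (rule Lap_ext_exact_grid) (use g in auto)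
  ultimately show ?thesis by (simp add: refl_deriv_inside[OF node_dom_x[OF g]] u_lap_def del: node.simps)
qed

lemma Lap_Lap_consistent:
  assumes t: "t \<in> {0..T}" and g: "(i, j, k) \<in> grid grid.N"
  shows "\<bar>grid.Lap (grid.Lap (grid.ext (exact_grid t))) i j k - u_bilap (gnode i j k, t)\<bar> \<le> B * mesh_sq / 2"
proof -
  interpret partials "refl_deriv t" refl_box B
    using t B by (intro refl_deriv_partials) auto
  show ?thesis
    using lap_h_lap_h_consistent[OF dpos node_stencil[OF g]]
    by (simp add: Lap_Lap_ext_exact_grid[OF g] refl_deriv_inside[OF node_dom_x[OF g]] u_bilap_def mesh_sq_def del: node.simps)
qed

text \<open>Independent of the mesh, since \<open>Lap\<close> differs from \<open>u_lap\<close> by a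
  multiple of \<open>mesh_sq\<close>, which never exceeds \<open>lx^2 + ly^2 + lz^2\<close>.\<close>

lemma exact_grid_bound:
  assumes t: "t \<in> {0..T}" and g: "(i, j, k) \<in> grid grid.N"
  shows "\<bar>exact_grid t i j k\<bar> \<le> B" "\<bar>grid.Lap (grid.ext (exact_grid t)) i j k\<bar> \<le> 3 * B + B * (lx^2 + ly^2 + lz^2) / 12"
proof -
  have n: "gnode i j k \<in> dom_x" by (rule node_dom_x[OF g])
  show "\<bar>exact_grid t i j k\<bar> \<le> B" using B[of 0 0 0, OF _ n t] by (simp add: u_deriv_0 u_xt_def exact_grid_def)
  have "B \<ge> 0" using B[of 0 0 0, OF _ n t] by simp
  have "(m / real n)^2 \<le> m^2" if "n > 2" for m and n :: nat
  proof -
    have "1 \<le> (real n)^2" using that by (simp add: one_le_power)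
    then have "m^2 / (real n)^2 \<le> m^2 / 1" using that by (intro divide_left_mono) auto
    then show ?thesis by (simp add: power_divide)
  qed
  then have "mesh_sq \<le> lx^2 + ly^2 + lz^2" unfolding mesh_sq_def using N2 by (intro add_mono) auto
  then have "B * mesh_sq / 12 \<le> B * (lx^2 + ly^2 + lz^2) / 12"
    using \<open>B \<ge> 0\<close> by (intro divide_right_mono mult_left_mono) auto
  moreover have "\<bar>u_lap (gnode i j k, t)\<bar> \<le> 3 * B"
    using B[of 2 0 0, OF _ n t] B[of 0 2 0, OF _ n t] B[of 0 0 2, OF _ n t] unfolding u_lap_def by linarith
  ultimately show "\<bar>grid.Lap (grid.ext (exact_grid t)) i j k\<bar> \<le> 3 * B + B * (lx^2 + ly^2 + lz^2) / 12"
    using Lap_consistent[OF t g] by linarith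
qed

text \<open>Bounds the initial energy, and with it \<open>M\<close>, uniformly in the mesh. The
  gradient term enters the energy with a minus sign and is dropped.\<close>

lemma H_d_bound:
  assumes T: "T \<ge> 0" and U: "\<And>i j k. (i, j, k) \<in> grid grid.N \<Longrightarrow> U i j k = exact_grid 0 i j k"
  shows "H_d \<epsilon> \<eta> grid.l grid.N U
    \<le> (B^4 / 4 + \<bar>1 - \<eta>\<bar> / 2 * B^2 + \<epsilon> / 2 * (3 * B + B * (lx^2 + ly^2 + lz^2) / 12)^2) * vol grid.l"
    (is "_ \<le> ?K * _")
proof -
  \<comment> \<open>Agreement is known at grid indices only, but the extension reads no
    others.\<close>
  have "grid.ext U i j k = grid.ext (exact_grid 0) i j k" for i j k
  proof -
    have fi: "0 \<le> fold_index n m \<and> fold_index n m \<le> int n" if "n > 2" for n m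
    proof -
      have "0 \<le> m mod (2 * int n)" "m mod (2 * int n) < 2 * int n" using that by auto
      then show ?thesis by (simp add: fold_index_def Let_def)
    qed
    show ?thesis unfolding neumann_ext.simps by (rule U) (use fi N2 in simp)
  qed
  then have ext: "grid.ext U = grid.ext (exact_grid 0)" by (intro HOL.ext)
  have "grid.energy (\<lambda>x. x^4 / 4) \<epsilon> \<eta> (grid.ext U) \<le> grid.gsum (\<lambda>i j k. ?K)"
    unfolding grid.energy_def ext
  proof (rule grid.gsum_mono)
    fix i j k assume g: "(i, j, k) \<in> grid grid.N"
    let ?V = "grid.ext (exact_grid 0) i j k"
    have e: "?V = exact_grid 0 i j k" by (rule grid.ext_grid[OF g])
    have "\<bar>?V\<bar> \<le> B" unfolding e using exact_grid_bound(1)[OF _ g] T by simp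
    then have "\<bar>?V\<bar> \<le> \<bar>B\<bar>" by linarith
    then have V2: "?V^2 \<le> B^2" by (simp only: abs_le_square_iff)
    then have "(?V^2)^2 \<le> (B^2)^2" by (rule power_mono) simp
    then have V4: "?V^4 \<le> B^4" by simp
    have "(1 - \<eta>) / 2 * ?V^2 \<le> \<bar>1 - \<eta>\<bar> / 2 * ?V^2"
      by (intro mult_right_mono divide_right_mono abs_ge_self) simp_all
    also have "\<dots> \<le> \<bar>1 - \<eta>\<bar> / 2 * B^2" by (intro mult_left_mono V2) auto
    finally have e2: "(1 - \<eta>) / 2 * ?V^2 \<le> \<bar>1 - \<eta>\<bar> / 2 * B^2" .
    have "\<bar>grid.Lap (grid.ext (exact_grid 0)) i j k\<bar> \<le> \<bar>3 * B + B * (lx^2 + ly^2 + lz^2) / 12\<bar>"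
      using exact_grid_bound(2)[OF _ g, of 0] T by (intro order_trans[OF _ abs_ge_self]) auto
    then have "(grid.Lap (grid.ext (exact_grid 0)) i j k)^2 \<le> (3 * B + B * (lx^2 + ly^2 + lz^2) / 12)^2"
      by (simp only: abs_le_square_iff)
    then have "\<epsilon> / 2 * (grid.Lap (grid.ext (exact_grid 0)) i j k)^2 \<le> \<epsilon> / 2 * (3 * B + B * (lx^2 + ly^2 + lz^2) / 12)^2"
      using eps by (intro mult_left_mono) auto
    then show "?V^4 / 4 + (1 - \<eta>) / 2 * ?V^2 - grid.grad_prod (grid.ext (exact_grid 0)) (grid.ext (exact_grid 0)) i j k
       + \<epsilon> / 2 * (grid.Lap (grid.ext (exact_grid 0)) i j k)^2 \<le> ?K"
      using V4 e2 grid.grad_prod_self_nonneg[of "grid.ext (exact_grid 0)" i j k] by linarith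
  qed
  also have "\<dots> = real Nx * real Ny * real Nz * ?K" by (rule grid.gsum_const)
  finally have "grid.energy (\<lambda>x. x^4 / 4) \<epsilon> \<eta> (grid.ext U) * grid.cell \<le> real Nx * real Ny * real Nz * ?K * grid.cell"
    using grid.cell_pos by (intro mult_right_mono) auto
  also have "\<dots> = ?K * vol grid.l" unfolding grid.cell_count[symmetric] by (simp only: mult_ac)
  finally show ?thesis by (subst grid.H_d_eq_energy[of "\<lambda>x. x^4 / 4"]) auto
qed

text \<open>The equation is used at the new time \<open>t + dt\<close>: the implicit terms then have
  no error in time, while the difference quotient and each explicit term cost one time step,
  controlled by a time derivative.\<close>

lemma truncation_bound:
  assumes Bt: "\<And>x t. x \<in> dom_x \<Longrightarrow> t \<in> {0..T} \<Longrightarrow> \<bar>pd et u_xt (x, t)\<bar> \<le> Bt"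
    and Btt: "\<And>x t. x \<in> dom_x \<Longrightarrow> t \<in> {0..T} \<Longrightarrow> \<bar>pd et (pd et u_xt) (x, t)\<bar> \<le> Btt"
    and BtL: "\<And>x t. x \<in> dom_x \<Longrightarrow> t \<in> {0..T} \<Longrightarrow> \<bar>pd et u_lap (x, t)\<bar> \<le> BtL"
    and dt: "dt > 0" and t: "0 \<le> t" "t + dt \<le> T" and ab: "\<alpha> + \<beta> = 1 - \<eta>" and g: "(i, j, k) \<in> grid grid.N"
  shows "\<bar>(exact_grid (t + dt) i j k - exact_grid t i j k) / dt
     + ((exact_grid t i j k)^3 + \<alpha> * exact_grid (t + dt) i j k + \<beta> * exact_grid t i j k
       + \<epsilon> * grid.Lap (grid.Lap (grid.ext (exact_grid (t + dt)))) i j k + 2 * grid.Lap (grid.ext (exact_grid t)) i j k)\<bar>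
    \<le> (Btt + 3 * B^2 * Bt + \<bar>\<beta>\<bar> * Bt + 2 * BtL + \<epsilon> * B / 2 + B / 6) * (dt + mesh_sq)"
proof -
  let ?x = "gnode i j k" and ?s = "t + dt"
  have n: "?x \<in> dom_x" by (rule node_dom_x[OF g])
  have tT: "t \<in> {0..T}" "?s \<in> {0..T}" using t dt by auto
  have rT: "r \<in> {0..T}" if "t \<le> r" "r \<le> ?s" for r using that t by auto
  have duu: "u_xt differentiable_on cyl" using diff_u_deriv[of 0 0 0] by (simp add: u_deriv_0)
  define a where "a = u_xt (?x, t)"
  define b where "b = u_xt (?x, ?s)"
  have ea: "exact_grid t i j k = a" "exact_grid ?s i j k = b" by (simp_all add: exact_grid_def a_def b_def u_xt_def)
  have B0: "B \<ge> 0" "Bt \<ge> 0" "Btt \<ge> 0" "BtL \<ge> 0"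
    using B[of 0 0 0, OF _ n tT(1)] Bt[OF n tT(1)] Btt[OF n tT(1)] BtL[OF n tT(1)] by auto
  have aB: "\<bar>a\<bar> \<le> B" "\<bar>b\<bar> \<le> B"
    using B[of 0 0 0, OF _ n tT(1)] B[of 0 0 0, OF _ n tT(2)] by (simp_all add: u_deriv_0 a_def b_def)
  have ba: "\<bar>b - a\<bar> \<le> Bt * dt"
    using time_lipschitz(1)[OF duu n t(1), of ?s Bt] Bt[OF n rT] dt by (simp add: a_def b_def)
  obtain r where r: "t < r" "r < ?s" "b - a = dt * pd et u_xt (?x, r)"
    using time_lipschitz(2)[OF duu n t(1), of ?s Bt] Bt[OF n rT] dt by (auto simp: a_def b_def)
  have "\<bar>pd et u_xt (?x, ?s) - pd et u_xt (?x, r)\<bar> \<le> Btt * (?s - r)"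
    using r t by (intro time_lipschitz(1)[OF diff_dt n] Btt[OF n rT]) auto
  also have "\<dots> \<le> Btt * dt" using r B0 by (intro mult_left_mono) auto
  finally have T1: "\<bar>(b - a) / dt - pd et u_xt (?x, ?s)\<bar> \<le> Btt * dt"
    using r(3) dt by (simp add: abs_minus_commute)
  have T2: "\<bar>u_lap (?x, ?s) - u_lap (?x, t)\<bar> \<le> BtL * dt"
    using time_lipschitz(1)[OF diff_u_lap n t(1), of ?s BtL] BtL[OF n rT] dt by simp
  have T3: "\<bar>a^3 - b^3\<bar> \<le> 3 * B^2 * (Bt * dt)"
  proof -
    have "\<bar>b^2 + b * a + a^2\<bar> \<le> B^2 + B * B + B^2"
    proof -
      have "\<bar>b^2\<bar> \<le> B^2" "\<bar>a^2\<bar> \<le> B^2" using aB by (simp_all add: abs_le_square_iff[symmetric])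
      moreover have "\<bar>b * a\<bar> \<le> B * B" unfolding abs_mult using aB by (intro mult_mono) auto
      ultimately show ?thesis by linarith
    qed
    then have "\<bar>b^2 + b * a + a^2\<bar> * \<bar>b - a\<bar> \<le> (B^2 + B * B + B^2) * (Bt * dt)"
      using ba by (intro mult_mono) auto
    moreover have "\<bar>a^3 - b^3\<bar> = \<bar>b^2 + b * a + a^2\<bar> * \<bar>b - a\<bar>"
    proof -
      have "a^3 - b^3 = - ((b^2 + b * a + a^2) * (b - a))"
        by (simp add: algebra_simps power2_eq_square power3_eq_cube)
      then show ?thesis by (simp only: abs_minus_cancel abs_mult)
    qed
    moreover have "B^2 + B * B + B^2 = 3 * B^2" by (simp add: power2_eq_square)
    ultimately show ?thesis by (simp only:)
  qed
  have T4: "\<bar>\<beta> * (a - b)\<bar> \<le> \<bar>\<beta>\<bar> * (Bt * dt)"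
    unfolding abs_mult using ba by (intro mult_left_mono) (auto simp: abs_minus_commute)
  let ?LL = "grid.Lap (grid.Lap (grid.ext (exact_grid ?s))) i j k" and ?L = "grid.Lap (grid.ext (exact_grid t)) i j k"
  have T5: "\<bar>\<epsilon> * (?LL - u_bilap (?x, ?s))\<bar> \<le> \<epsilon> * (B * mesh_sq / 2)"
    unfolding abs_mult using Lap_Lap_consistent[OF tT(2) g] eps by (intro mult_mono) auto
  have T6: "\<bar>?L - u_lap (?x, t)\<bar> \<le> B * mesh_sq / 12"
    by (rule Lap_consistent[OF tT(1) g])
  have "pd et u_xt (?x, ?s) + b^3 + (1 - \<eta>) * b + \<epsilon> * u_bilap (?x, ?s) + 2 * u_lap (?x, ?s) = 0"
    using pde[of "(?x, ?s)"] n t dt by (simp add: cyl_def b_def del: node.simps)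
  \<comment> \<open>Subtracting the equation at time \<open>?s\<close> pairs each term with its
    exact counterpart. The explicit Laplacian is compared in two moves, in space at time
    \<open>t\<close> and then in time.\<close>
  then have eq: "(b - a) / dt + (a^3 + \<alpha> * b + \<beta> * a + \<epsilon> * ?LL + 2 * ?L)
    = ((b - a) / dt - pd et u_xt (?x, ?s)) + (a^3 - b^3) + \<beta> * (a - b) + \<epsilon> * (?LL - u_bilap (?x, ?s))
      + 2 * (?L - u_lap (?x, t)) - 2 * (u_lap (?x, ?s) - u_lap (?x, t))"
    unfolding ab[symmetric] by (simp add: algebra_simps del: node.simps)
  have gen: "\<bar>x1 + x2 + x3 + x4 + 2 * x5 - 2 * x6\<bar> \<le> y1 + y2 + y3 + y4 + 2 * y5 + 2 * y6"
    if "\<bar>x1\<bar> \<le> y1" "\<bar>x2\<bar> \<le> y2" "\<bar>x3\<bar> \<le> y3" "\<bar>x4\<bar> \<le> y4" "\<bar>x5\<bar> \<le> y5" "\<bar>x6\<bar> \<le> y6"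
    for x1 x2 x3 x4 x5 x6 y1 y2 y3 y4 y5 y6 :: real
    using that by linarith
  have "\<bar>(b - a) / dt + (a^3 + \<alpha> * b + \<beta> * a + \<epsilon> * ?LL + 2 * ?L)\<bar>
    \<le> Btt * dt + 3 * B^2 * (Bt * dt) + \<bar>\<beta>\<bar> * (Bt * dt) + \<epsilon> * (B * mesh_sq / 2) + 2 * (B * mesh_sq / 12) + 2 * (BtL * dt)"
    unfolding eq by (rule gen[OF T1 T3 T4 T5 T6 T2])
  also have "\<dots> = (Btt + 3 * B^2 * Bt + \<bar>\<beta>\<bar> * Bt + 2 * BtL) * dt + (\<epsilon> * B / 2 + B / 6) * mesh_sq"
    by (simp add: algebra_simps)
  also have "\<dots> \<le> (Btt + 3 * B^2 * Bt + \<bar>\<beta>\<bar> * Bt + 2 * BtL + (\<epsilon> * B / 2 + B / 6)) * (dt + mesh_sq)"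
  proof -
    have "Btt + 3 * B^2 * Bt + \<bar>\<beta>\<bar> * Bt + 2 * BtL \<ge> 0" "\<epsilon> * B / 2 + B / 6 \<ge> 0"
      using B0 eps by (intro add_nonneg_nonneg mult_nonneg_nonneg divide_nonneg_nonneg; simp)+
    moreover have "mesh_sq \<ge> 0" by (simp add: mesh_sq_def)
    moreover have "p * x + q * y \<le> (p + q) * (x + y)" if "p \<ge> 0" "q \<ge> 0" "x \<ge> 0" "y \<ge> 0" for p q x y :: real
      using that by (simp add: algebra_simps)
    ultimately show ?thesis using dt by simp
  qed
  finally show ?thesis unfolding ea by (simp only: add.assoc)
qed

end

text \<open>\<open>A\<close> and \<open>K\<close> contain no mesh widths. The recursion uses
  unweighted sums; the cell count \<open>n3\<close> in its source term finally meets the cell volume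
  and gives the volume of the box.\<close>

lemma error_bound:
  assumes B: "\<And>a b c x t. a + b + c \<le> 6 \<Longrightarrow> x \<in> dom_x \<Longrightarrow> t \<in> {0..T} \<Longrightarrow> \<bar>u_deriv a b c (x, t)\<bar> \<le> B"
    and Bt: "\<And>x t. x \<in> dom_x \<Longrightarrow> t \<in> {0..T} \<Longrightarrow> \<bar>pd et u_xt (x, t)\<bar> \<le> Bt"
    and Btt: "\<And>x t. x \<in> dom_x \<Longrightarrow> t \<in> {0..T} \<Longrightarrow> \<bar>pd et (pd et u_xt) (x, t)\<bar> \<le> Btt"
    and BtL: "\<And>x t. x \<in> dom_x \<Longrightarrow> t \<in> {0..T} \<Longrightarrow> \<bar>pd et u_lap (x, t)\<bar> \<le> BtL"
    and B0: "B \<ge> 0" "Bt \<ge> 0" "Btt \<ge> 0" "BtL \<ge> 0"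
    and dt: "dt > 0" and T: "real n * dt = T" and scheme: "SH_scheme \<epsilon> \<eta> grid.l grid.N dt U"
    and init: "\<And>i j k. (i, j, k) \<in> grid grid.N \<Longrightarrow> U 0 i j k = exact_grid 0 i j k"
    and M: "M \<ge> 0" "\<And>n i j k. (i, j, k) \<in> grid grid.N \<Longrightarrow> \<bar>U n i j k\<bar> \<le> M"
    and A: "A = M^2 + M * B + B^2 + \<bar>1 - \<eta>\<bar> + 1" and dtA: "dt * A \<le> 1 / 2"
    and K: "K = Btt + 3 * B^2 * Bt + \<bar>1 - \<eta>\<bar> * Bt + 2 * BtL + \<epsilon> * B / 2 + B / 6"
  shows "L2_norm_d grid.l grid.N (\<lambda>i j k. U n i j k - u (gnode i j k) (real n * dt))
    \<le> sqrt (2 * T * exp (2 * (A + (A + 2 / \<epsilon>)) * T) * vol grid.l) * K * (dt + mesh_sq)"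
proof -
  obtain \<alpha> \<beta> where ab: "\<alpha> \<ge> 0" "\<alpha> + \<beta> = 1 - \<eta>" "\<alpha> - \<beta> = \<bar>1 - \<eta>\<bar>" "\<bar>\<beta>\<bar> \<le> \<bar>1 - \<eta>\<bar>"
    and sch: "\<And>n i j k. (i, j, k) \<in> grid grid.N \<Longrightarrow> (grid.ext (U (Suc n)) i j k - grid.ext (U n) i j k) / dt =
      - ((grid.ext (U n) i j k)^3 + \<alpha> * grid.ext (U (Suc n)) i j k + \<beta> * grid.ext (U n) i j k
        + \<epsilon> * grid.Lap (grid.Lap (grid.ext (U (Suc n)))) i j k + 2 * grid.Lap (grid.ext (U n)) i j k)"
    using grid.scheme_on_extension[OF scheme] by metis
  define X where "X m = grid.ext (exact_grid (real m * dt))" for m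
  define V where "V m = grid.ext (U m)" for m
  define e where "e m = (\<lambda>i j k. V m i j k - X m i j k)" for m
  define E where "E m = grid.gsum (\<lambda>i j k. (e m i j k)^2)" for m
  define K0 where "K0 = M^2 + M * B + B^2"
  define \<tau>0 where "\<tau>0 = K * (dt + mesh_sq)"
  define n3 where "n3 = real Nx * real Ny * real Nz"
  have re: "grid.reflected (e m)" for m
    unfolding e_def V_def X_def by (intro grid.reflected_diff grid.reflected_ext)
  have Xg: "X m i j k = exact_grid (real m * dt) i j k" and Vg: "V m i j k = U m i j k"
    if "(i, j, k) \<in> grid grid.N" for m i j k
    unfolding X_def V_def by (rule grid.ext_grid[OF that])+
  have mesh_sq: "mesh_sq \<ge> 0" by (simp add: mesh_sq_def)
  have A0: "A \<ge> 0" using M(1) B0 by (simp add: A)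
  have T0: "T \<ge> 0" using T dt by (metis mult_nonneg_nonneg of_nat_0_le_iff less_imp_le)
  have step: "(1 - dt * A) * E (Suc m) \<le> (1 + dt * (A + 2 / \<epsilon>)) * E m + dt * (\<tau>0^2 * n3)" if m: "m < n" for m
  proof -
    have "real (Suc m) * dt \<le> real n * dt" using m dt by (intro mult_right_mono) auto
    then have tm: "0 \<le> real m * dt" "real m * dt + dt \<le> T" "real (Suc m) * dt = real m * dt + dt"
      using T dt by (auto simp: algebra_simps)
    define \<rho> where "\<rho> i j k = (X (Suc m) i j k - X m i j k) / dt + ((X m i j k)^3 + \<alpha> * X (Suc m) i j k
      + \<beta> * X m i j k + \<epsilon> * grid.Lap (grid.Lap (X (Suc m))) i j k + 2 * grid.Lap (X m) i j k)" for i j k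
    \<comment> \<open>The cofactor of \<open>v - x\<close> in \<open>v^3 - x^3\<close>; bounding it
      takes pointwise bounds on both the numerical and the exact solution.\<close>
    define q where "q i j k = (V m i j k)^2 + V m i j k * X m i j k + (X m i j k)^2" for i j k
    have "(1 - dt * (K0 + \<bar>\<beta>\<bar> + 1)) * E (Suc m) \<le> (1 + dt * (K0 + \<bar>\<beta>\<bar> + 2 / \<epsilon>)) * E m + dt * (\<tau>0^2 * n3)"
      unfolding E_def n3_def
    proof (rule grid.error_step[OF re re eps dt ab(1), where q = q and \<tau> = \<rho>])
      fix i j k assume g: "(i, j, k) \<in> grid grid.N"
      have v: "\<bar>V m i j k\<bar> \<le> M" unfolding Vg[OF g] by (rule M(2)[OF g])
      have x: "\<bar>X m i j k\<bar> \<le> B"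
        unfolding Xg[OF g] using tm dt by (intro exact_grid_bound(1)[OF B _ g]) auto
      have "(V m i j k)^2 \<le> M^2" "(X m i j k)^2 \<le> B^2"
        using v x M(1) B0(1) by (simp_all add: abs_le_square_iff[symmetric])
      moreover have "\<bar>V m i j k * X m i j k\<bar> \<le> M * B"
        unfolding abs_mult using v x M(1) by (intro mult_mono) auto
      ultimately show "\<bar>q i j k\<bar> \<le> K0"
        unfolding q_def K0_def using zero_le_power2[of "V m i j k"] zero_le_power2[of "X m i j k"] by linarith
      have "\<bar>\<rho> i j k\<bar> \<le> (Btt + 3 * B^2 * Bt + \<bar>\<beta>\<bar> * Bt + 2 * BtL + \<epsilon> * B / 2 + B / 6) * (dt + mesh_sq)"
        unfolding \<rho>_def Xg[OF g] tm(3)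
        using truncation_bound[OF B Bt Btt BtL dt tm(1,2) ab(2) g]
        by (simp add: X_def tm(3)[symmetric] del: of_nat_Suc)
      also have "\<dots> \<le> \<tau>0"
        unfolding \<tau>0_def K using ab(4) B0 dt mesh_sq by (intro mult_right_mono add_mono) auto
      finally show "\<bar>\<rho> i j k\<bar> \<le> \<tau>0" .
      have Le: "grid.Lap (e m') i j k = grid.Lap (V m') i j k - grid.Lap (X m') i j k" for m' i j k
        unfolding e_def by (rule grid.Lap_diff)
      have "grid.Lap (e (Suc m)) = (\<lambda>i j k. grid.Lap (V (Suc m)) i j k - grid.Lap (X (Suc m)) i j k)"
        by (intro HOL.ext Le)
      then have LLe: "grid.Lap (grid.Lap (e (Suc m))) i j k
          = grid.Lap (grid.Lap (V (Suc m))) i j k - grid.Lap (grid.Lap (X (Suc m))) i j k"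
        by (simp only: grid.Lap_diff)
      have cube: "(V m i j k)^3 - (X m i j k)^3 = q i j k * e m i j k"
        by (simp add: q_def e_def algebra_simps power2_eq_square power3_eq_cube)
      have "(e (Suc m) i j k - e m i j k) / dt
          = (V (Suc m) i j k - V m i j k) / dt - (X (Suc m) i j k - X m i j k) / dt"
        by (simp add: e_def diff_divide_distrib)
      also have "(V (Suc m) i j k - V m i j k) / dt = - ((V m i j k)^3 + \<alpha> * V (Suc m) i j k + \<beta> * V m i j k
        + \<epsilon> * grid.Lap (grid.Lap (V (Suc m))) i j k + 2 * grid.Lap (V m) i j k)"
        unfolding V_def by (rule sch[OF g])
      finally show "(e (Suc m) i j k - e m i j k) / dt =
        - (q i j k * e m i j k + \<alpha> * e (Suc m) i j k + \<beta> * e m i j k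
          + \<epsilon> * grid.Lap (grid.Lap (e (Suc m))) i j k + 2 * grid.Lap (e m) i j k) - \<rho> i j k"
        unfolding LLe Le cube[symmetric] \<rho>_def by (simp add: e_def algebra_simps)
    qed
    moreover have E0: "E m' \<ge> 0" for m' unfolding E_def by (intro grid.gsum_nonneg) auto
    \<comment> \<open>\<open>\<bar>\<beta>\<bar> \<le> \<bar>1 - \<eta>\<bar>\<close> lets one
      \<open>A\<close> serve both cases of the scheme; its summand 1 is the one from the truncation
      error.\<close>
    moreover have le: "K0 + \<bar>\<beta>\<bar> \<le> A - 1" "K0 + \<bar>\<beta>\<bar> \<le> A" using ab(4) by (auto simp: A K0_def)
    moreover have "(1 - dt * A) * E (Suc m) \<le> (1 - dt * (K0 + \<bar>\<beta>\<bar> + 1)) * E (Suc m)"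
      using le dt E0 by (intro mult_right_mono) auto
    moreover have "(1 + dt * (K0 + \<bar>\<beta>\<bar> + 2 / \<epsilon>)) * E m \<le> (1 + dt * (A + 2 / \<epsilon>)) * E m"
      using le dt E0 by (intro mult_right_mono add_left_mono mult_left_mono) auto
    ultimately show ?thesis by linarith
  qed
  have "E 0 = grid.gsum (\<lambda>i j k. 0)"
    unfolding E_def by (rule grid.gsum_cong) (simp add: e_def Vg Xg init del: grid.simps)
  then have E00: "E 0 = 0" using grid.gsum_const[of 0] by simp
  have "E n \<le> 2 * (real n * dt) * (\<tau>0^2 * n3) * exp (2 * (A + (A + 2 / \<epsilon>)) * (real n * dt))"
  proof (rule discrete_gronwall[OF E00 _ A0 _ _ dt dtA step])
    show "0 \<le> E m" for m unfolding E_def by (intro grid.gsum_nonneg) auto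
    show "0 \<le> A + 2 / \<epsilon>" using A0 eps by simp
    show "0 \<le> \<tau>0^2 * n3" by (simp add: n3_def)
  qed
  then have En: "E n \<le> 2 * T * exp (2 * (A + (A + 2 / \<epsilon>)) * T) * n3 * \<tau>0^2"
    unfolding T by (simp add: mult_ac)
  have "L2_norm_d grid.l grid.N (\<lambda>i j k. U n i j k - u (gnode i j k) (real n * dt)) = sqrt (E n * grid.cell)"
  proof -
    have "grid.gsum (\<lambda>i j k. (U n i j k - u (gnode i j k) (real n * dt))^2 * grid.cell)
        = grid.gsum (\<lambda>i j k. (e n i j k)^2 * grid.cell)"
      by (rule grid.gsum_cong) (simp add: e_def Vg Xg exact_grid_def del: grid.simps node.simps vol.simps)
    then show ?thesis unfolding L2_norm_d_def grid.gsum_times_cell E_def by (simp only:)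
  qed
  also have "\<dots> \<le> sqrt (2 * T * exp (2 * (A + (A + 2 / \<epsilon>)) * T) * n3 * \<tau>0^2 * grid.cell)"
    using En grid.cell_pos by (intro real_sqrt_le_mono mult_right_mono) auto
  also have "2 * T * exp (2 * (A + (A + 2 / \<epsilon>)) * T) * n3 * \<tau>0^2 * grid.cell
      = (2 * T * exp (2 * (A + (A + 2 / \<epsilon>)) * T) * vol grid.l) * \<tau>0^2"
    unfolding grid.cell_count[symmetric] n3_def by (simp only: mult_ac)
  also have "sqrt \<dots> = sqrt (2 * T * exp (2 * (A + (A + 2 / \<epsilon>)) * T) * vol grid.l) * \<bar>\<tau>0\<bar>"
    by (simp only: real_sqrt_mult real_sqrt_abs)
  also have "\<bar>\<tau>0\<bar> = \<tau>0"
    unfolding \<tau>0_def K using B0 eps dt mesh_sq by (intro abs_of_nonneg mult_nonneg_nonneg add_nonneg_nonneg divide_nonneg_nonneg) auto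
  finally show ?thesis by (simp only: \<tau>0_def mult.assoc)
qed

end

section \<open>Mesh-independent constants and convergence\<close>

theorem theorem4p7:
  fixes lx ly lz \<epsilon> \<eta> \<zeta> C C' T :: real
    and u0 :: "real \<times> real \<times> real \<Rightarrow> real"
    and u :: "real \<times> real \<times> real \<Rightarrow> real \<Rightarrow> real"
  assumes lengths: "lx > 0" "ly > 0" "lz > 0"
    and eps: "\<epsilon> > 0"
    and exact: "SH_exact_solution \<epsilon> \<eta> (lx, ly, lz) u0 u"
    and smooth: "Ck_on 6 (\<lambda>(x, t). u x t) (Omega (lx, ly, lz) \<times> {0..})"
    and C: "discrete_sobolev_const (lx, ly, lz) C"
    and C': "sobolev_const (lx, ly, lz) C'"
    and zeta: "\<zeta> > 1 / \<epsilon> + \<eta> - 1"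
    and T: "T > 0"
  shows "\<exists>K \<delta>. \<delta> > 0 \<and>
    (\<forall>Nx Ny Nz :: nat. \<forall>dt dx dy dz M M' L :: real. \<forall>U :: nat \<Rightarrow> int \<Rightarrow> int \<Rightarrow> int \<Rightarrow> real.
       \<forall>n :: nat.
       Nx > 0 \<and> Ny > 0 \<and> Nz > 0 \<and>
       dx = lx / real Nx \<and> dy = ly / real Ny \<and> dz = lz / real Nz \<and>
       dt > 0 \<and> dt < \<delta> \<and> dx < \<delta> \<and> dy < \<delta> \<and> dz < \<delta> \<and>
       SH_scheme \<epsilon> \<eta> (lx, ly, lz) (Nx, Ny, Nz) dt U \<and>
       (\<forall>(i, j, k)\<in>grid (Nx, Ny, Nz). U 0 i j k = u0 (node (dx, dy, dz) i j k)) \<and>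
       M = M_const C \<epsilon> \<eta> \<zeta> (lx, ly, lz) (Nx, Ny, Nz) (U 0) \<and>
       M' = M'_const C C' \<epsilon> \<eta> \<zeta> (lx, ly, lz) (Nx, Ny, Nz) (U 0) u0 \<and>
       L = 3 * M'^2 - \<bar>1 - \<eta>\<bar> \<and> L \<noteq> 0 \<and>
       (L < 0 \<or> L > 0 \<and> dt < 2 / L) \<and>
       (3 * M^2 \<le> \<bar>1 - \<eta>\<bar> \<or> 3 * M^2 > \<bar>1 - \<eta>\<bar> \<and> dt \<le> 2 / (3 * M^2 - \<bar>1 - \<eta>\<bar>)) \<and>
       real n * dt = T
       \<longrightarrow> L2_norm_d (lx, ly, lz) (Nx, Ny, Nz)
             (\<lambda>i j k. U n i j k - u (node (dx, dy, dz) i j k) (real n * dt))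
           \<le> K * (dt + dx^2 + dy^2 + dz^2))"
proof -
  interpret sol: SH_solution lx ly lz \<epsilon> \<eta> u0 u
    using lengths eps exact smooth by unfold_locales
  obtain B where B: "B \<ge> 0"
    "\<And>a b c x t. a + b + c \<le> 6 \<Longrightarrow> x \<in> sol.dom_x \<Longrightarrow> t \<in> {0..T} \<Longrightarrow> \<bar>sol.u_deriv a b c (x, t)\<bar> \<le> B"
    using sol.u_deriv_bound[of T] by blast
  obtain Bt Btt BtL where Bt: "Bt \<ge> 0" "\<And>x t. x \<in> sol.dom_x \<Longrightarrow> t \<in> {0..T} \<Longrightarrow> \<bar>ddir sol.cyl sol.et sol.u_xt (x, t)\<bar> \<le> Bt"
    and Btt: "Btt \<ge> 0" "\<And>x t. x \<in> sol.dom_x \<Longrightarrow> t \<in> {0..T} \<Longrightarrow>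
      \<bar>ddir sol.cyl sol.et (ddir sol.cyl sol.et sol.u_xt) (x, t)\<bar> \<le> Btt"
    and BtL: "BtL \<ge> 0" "\<And>x t. x \<in> sol.dom_x \<Longrightarrow> t \<in> {0..T} \<Longrightarrow> \<bar>ddir sol.cyl sol.et sol.u_lap (x, t)\<bar> \<le> BtL"
    using sol.time_derivative_bounds[of T] by blast
  define Hb where "Hb = (B^4 / 4 + \<bar>1 - \<eta>\<bar> / 2 * B^2
    + \<epsilon> / 2 * (3 * B + B * (lx^2 + ly^2 + lz^2) / 12)^2) * vol (lx, ly, lz)"
  \<comment> \<open>\<open>M_const\<close> is monotone in the initial energy, so inserting the
    uniform bound \<open>Hb\<close> dominates \<open>M\<close> on every mesh below the
    threshold.\<close>
  define Mb where "Mb = max (sqrt (max 0 \<zeta>)) (sqrt (C^2 / C_const \<epsilon> \<eta> \<zeta> * (Hb + \<zeta>^2 / 4 * vol (lx, ly, lz))))"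
  have "0 \<le> sqrt (max 0 \<zeta>)" by simp
  then have Mb0: "Mb \<ge> 0" unfolding Mb_def by (rule max.coboundedI1)
  define A where "A = Mb^2 + Mb * B + B^2 + \<bar>1 - \<eta>\<bar> + 1"
  have "Mb * B \<ge> 0" using Mb0 B(1) by simp
  then have A: "A > 0" unfolding A_def using zero_le_power2[of Mb] zero_le_power2[of B] by linarith
  define K where "K = Btt + 3 * B^2 * Bt + \<bar>1 - \<eta>\<bar> * Bt + 2 * BtL + \<epsilon> * B / 2 + B / 6"
  define K' where "K' = sqrt (2 * T * exp (2 * (A + (A + 2 / \<epsilon>)) * T) * vol (lx, ly, lz)) * K"
  \<comment> \<open>A third of each length forces more than two cells per axis;
    \<open>1 / (2 * A)\<close> gives \<open>dt * A \<le> 1/2\<close>, as the Gronwall inequality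
    requires.\<close>
  define \<delta> where "\<delta> = Min {lx / 3, ly / 3, lz / 3, 1 / (2 * A)}"
  have \<delta>: "\<delta> > 0" "\<delta> \<le> lx / 3" "\<delta> \<le> ly / 3" "\<delta> \<le> lz / 3" "\<delta> \<le> 1 / (2 * A)"
    using lengths A by (auto simp: \<delta>_def)
  show ?thesis
  proof (rule exI[of _ K'], rule exI[of _ \<delta>], intro conjI allI impI \<delta>(1); elim conjE)
    fix Nx Ny Nz :: nat and dt dx dy dz M M' L :: real and U :: "nat \<Rightarrow> int \<Rightarrow> int \<Rightarrow> int \<Rightarrow> real" and n :: nat
    assume N: "Nx > 0" "Ny > 0" "Nz > 0" and d: "dx = lx / real Nx" "dy = ly / real Ny" "dz = lz / real Nz"
      and dt: "dt > 0" "dt < \<delta>" and small: "dx < \<delta>" "dy < \<delta>" "dz < \<delta>"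
      and scheme: "SH_scheme \<epsilon> \<eta> (lx, ly, lz) (Nx, Ny, Nz) dt U"
      and init: "\<forall>(i, j, k)\<in>grid (Nx, Ny, Nz). U 0 i j k = u0 (node (dx, dy, dz) i j k)"
      and M: "M = M_const C \<epsilon> \<eta> \<zeta> (lx, ly, lz) (Nx, Ny, Nz) (U 0)"
      and cond: "3 * M^2 \<le> \<bar>1 - \<eta>\<bar> \<or> 3 * M^2 > \<bar>1 - \<eta>\<bar> \<and> dt \<le> 2 / (3 * M^2 - \<bar>1 - \<eta>\<bar>)"
      and nT: "real n * dt = T"
    have big: "m > 2" if "l / real m < l / 3" "l > 0" "m > 0" for l :: real and m :: nat
      using that by (simp add: field_simps)
    have N2: "Nx > 2" "Ny > 2" "Nz > 2"
      using big[of lx Nx] big[of ly Ny] big[of lz Nz] N d small \<delta> lengths by linarith+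
    interpret g: SH_grid lx ly lz \<epsilon> \<eta> u0 u Nx Ny Nz
      using N N2 lengths by unfold_locales
    have u0: "U 0 i j k = g.exact_grid 0 i j k" if "(i, j, k) \<in> grid (Nx, Ny, Nz)" for i j k
    proof -
      have "u0 (g.gnode i j k) = u (g.gnode i j k) 0"
        using exact g.node_dom_x[OF that] unfolding SH_exact_solution_def sol.dom_x_def by simp
      then show ?thesis using init that d by (auto simp: g.exact_grid_def simp del: node.simps)
    qed
    have "H_d \<epsilon> \<eta> (lx, ly, lz) (Nx, Ny, Nz) (U 0) \<le> Hb"
      unfolding Hb_def using T by (intro g.H_d_bound[OF B(2) _ u0]) auto
    then have "M \<le> Mb"
      unfolding M M_const_def Mb_def using C_const_coercive(1)[OF eps zeta]
      by (intro max.mono real_sqrt_le_mono mult_left_mono) auto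
    then have Ub: "\<bar>U m i j k\<bar> \<le> Mb" if "(i, j, k) \<in> grid (Nx, Ny, Nz)" for m i j k
      using g.grid.numerical_bound[OF C eps zeta dt(1) scheme M cond that, of m] by linarith
    have "dt * A \<le> 1 / (2 * A) * A" using dt \<delta> A by (intro mult_right_mono) auto
    then have dtA: "dt * A \<le> 1 / 2" using A by simp
    have "L2_norm_d (lx, ly, lz) (Nx, Ny, Nz) (\<lambda>i j k. U n i j k - u (g.gnode i j k) (real n * dt))
        \<le> sqrt (2 * T * exp (2 * (A + (A + 2 / \<epsilon>)) * T) * vol (lx, ly, lz)) * K * (dt + g.mesh_sq)"
      by (rule g.error_bound[OF B(2) Bt(2) Btt(2) BtL(2) B(1) Bt(1) Btt(1) BtL(1) dt(1) nT scheme u0 Mb0 Ub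
            A_def dtA K_def])
    then show "L2_norm_d (lx, ly, lz) (Nx, Ny, Nz) (\<lambda>i j k. U n i j k - u (node (dx, dy, dz) i j k) (real n * dt))
        \<le> K' * (dt + dx^2 + dy^2 + dz^2)"
      unfolding K'_def g.mesh_sq_def d by (simp only: add.assoc)
  qed
qed

end
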